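(* Let $1<x<\infty$ and write $x=\cosh\frac{\delta}{2}$ with $\delta>0$. Then the image of $\rho'_x=c\circ\rho_x:G(3_1)\to SO^0(1,2)$ is a subgroup of $SO^0(1,2)$ isomorphic to the holonomy of the 2-dimensional hyperbolic orbifold $O^2_{2,3,\delta}$, where $O^2$ is an open disk and $\delta$ is the length of the closed geodesic at the end of $O^2$.
   Context: $G(3_1)=\langle a,b\mid aba=bab\rangle$ is the trefoil knot group. $H=\left(\frac{-1,1}{\mathbb R}\right)\cong M(2,\mathbb R)$ is the quaternion algebra with basis $1,i,j,ij$, where $i^2=-1$, $j^2=1$, $ij=-ji$; its norm-one group is $U_1=SL(2,\mathbb R)$; $H_0\cong E^{1,2}$ is the space of pure quaternions with the norm as quadratic form (Minkowski space). The homomorphism $c:SL(2,\mathbb R)\to SO^0(1,2)\cong \mathrm{Iso}^+(\mathbb H^2)$ is $c(A)(v)=Av\overline{A}$, where $\overline A$ is the quaternion conjugate. For $x>1$ the representation $\rho_x:G(3_1)\to SL(2,\mathbb R)$ is $$\rho_x(a)=x+\sqrt{x^2-1}\,j,\qquad \rho_x(b)=x-\frac12\sqrt{\frac{4x^2-3}{x^2-1}}\,i-\frac{2x^2-1}{2\sqrt{x^2-1}}\,j .$$ $O^2_{2,3,\delta}$ is the complete hyperbolic 2-orbifold of infinite area whose underlying space is an open disk, with exactly two cone points, of orders $2$ and $3$, and such that the closed geodesic going around its end has length $\delta$. *)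

theory Defs
  imports "HOL-Analysis.Analysis" "HOL-Algebra.Group"
begin

section \<open>Groups given by generators and relations\<close>

text \<open>A letter \<open>(g, True)\<close> stands for the generator \<open>g\<close>, a letter \<open>(g, False)\<close> for its inverse.\<close>

type_synonym 'g word = "('g \<times> bool) list"

inductive pres_eq :: "('g word \<times> 'g word) set \<Rightarrow> 'g word \<Rightarrow> 'g word \<Rightarrow> bool"
  for R where
  refl: "pres_eq R u u"
| sym: "pres_eq R u v \<Longrightarrow> pres_eq R v u"
| trans: "pres_eq R u v \<Longrightarrow> pres_eq R v w \<Longrightarrow> pres_eq R u w"
| app: "pres_eq R u u' \<Longrightarrow> pres_eq R v v' \<Longrightarrow> pres_eq R (u @ v) (u' @ v')"
| cancel: "pres_eq R [(g, e), (g, \<not> e)] []"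
| rel: "(u, v) \<in> R \<Longrightarrow> pres_eq R u v"

definition pres_class :: "('g word \<times> 'g word) set \<Rightarrow> 'g word \<Rightarrow> 'g word set" where
  "pres_class R u = {v. pres_eq R u v}"

definition presented_group :: "('g word \<times> 'g word) set \<Rightarrow> 'g word set monoid" where
  "presented_group R =
     \<lparr>carrier = range (pres_class R),
      mult = (\<lambda>S T. {w. \<exists>u\<in>S. \<exists>v\<in>T. pres_eq R (u @ v) w}),
      one = pres_class R []\<rparr>"

definition word_val :: "('h, 'm) monoid_scheme \<Rightarrow> ('g \<Rightarrow> 'h) \<Rightarrow> 'g word \<Rightarrow> 'h" where
  "word_val G f w =
     foldr (\<lambda>(g, e) y. (if e then f g else inv\<^bsub>G\<^esub> f g) \<otimes>\<^bsub>G\<^esub> y) w \<one>\<^bsub>G\<^esub>"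

text \<open>The map induced on a presented group by an assignment \<open>f\<close> of the generators. It is meaningful
  only if \<open>f\<close> respects the relations; see \<open>pres_lift_class\<close> below.\<close>

definition pres_lift :: "('h, 'm) monoid_scheme \<Rightarrow> ('g \<Rightarrow> 'h) \<Rightarrow> 'g word set \<Rightarrow> 'h" where
  "pres_lift G f S = the_elem (word_val G f ` S)"

lemma pres_class_eq_iff: "pres_class R u = pres_class R v \<longleftrightarrow> pres_eq R u v"
  unfolding pres_class_def by (blast intro: pres_eq.intros)

lemma pres_class_mult:
  "pres_class R u \<otimes>\<^bsub>presented_group R\<^esub> pres_class R v = pres_class R (u @ v)"
  unfolding pres_class_def presented_group_def
  by (auto intro: pres_eq.refl pres_eq.trans[OF pres_eq.app])

lemma pres_eq_inverse: "pres_eq R (rev (map (\<lambda>(g, e). (g, \<not> e)) u) @ u) []"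
proof (induction u)
  case Nil
  show ?case by (simp add: pres_eq.refl)
next
  case (Cons p u)
  obtain g e where p: "p = (g, e)" by (cases p)
  let ?i = "rev (map (\<lambda>(g, e). (g, \<not> e)) u)"
  have "pres_eq R ([(g, \<not> e), (g, e)]) []"
    using pres_eq.cancel[of R g "\<not> e"] by simp
  from pres_eq.app[OF pres_eq.app[OF pres_eq.refl[of R ?i] this] pres_eq.refl[of R u]]
  have "pres_eq R (?i @ [(g, \<not> e), (g, e)] @ u) (?i @ u)" by simp
  from pres_eq.trans[OF this Cons.IH] show ?case by (simp add: p)
qed

lemma group_presented_group: "group (presented_group R)"
proof (rule groupI)
  have carr: "S \<in> carrier (presented_group R) \<longleftrightarrow> (\<exists>u. S = pres_class R u)" for S
    by (auto simp: presented_group_def)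
  have one: "\<one>\<^bsub>presented_group R\<^esub> = pres_class R []"
    by (simp add: presented_group_def)
  show "S \<otimes>\<^bsub>presented_group R\<^esub> T \<in> carrier (presented_group R)"
    if "S \<in> carrier (presented_group R)" "T \<in> carrier (presented_group R)" for S T
    using that unfolding carr by (metis pres_class_mult)
  show "\<one>\<^bsub>presented_group R\<^esub> \<in> carrier (presented_group R)"
    unfolding carr one by blast
  show "S \<otimes>\<^bsub>presented_group R\<^esub> T \<otimes>\<^bsub>presented_group R\<^esub> U
      = S \<otimes>\<^bsub>presented_group R\<^esub> (T \<otimes>\<^bsub>presented_group R\<^esub> U)"
    if "S \<in> carrier (presented_group R)" "T \<in> carrier (presented_group R)"
      "U \<in> carrier (presented_group R)" for S T U
    using that unfolding carr by (auto simp: pres_class_mult)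
  show "\<one>\<^bsub>presented_group R\<^esub> \<otimes>\<^bsub>presented_group R\<^esub> S = S"
    if "S \<in> carrier (presented_group R)" for S
    using that unfolding carr one by (auto simp: pres_class_mult)
  show "\<exists>T\<in>carrier (presented_group R). T \<otimes>\<^bsub>presented_group R\<^esub> S = \<one>\<^bsub>presented_group R\<^esub>"
    if S: "S \<in> carrier (presented_group R)" for S
  proof -
    from S obtain u where "S = pres_class R u" unfolding carr by blast
    then have "pres_class R (rev (map (\<lambda>(g, e). (g, \<not> e)) u)) \<otimes>\<^bsub>presented_group R\<^esub> S
        = \<one>\<^bsub>presented_group R\<^esub>"
      by (simp add: pres_class_mult one pres_class_eq_iff pres_eq_inverse)
    then show ?thesis unfolding Bex_def carr by blast
  qed
qed

context group
begin

lemma word_val_closed: "range f \<subseteq> carrier G \<Longrightarrow> word_val G f w \<in> carrier G"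
proof (induction w)
  case (Cons p w)
  moreover assume "range f \<subseteq> carrier G"
  moreover from this have "f (fst p) \<in> carrier G" by auto
  ultimately show ?case by (cases p) (auto simp: word_val_def)
qed (simp add: word_val_def)

lemma word_val_append:
  assumes "range f \<subseteq> carrier G"
  shows "word_val G f (u @ v) = word_val G f u \<otimes> word_val G f v"
proof (induction u)
  case Nil
  show ?case using word_val_closed[OF assms, of v] by (simp add: word_val_def)
next
  case (Cons p u)
  have "word_val G f u \<in> carrier G" "word_val G f v \<in> carrier G"
    using word_val_closed[OF assms] by auto
  moreover have "f (fst p) \<in> carrier G" using assms by auto
  ultimately show ?case
    using Cons by (cases p) (auto simp: word_val_def m_assoc)
qed

lemma word_val_pres_eq:
  assumes f: "range f \<subseteq> carrier G"
    and R: "\<And>u v. (u, v) \<in> R \<Longrightarrow> word_val G f u = word_val G f v"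
    and "pres_eq R u v"
  shows "word_val G f u = word_val G f v"
  using assms(3)
proof induction
  case (cancel g e)
  have "f g \<in> carrier G" using f by auto
  then show ?case by (simp add: word_val_def)
next
  case (rel u v)
  then show ?case by (rule R)
qed (simp_all add: word_val_append[OF f])

lemma pres_lift_class:
  assumes f: "range f \<subseteq> carrier G"
    and R: "\<And>u v. (u, v) \<in> R \<Longrightarrow> word_val G f u = word_val G f v"
  shows "pres_lift G f (pres_class R u) = word_val G f u"
proof -
  have "word_val G f ` pres_class R u = {word_val G f u}"
  proof (intro equalityI subsetI)
    fix y assume "y \<in> word_val G f ` pres_class R u"
    then obtain v where v: "pres_eq R u v" "y = word_val G f v"
      by (auto simp: pres_class_def)
    have "word_val G f u = word_val G f v"
      by (rule word_val_pres_eq[OF f _ v(1)]) (rule R)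
    with v show "y \<in> {word_val G f u}" by simp
  qed (auto simp: pres_class_def pres_eq.refl)
  then show ?thesis by (simp add: pres_lift_def)
qed

lemma pres_lift_hom:
  assumes f: "range f \<subseteq> carrier G"
    and R: "\<And>u v. (u, v) \<in> R \<Longrightarrow> word_val G f u = word_val G f v"
  shows "pres_lift G f \<in> hom (presented_group R) G"
proof (rule homI)
  have carr: "S \<in> carrier (presented_group R) \<longleftrightarrow> (\<exists>u. S = pres_class R u)" for S
    by (auto simp: presented_group_def)
  show "pres_lift G f S \<in> carrier G" if "S \<in> carrier (presented_group R)" for S
    using that word_val_closed[OF f] unfolding carr by (auto simp: pres_lift_class[OF f R])
  show "pres_lift G f (S \<otimes>\<^bsub>presented_group R\<^esub> T) = pres_lift G f S \<otimes> pres_lift G f T"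
    if "S \<in> carrier (presented_group R)" "T \<in> carrier (presented_group R)" for S T
    using that unfolding carr
    by (auto simp: pres_class_mult pres_lift_class[OF f R] word_val_append[OF f])
qed

end

datatype trefoil_gen = gen_a | gen_b

definition trefoil_rels :: "(trefoil_gen word \<times> trefoil_gen word) set" where
  "trefoil_rels = {([(gen_a, True), (gen_b, True), (gen_a, True)],
                    [(gen_b, True), (gen_a, True), (gen_b, True)])}"

definition trefoil_group :: "trefoil_gen word set monoid" where
  "trefoil_group = presented_group trefoil_rels"


section \<open>The quaternion algebra with \<open>i\<^sup>2 = -1\<close> and \<open>j\<^sup>2 = 1\<close>\<close>

text \<open>Coordinates with respect to the basis \<open>1, i, j, ij\<close>.\<close>

datatype quat = Quat (q1: real) (qi: real) (qj: real) (qij: real)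

lemma quat_eq_iff: "p = q \<longleftrightarrow> q1 p = q1 q \<and> qi p = qi q \<and> qj p = qj q \<and> qij p = qij q"
  by (cases p; cases q) auto

instantiation quat :: real_algebra_1
begin

definition "0 = Quat 0 0 0 0"
definition "1 = Quat 1 0 0 0"
definition "p + q = Quat (q1 p + q1 q) (qi p + qi q) (qj p + qj q) (qij p + qij q)"
definition "- p = Quat (- q1 p) (- qi p) (- qj p) (- qij p)"
definition "p - q = Quat (q1 p - q1 q) (qi p - qi q) (qj p - qj q) (qij p - qij q)"
definition "r *\<^sub>R p = Quat (r * q1 p) (r * qi p) (r * qj p) (r * qij p)"
definition "p * q =
  Quat (q1 p * q1 q - qi p * qi q + qj p * qj q + qij p * qij q)
       (q1 p * qi q + qi p * q1 q - qj p * qij q + qij p * qj q)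
       (q1 p * qj q + qj p * q1 q - qi p * qij q + qij p * qi q)
       (q1 p * qij q + qij p * q1 q + qi p * qj q - qj p * qi q)"

instance
  by standard
    (simp_all add: quat_eq_iff zero_quat_def one_quat_def plus_quat_def uminus_quat_def
      minus_quat_def scaleR_quat_def times_quat_def algebra_simps)

end

lemmas quat_defs = zero_quat_def one_quat_def plus_quat_def uminus_quat_def
  minus_quat_def scaleR_quat_def times_quat_def

definition quat_i :: quat where "quat_i = Quat 0 1 0 0"
definition quat_j :: quat where "quat_j = Quat 0 0 1 0"

lemma quat_basis:
  "quat_i * quat_i = - 1" "quat_j * quat_j = 1" "quat_i * quat_j = - (quat_j * quat_i)"
  "Quat t x y z = t *\<^sub>R 1 + x *\<^sub>R quat_i + y *\<^sub>R quat_j + z *\<^sub>R (quat_i * quat_j)"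
  by (simp_all add: quat_i_def quat_j_def quat_defs)

definition quat_cnj :: "quat \<Rightarrow> quat" where
  "quat_cnj q = Quat (q1 q) (- qi q) (- qj q) (- qij q)"

definition quat_norm :: "quat \<Rightarrow> real" where
  "quat_norm q = q1 (q * quat_cnj q)"

lemma quat_mult_cnj: "q * quat_cnj q = of_real (quat_norm q)"
  by (simp add: quat_norm_def quat_cnj_def of_real_def quat_defs)

lemma quat_norm_eq: "quat_norm q = (q1 q)\<^sup>2 + (qi q)\<^sup>2 - (qj q)\<^sup>2 - (qij q)\<^sup>2"
  by (simp add: quat_norm_def quat_cnj_def quat_defs power2_eq_square)

lemma quat_norm_mult: "quat_norm (p * q) = quat_norm p * quat_norm q"
  by (simp add: quat_norm_eq quat_defs power2_eq_square algebra_simps)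

lemma quat_cnj_mult: "quat_cnj (p * q) = quat_cnj q * quat_cnj p"
  by (simp add: quat_cnj_def times_quat_def algebra_simps)

text \<open>The group \<open>U\<^sub>1\<close> of unit quaternions, that is, \<open>SL(2,\<real>)\<close>.\<close>

definition unit_quats :: "quat monoid" where
  "unit_quats = \<lparr>carrier = {q. quat_norm q = 1}, mult = (*), one = 1\<rparr>"

lemma group_unit_quats: "group unit_quats"
proof (rule groupI)
  show "\<exists>p\<in>carrier unit_quats. p \<otimes>\<^bsub>unit_quats\<^esub> q = \<one>\<^bsub>unit_quats\<^esub>"
    if "q \<in> carrier unit_quats" for q
    using that
    by (intro bexI[of _ "quat_cnj q"])
      (auto simp: unit_quats_def quat_norm_eq quat_cnj_def quat_defs power2_eq_square algebra_simps)
qed (auto simp: unit_quats_def quat_norm_mult mult.assoc, simp add: quat_norm_eq one_quat_def)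

definition rho_gen :: "real \<Rightarrow> trefoil_gen \<Rightarrow> quat" where
  "rho_gen x g = (case g of
     gen_a \<Rightarrow> of_real x + sqrt (x\<^sup>2 - 1) *\<^sub>R quat_j
   | gen_b \<Rightarrow> of_real x - (1/2 * sqrt ((4 * x\<^sup>2 - 3) / (x\<^sup>2 - 1))) *\<^sub>R quat_i
                - ((2 * x\<^sup>2 - 1) / (2 * sqrt (x\<^sup>2 - 1))) *\<^sub>R quat_j)"

definition rho :: "real \<Rightarrow> trefoil_gen word set \<Rightarrow> quat" where
  "rho x = pres_lift unit_quats (rho_gen x)"

context
  fixes x :: real
  assumes x: "1 < x"
begin

lemma rho_gen_coords:
  obtains y \<alpha> \<beta> where
    "rho_gen x gen_a = Quat x 0 y 0" "rho_gen x gen_b = Quat x (- \<alpha>) (- \<beta>) 0"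
    "y * y = x * x - 1" "2 * (y * \<beta>) = 2 * (x * x) - 1" "\<alpha> * \<alpha> = \<beta> * \<beta> - y * y"
proof -
  define y where "y = sqrt (x\<^sup>2 - 1)"
  define \<alpha> where "\<alpha> = 1/2 * sqrt ((4 * x\<^sup>2 - 3) / (x\<^sup>2 - 1))"
  define \<beta> where "\<beta> = (2 * x\<^sup>2 - 1) / (2 * y)"
  have x2: "x\<^sup>2 > 1" using x by simp
  then have y: "y > 0" "y * y = x\<^sup>2 - 1" by (simp_all add: y_def)
  have "\<alpha> * \<alpha> = (4 * x\<^sup>2 - 3) / (4 * (y * y))"
  proof -
    have "(4 * x\<^sup>2 - 3) / (x\<^sup>2 - 1) \<ge> 0" using x2 by simp
    from real_sqrt_pow2[OF this]
    have "\<alpha>\<^sup>2 = 1/4 * ((4 * x\<^sup>2 - 3) / (x\<^sup>2 - 1))"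
      unfolding \<alpha>_def power_mult_distrib by (simp only:) (simp add: power2_eq_square)
    then show ?thesis by (simp add: y power2_eq_square[of \<alpha>])
  qed
  moreover have "\<beta> * \<beta> = (2 * x\<^sup>2 - 1)\<^sup>2 / (4 * (y * y))"
    by (simp add: \<beta>_def power2_eq_square)
  moreover have "(2 * x\<^sup>2 - 1)\<^sup>2 - (4 * x\<^sup>2 - 3) = (y * y) * (4 * (y * y))"
    unfolding y(2) by (simp add: power2_eq_square algebra_simps)
  moreover have "4 * (y * y) \<noteq> 0" using y(1) by simp
  ultimately have "\<beta> * \<beta> - \<alpha> * \<alpha> = y * y"
    by (metis diff_divide_distrib nonzero_mult_div_cancel_right)
  moreover have "2 * (y * \<beta>) = 2 * (x * x) - 1"
    using y by (simp add: \<beta>_def power2_eq_square)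
  moreover have "rho_gen x gen_a = Quat x 0 y 0"
    by (simp add: rho_gen_def y_def quat_j_def of_real_def quat_defs)
  moreover have "rho_gen x gen_b = Quat x (- \<alpha>) (- \<beta>) 0"
    by (simp add: rho_gen_def y_def \<alpha>_def \<beta>_def quat_i_def quat_j_def of_real_def quat_defs)
  ultimately show ?thesis using y that[of y \<alpha> \<beta>] by (simp add: power2_eq_square)
qed

lemma rho_gen_unit: "range (rho_gen x) \<subseteq> carrier unit_quats"
proof -
  obtain y \<alpha> \<beta> where *:
    "rho_gen x gen_a = Quat x 0 y 0" "rho_gen x gen_b = Quat x (- \<alpha>) (- \<beta>) 0"
    "y * y = x * x - 1" "2 * (y * \<beta>) = 2 * (x * x) - 1" "\<alpha> * \<alpha> = \<beta> * \<beta> - y * y"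
    by (rule rho_gen_coords)
  have "rho_gen x g \<in> carrier unit_quats" for g
    using *(3-) by (cases g) (simp_all add: * unit_quats_def quat_norm_eq power2_eq_square)
  then show ?thesis by auto
qed

lemma rho_gen_rels:
  assumes "(u, v) \<in> trefoil_rels"
  shows "word_val unit_quats (rho_gen x) u = word_val unit_quats (rho_gen x) v"
proof -
  obtain y \<alpha> \<beta> where *:
    "rho_gen x gen_a = Quat x 0 y 0" "rho_gen x gen_b = Quat x (- \<alpha>) (- \<beta>) 0"
    "y * y = x * x - 1" "2 * (y * \<beta>) = 2 * (x * x) - 1" "\<alpha> * \<alpha> = \<beta> * \<beta> - y * y"
    by (rule rho_gen_coords)
  let ?a = "rho_gen x gen_a" and ?b = "rho_gen x gen_b"
  have "?a * (?b * ?a) = ?b * (?a * ?b)"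
    unfolding *(1,2) quat_eq_iff times_quat_def quat.sel using *(3-)
    by (intro conjI; (algebra | simp add: algebra_simps))
  then show ?thesis
    using assms by (auto simp: trefoil_rels_def word_val_def unit_quats_def)
qed

lemma rho_hom: "rho x \<in> hom trefoil_group unit_quats"
  unfolding rho_def trefoil_group_def
  using group.pres_lift_hom[OF group_unit_quats rho_gen_unit rho_gen_rels] .

lemma rho_gen_class: "rho x (pres_class trefoil_rels [(g, True)]) = rho_gen x g"
  unfolding rho_def
  by (subst group.pres_lift_class[OF group_unit_quats rho_gen_unit rho_gen_rels])
    (simp_all add: word_val_def unit_quats_def)

end


section \<open>Minkowski space and the hyperbolic plane\<close>

text \<open>A vector of \<open>real ^ 3\<close> holds the coordinates of a pure quaternion with respect to
  \<open>i, j, ij\<close>.\<close>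

definition pure_quat :: "real ^ 3 \<Rightarrow> quat" where
  "pure_quat v = Quat 0 (v $ 1) (v $ 2) (v $ 3)"

definition pure_coords :: "quat \<Rightarrow> real ^ 3" where
  "pure_coords q = vector [qi q, qj q, qij q]"

definition mink_form :: "real ^ 3 \<Rightarrow> real ^ 3 \<Rightarrow> real" where
  "mink_form u v = u $ 1 * v $ 1 - u $ 2 * v $ 2 - u $ 3 * v $ 3"

lemma mink_form_norm: "mink_form v v = quat_norm (pure_quat v)"
  by (simp add: mink_form_def quat_norm_eq pure_quat_def power2_eq_square)

definition SO12 :: "(real ^ 3 ^ 3) set" where
  "SO12 = {A. (\<forall>v. mink_form (A *v v) (A *v v) = mink_form v v) \<and> det A = 1}"

definition SO012 :: "(real ^ 3 ^ 3) monoid" where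
  "SO012 = \<lparr>carrier = connected_component_set SO12 (mat 1), mult = (**), one = mat 1\<rparr>"

lemma SO12_one: "mat 1 \<in> SO12"
  by (simp add: SO12_def)

lemma SO12_mult: "A \<in> SO12 \<Longrightarrow> B \<in> SO12 \<Longrightarrow> A ** B \<in> SO12"
  by (simp add: SO12_def det_mul matrix_vector_mul_assoc[symmetric])

lemma SO12_inverse:
  assumes "A \<in> SO12"
  obtains B where "B \<in> SO12" "A ** B = mat 1" "B ** A = mat 1"
proof -
  have "det A \<noteq> 0" using assms by (simp add: SO12_def)
  then obtain B where B: "A ** B = mat 1" "B ** A = mat 1"
    unfolding invertible_det_nz[symmetric] invertible_def by blast
  have "det A * det B = 1" using B(1) det_mul[of A B] by simp
  then have "det B = 1" using assms by (simp add: SO12_def)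
  moreover have "mink_form (B *v v) (B *v v) = mink_form v v" for v
  proof -
    have "mink_form (A *v (B *v v)) (A *v (B *v v)) = mink_form (B *v v) (B *v v)"
      using assms by (simp add: SO12_def)
    then show ?thesis by (simp add: matrix_vector_mul_assoc B)
  qed
  ultimately have "B \<in> SO12" by (simp add: SO12_def)
  with B that show ?thesis by blast
qed

lemma SO012_translate:
  assumes "A \<in> SO12" "X \<in> carrier SO012" "A ** X \<in> carrier SO012" "Y \<in> carrier SO012"
  shows "A ** Y \<in> carrier SO012"
proof -
  let ?C = "connected_component_set SO12 (mat 1)"
  have sub: "?C \<subseteq> SO12" by (rule connected_component_subset)
  have "bounded_linear ((**) A)"
    by (simp add: linear_conv_bounded_linear[symmetric] linear_iff matrix_add_ldistrib
        scalar_matrix_assoc matrix_scalar_ac flip: scalar_mult_eq_scaleR)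
  then have "connected ((**) A ` ?C)"
    by (intro connected_continuous_image linear_continuous_on connected_connected_component)
  moreover have "(**) A ` ?C \<subseteq> SO12"
    using sub SO12_mult[OF assms(1)] by blast
  ultimately have "(**) A ` ?C \<subseteq> connected_component_set SO12 (A ** X)"
    using assms(2) by (intro connected_component_maximal) (auto simp: SO012_def)
  moreover have "connected_component_set SO12 (A ** X) = ?C"
    using assms(3) connected_component_eq[of "A ** X" SO12 "mat 1"] by (simp add: SO012_def)
  ultimately show ?thesis using assms(4) by (auto simp: SO012_def)
qed

lemma group_SO012: "group SO012"
proof (rule groupI)
  have sub: "carrier SO012 \<subseteq> SO12"
    using connected_component_subset[of SO12 "mat 1"] by (simp add: SO012_def)
  have one: "mat 1 \<in> carrier SO012"
    using SO12_one by (simp add: SO012_def connected_component_refl)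
  show "\<one>\<^bsub>SO012\<^esub> \<in> carrier SO012" using one by (simp add: SO012_def)
  show "A \<otimes>\<^bsub>SO012\<^esub> B \<in> carrier SO012" if "A \<in> carrier SO012" "B \<in> carrier SO012" for A B
    using SO012_translate[of A "mat 1" B] that sub one by (auto simp: SO012_def)
  show "\<exists>B\<in>carrier SO012. B \<otimes>\<^bsub>SO012\<^esub> A = \<one>\<^bsub>SO012\<^esub>" if A: "A \<in> carrier SO012" for A
  proof -
    obtain B where B: "B \<in> SO12" "B ** A = mat 1"
      using SO12_inverse[of A] A sub by blast
    have "B ** mat 1 \<in> carrier SO012"
      by (rule SO012_translate[OF B(1) A _ one]) (simp add: B one)
    then show ?thesis using B by (intro bexI[of _ B]) (simp_all add: SO012_def)
  qed
qed (simp_all add: SO012_def matrix_mul_assoc)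

definition c_map :: "quat \<Rightarrow> real ^ 3 ^ 3" where
  "c_map q = matrix (\<lambda>v. pure_coords (q * pure_quat v * quat_cnj q))"

lemma c_map_apply: "c_map q *v v = pure_coords (q * pure_quat v * quat_cnj q)"
proof -
  have "linear (\<lambda>v. pure_coords (q * pure_quat v * quat_cnj q))"
    by (simp add: linear_iff vec_eq_iff forall_3 pure_coords_def pure_quat_def quat_cnj_def
      times_quat_def algebra_simps)
  then show ?thesis
    unfolding c_map_def by (intro matrix_works) (simp add: linear_matrix_vector_mul_eq)
qed

lemma c_map_pure: "pure_quat (c_map q *v v) = q * pure_quat v * quat_cnj q"
  by (simp add: c_map_apply quat_eq_iff pure_coords_def pure_quat_def quat_cnj_def
      times_quat_def algebra_simps)

lemma c_map_mult: "c_map (p * q) = c_map p ** c_map q"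
proof -
  have "pure_quat (c_map (p * q) *v v) = pure_quat ((c_map p ** c_map q) *v v)" for v
    by (simp add: c_map_pure matrix_vector_mul_assoc[symmetric] mult.assoc quat_cnj_mult)
  then have "c_map (p * q) *v v = (c_map p ** c_map q) *v v" for v
    by (simp add: pure_quat_def vec_eq_iff forall_3)
  then show ?thesis by (simp add: matrix_eq)
qed

definition rho' :: "real \<Rightarrow> trefoil_gen word set \<Rightarrow> real ^ 3 ^ 3" where
  "rho' x = c_map \<circ> rho x"

definition H2 :: "(real ^ 3) set" where
  "H2 = {v. mink_form v v = 1 \<and> v $ 1 > 0}"

definition hdist :: "real ^ 3 \<Rightarrow> real ^ 3 \<Rightarrow> real" where
  "hdist u v = arcosh (mink_form u v)"

text \<open>The hyperboloid is the graph of \<open>(s, t) \<mapsto> sqrt (1 + s\<^sup>2 + t\<^sup>2)\<close>; in these coordinates the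
  hyperbolic area element is \<open>ds dt / sqrt (1 + s\<^sup>2 + t\<^sup>2)\<close>.\<close>

definition harea :: "(real ^ 3) set \<Rightarrow> ennreal" where
  "harea D = (\<integral>\<^sup>+ p. (case p of (s, t) \<Rightarrow>
      indicator D (vector [sqrt (1 + s\<^sup>2 + t\<^sup>2), s, t] :: real ^ 3)
        * ennreal (1 / sqrt (1 + s\<^sup>2 + t\<^sup>2))) \<partial>lborel)"

definition geodesic_line :: "(real \<Rightarrow> real ^ 3) \<Rightarrow> bool" where
  "geodesic_line \<sigma> \<longleftrightarrow> range \<sigma> \<subseteq> H2 \<and> (\<forall>s t. hdist (\<sigma> s) (\<sigma> t) = \<bar>s - t\<bar>)"


section \<open>Complete hyperbolic 2-orbifolds\<close>

text \<open>A complete orientable hyperbolic 2-orbifold is a quotient of the hyperbolic plane by its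
  holonomy group, a discrete subgroup \<open>\<Gamma>\<close> of the orientation-preserving isometry group. The
  group \<open>\<Gamma>\<close> is determined by the orbifold up to conjugation, and determines it: the underlying
  space is the orbit space, and the cone points are the orbits with nontrivial stabilizer.\<close>

definition Gorbit :: "(real ^ 3 ^ 3) set \<Rightarrow> real ^ 3 \<Rightarrow> (real ^ 3) set" where
  "Gorbit \<Gamma> v = (\<lambda>A. A *v v) ` \<Gamma>"

definition orbit_space :: "(real ^ 3 ^ 3) set \<Rightarrow> (real ^ 3) set topology" where
  "orbit_space \<Gamma> = topology (\<lambda>U. U \<subseteq> Gorbit \<Gamma> ` H2 \<and>
     openin (top_of_set H2) {v \<in> H2. Gorbit \<Gamma> v \<in> U})"

lemma openin_orbit_space:
  "openin (orbit_space \<Gamma>) U \<longleftrightarrow>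
     U \<subseteq> Gorbit \<Gamma> ` H2 \<and> openin (top_of_set H2) {v \<in> H2. Gorbit \<Gamma> v \<in> U}"
proof -
  have "istopology (\<lambda>U. U \<subseteq> Gorbit \<Gamma> ` H2 \<and>
     openin (top_of_set H2) {v \<in> H2. Gorbit \<Gamma> v \<in> U})" (is "istopology ?L")
    unfolding istopology_def
  proof (intro conjI allI impI)
    fix S T assume "?L S" "?L T"
    moreover have "{v \<in> H2. Gorbit \<Gamma> v \<in> S \<inter> T}
        = {v \<in> H2. Gorbit \<Gamma> v \<in> S} \<inter> {v \<in> H2. Gorbit \<Gamma> v \<in> T}" by blast
    ultimately show "S \<inter> T \<subseteq> Gorbit \<Gamma> ` H2"
      "openin (top_of_set H2) {v \<in> H2. Gorbit \<Gamma> v \<in> S \<inter> T}" by auto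
  next
    fix \<K> assume K: "\<forall>K\<in>\<K>. ?L K"
    have "{v \<in> H2. Gorbit \<Gamma> v \<in> \<Union>\<K>} = (\<Union>K\<in>\<K>. {v \<in> H2. Gorbit \<Gamma> v \<in> K})" by blast
    with K show "\<Union>\<K> \<subseteq> Gorbit \<Gamma> ` H2"
      "openin (top_of_set H2) {v \<in> H2. Gorbit \<Gamma> v \<in> \<Union>\<K>}" by (auto intro!: openin_Union)
  qed
  then show ?thesis unfolding orbit_space_def by simp
qed

lemma topspace_orbit_space: "topspace (orbit_space \<Gamma>) = Gorbit \<Gamma> ` H2"
proof -
  have "openin (orbit_space \<Gamma>) (Gorbit \<Gamma> ` H2)"
    unfolding openin_orbit_space
    by (metis (no_types, lifting) Collect_cong Collect_mem_eq imageI openin_subtopology_self subset_refl)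
  then show ?thesis
    unfolding topspace_def by (auto simp: openin_orbit_space)
qed

definition stabilizer :: "(real ^ 3 ^ 3) set \<Rightarrow> real ^ 3 \<Rightarrow> (real ^ 3 ^ 3) set" where
  "stabilizer \<Gamma> v = {A \<in> \<Gamma>. A *v v = v}"

definition cone_points :: "(real ^ 3 ^ 3) set \<Rightarrow> (real ^ 3) set set" where
  "cone_points \<Gamma> = {Gorbit \<Gamma> v | v. v \<in> H2 \<and> stabilizer \<Gamma> v \<noteq> {mat 1}}"

text \<open>The supremum is attained by any Borel set that meets every orbit exactly once.\<close>

definition orbifold_area :: "(real ^ 3 ^ 3) set \<Rightarrow> ennreal" where
  "orbifold_area \<Gamma> = (SUP D \<in> {D \<in> sets borel. D \<subseteq> H2 \<and> inj_on (Gorbit \<Gamma>) D}. harea D)"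

text \<open>The projection of the line \<open>\<sigma>\<close> is a simple closed geodesic of length \<open>\<delta>\<close>. Going around the
  end means that it cuts off a neighbourhood \<open>E\<close> of the end, i.e. a component whose complement is
  compact, and that all cone points lie on the other side.\<close>

definition closed_geodesic_around_end ::
    "(real ^ 3 ^ 3) set \<Rightarrow> (real \<Rightarrow> real ^ 3) \<Rightarrow> real \<Rightarrow> bool" where
  "closed_geodesic_around_end \<Gamma> \<sigma> \<delta> \<longleftrightarrow>
     geodesic_line \<sigma> \<and> \<delta> > 0 \<and>
     (\<forall>s t. Gorbit \<Gamma> (\<sigma> s) = Gorbit \<Gamma> (\<sigma> t) \<longleftrightarrow> (\<exists>n::int. s - t = of_int n * \<delta>)) \<and>
     (let X = orbit_space \<Gamma>; C = Gorbit \<Gamma> ` range \<sigma> in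
       \<exists>E \<in> connected_components_of (subtopology X (topspace X - C)).
         compactin X (topspace X - E) \<and> cone_points \<Gamma> \<inter> (C \<union> E) = {})"

text \<open>\<open>\<Gamma>\<close> is the holonomy group of a complete hyperbolic 2-orbifold of infinite area, with
  underlying space an open disk, with one cone point of order 2, one of order 3 and no others,
  and with end geodesic of length \<open>\<delta>\<close>.\<close>

definition holonomy_O23 :: "real \<Rightarrow> (real ^ 3 ^ 3) set \<Rightarrow> bool" where
  "holonomy_O23 \<delta> \<Gamma> \<longleftrightarrow>
     subgroup \<Gamma> SO012 \<and> discrete \<Gamma> \<and>
     orbit_space \<Gamma> homeomorphic_space top_of_set (ball (0::complex) 1) \<and>
     orbifold_area \<Gamma> = \<infinity> \<and>
     (\<exists>u\<in>H2. \<exists>v\<in>H2. cone_points \<Gamma> = {Gorbit \<Gamma> u, Gorbit \<Gamma> v} \<and>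
        card (stabilizer \<Gamma> u) = 2 \<and> card (stabilizer \<Gamma> v) = 3) \<and>
     (\<exists>\<sigma>. closed_geodesic_around_end \<Gamma> \<sigma> \<delta>)"

end

theory Submission
  imports Defs
begin

text \<open>The image of \<open>\<rho>'\<^sub>x\<close> is itself the holonomy group. As quaternions \<open>\<rho>\<^sub>x(a) = - e\<^sub>3 e\<^sub>1\<close> and
  \<open>\<rho>\<^sub>x(ab) = - e\<^sub>2 e\<^sub>3\<close>, where \<open>e\<^sub>1, e\<^sub>2, e\<^sub>3\<close> are the pure quaternions of norm \<open>-1\<close> normal to the sides of a
  hyperbolic triangle with angles \<open>\<pi>/2\<close>, \<open>\<pi>/3\<close> and two ultraparallel sides at distance \<open>\<delta>/2\<close>. Since
  \<open>c(e\<^sub>i)\<close> is the reflection in the \<open>i\<close>-th side, the image is the orientation-preserving subgroup of the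
  reflection group of the triangle.

  That the triangle is a strict fundamental domain is seen by rewriting: reflect a point in a side
  whenever it lies on the wrong side of it. Any two competing reflections can be completed to a common
  point in equally many steps, so normal forms are unique, and they define a folding of the plane onto
  the triangle that is constant on orbits and does not increase distances to the triangle. Discreteness
  and the stabilizers follow. The orbit space is the double of the triangle; explicit coordinates
  turn the triangle into a closed half-plane, hence the double into a plane. The common perpendicular
  of the ultraparallel sides covers the closed geodesic of length \<open>\<delta>\<close>.\<close>

section \<open>Isometries from unit quaternions\<close>

text \<open>One inequality does most of the work: a reflection step never increases
  \<open>mink_form p\<close> for a vector \<open>p\<close> with nonnegative heights over all sides,
  because it adds twice the product of a negative and a nonnegative height. With
  \<open>p = base\<close> it bounds the number of rounds of the rewriting, with
  \<open>p = fold q0\<close> it makes the folding continuous, and its equality case confines the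
  stabilizer of \<open>p\<close> to words in the sides through \<open>p\<close>. Uniqueness of
  normal forms plays the role of Poincare's polygon theorem; the determinant of a reducing element
  then tells in which of the two copies of the triangle an orbit lies. The length \<delta> arises
  because \<open>c_map (rho_gen x gen_a)\<close> is a product of reflections in two lines at
  distance \<delta>/2, hence a translation by \<delta> along their common perpendicular.\<close>

lemma c_map_entries:
  "c_map (Quat t a b c) = vector
    [vector [t\<^sup>2 + a\<^sup>2 + b\<^sup>2 + c\<^sup>2, 2 * (t * c - a * b), - 2 * (t * b + a * c)],
     vector [2 * (a * b + t * c), t\<^sup>2 - a\<^sup>2 - b\<^sup>2 + c\<^sup>2, - 2 * (t * a + b * c)],
     vector [2 * (a * c - t * b), 2 * (t * a - b * c), t\<^sup>2 - a\<^sup>2 + b\<^sup>2 - c\<^sup>2]]"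
  (is "_ = ?M")
proof -
  have "c_map (Quat t a b c) *v v = ?M *v v" for v
    unfolding c_map_apply
    by (simp add: vec_eq_iff forall_3 matrix_vector_mult_def sum_3 pure_coords_def
      pure_quat_def quat_cnj_def times_quat_def power2_eq_square algebra_simps)
  then show ?thesis by (simp add: matrix_eq)
qed

text \<open>Stated for all quaternions and not only for units, because the reflections below come
  from quaternions of norm -1.\<close>

lemma det_c_map: "det (c_map q) = quat_norm q ^ 3"
  by (cases q) (simp add: c_map_entries det_3 quat_norm_eq power2_eq_square power3_eq_cube algebra_simps)

lemma mink_form_c_map: "mink_form (c_map q *v v) (c_map q *v v) = (quat_norm q)\<^sup>2 * mink_form v v"
proof -
  have "quat_norm (quat_cnj q) = quat_norm q" by (simp add: quat_norm_eq quat_cnj_def)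
  then show ?thesis by (simp add: mink_form_norm c_map_pure quat_norm_mult power2_eq_square)
qed

lemma c_map_1: "c_map 1 = mat 1"
  by (simp add: matrix_eq c_map_apply pure_coords_def pure_quat_def quat_cnj_def
      times_quat_def one_quat_def vec_eq_iff forall_3)

text \<open>Polar coordinates in the plane of \<open>1, i\<close> exhibit the unit quaternions as a continuous image of
  \<open>\<real>\<^sup>3\<close>, so their images lie in the identity component.\<close>

lemma c_map_in_SO012:
  assumes "quat_norm q = 1"
  shows "c_map q \<in> carrier SO012"
proof -
  define f where "f = (\<lambda>(\<theta>, b, c). c_map (Quat (sqrt (1 + b\<^sup>2 + c\<^sup>2) * cos \<theta>) (sqrt (1 + b\<^sup>2 + c\<^sup>2) * sin \<theta>) b c))"
  have f_SO12: "f p \<in> SO12" for p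
  proof -
    obtain \<theta> b c where p: "p = (\<theta>, b, c)" by (cases p)
    have "(sqrt (1 + b\<^sup>2 + c\<^sup>2) * cos \<theta>)\<^sup>2 + (sqrt (1 + b\<^sup>2 + c\<^sup>2) * sin \<theta>)\<^sup>2 = 1 + b\<^sup>2 + c\<^sup>2"
      by (simp add: power_mult_distrib flip: distrib_left)
    then have "quat_norm (Quat (sqrt (1 + b\<^sup>2 + c\<^sup>2) * cos \<theta>) (sqrt (1 + b\<^sup>2 + c\<^sup>2) * sin \<theta>) b c) = 1"
      by (simp add: quat_norm_eq)
    then show ?thesis
      by (simp add: p f_def SO12_def mink_form_c_map det_c_map)
  qed
  have cont: "continuous_on UNIV (\<lambda>p. f p $ i $ j)" for i j
    using exhaust_3[of i] exhaust_3[of j] unfolding f_def case_prod_unfold c_map_entries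
    by (elim disjE; simp) (intro continuous_intros)+
  have "continuous_on UNIV (\<lambda>p. \<chi> i j. f p $ i $ j)"
    by (intro continuous_on_vec_lambda cont)
  then have "continuous_on UNIV f" by simp
  then have "connected (range f)"
    by (rule connected_continuous_image) (simp add: connected_UNIV)
  moreover have "mat 1 \<in> range f"
  proof
    show "mat 1 = f (0, 0, 0)" by (simp add: f_def flip: c_map_1 one_quat_def)
  qed simp
  moreover have "range f \<subseteq> SO12" using f_SO12 by blast
  ultimately have "range f \<subseteq> carrier SO012"
    using connected_component_maximal by (simp add: SO012_def)
  moreover have "c_map q \<in> range f"
  proof -
    obtain t a b c where q: "q = Quat t a b c" by (cases q)
    have ta: "t\<^sup>2 + a\<^sup>2 = 1 + b\<^sup>2 + c\<^sup>2" using assms by (simp add: q quat_norm_eq)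
    define r where "r = sqrt (1 + b\<^sup>2 + c\<^sup>2)"
    have r: "r > 0" "r\<^sup>2 = 1 + b\<^sup>2 + c\<^sup>2"
      by (auto simp: r_def add_pos_nonneg)
    have "(t / r)\<^sup>2 + (a / r)\<^sup>2 = 1" 
      unfolding power_divide add_divide_distrib[symmetric] ta r(2)[symmetric] using r(1) by simp
    then obtain \<theta> where "t / r = cos \<theta>" "a / r = sin \<theta>" 
      using sincos_total_2pi by metis
    then have "t = r * cos \<theta>" "a = r * sin \<theta>" using r(1) by (simp_all add: field_simps)
    then have "c_map q = f (\<theta>, b, c)" by (simp add: q f_def r_def)
    then show ?thesis by blast
  qed
  ultimately show ?thesis by blast
qed

lemma c_map_hom: "c_map \<in> hom unit_quats SO012"
  by (rule homI) (auto simp: unit_quats_def c_map_in_SO012 c_map_mult, simp add: SO012_def)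

text \<open>Replaces classes of words by words, so that membership can be proved by induction on a
  word.\<close>

lemma rho'_image:
  assumes "1 < x"
  shows "rho' x ` carrier trefoil_group = range (\<lambda>w. c_map (word_val unit_quats (rho_gen x) w))"
  unfolding rho'_def rho_def trefoil_group_def presented_group_def
  using group.pres_lift_class[OF group_unit_quats rho_gen_unit[OF assms] rho_gen_rels[OF assms]]
  by (simp add: image_comp o_def)

lemma subgroup_rho'_image:
  assumes "1 < x"
  shows "subgroup (rho' x ` carrier trefoil_group) SO012"
proof -
  have "rho' x \<in> hom trefoil_group SO012"
    unfolding rho'_def using rho_hom[OF assms] c_map_hom by (rule Group.hom_compose)
  then have "group_hom trefoil_group SO012 (rho' x)"
    by (simp add: group_hom_def group_hom_axioms_def group_SO012 trefoil_group_def group_presented_group)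
  then show ?thesis by (rule group_hom.img_is_subgroup)
qed

section \<open>Folding the hyperbolic plane onto a triangle\<close>

lemma mink_form_sym: "mink_form u v = mink_form v u"
  by (simp add: mink_form_def mult.commute)

lemma mink_form_add_left: "mink_form (u + v) w = mink_form u w + mink_form v w"
  and mink_form_add_right: "mink_form w (u + v) = mink_form w u + mink_form w v"
  and mink_form_scaleR_left: "mink_form (r *\<^sub>R u) w = r * mink_form u w"
  and mink_form_scaleR_right: "mink_form w (r *\<^sub>R u) = r * mink_form w u"
  and mink_form_diff_left: "mink_form (u - v) w = mink_form u w - mink_form v w"
  and mink_form_diff_right: "mink_form w (u - v) = mink_form w u - mink_form w v"
  by (simp_all add: mink_form_def algebra_simps)

lemmas mink_form_linear = mink_form_add_left mink_form_add_right mink_form_scaleR_left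
  mink_form_scaleR_right mink_form_diff_left mink_form_diff_right

lemma mink_form_isometry:
  assumes "\<And>v. mink_form (A *v v) (A *v v) = mink_form v v"
  shows "mink_form (A *v u) (A *v v) = mink_form u v"
  using assms[of "u + v"] assms[of u] assms[of v] mink_form_sym[of "A *v u" "A *v v"]
    mink_form_sym[of u v]
  by (simp add: mink_form_linear matrix_vector_right_distrib)

lemma H2_first_gt:
  assumes "v \<in> H2"
  shows "v $ 1 \<ge> 1" "\<bar>v $ 2\<bar> < v $ 1" "\<bar>v $ 3\<bar> < v $ 1"
proof -
  have *: "v $ 1 * v $ 1 = 1 + v $ 2 * v $ 2 + v $ 3 * v $ 3" "v $ 1 > 0"
    using assms by (auto simp: H2_def mink_form_def)
  then have "1\<^sup>2 \<le> (v $ 1)\<^sup>2" "(v $ 2)\<^sup>2 < (v $ 1)\<^sup>2" "(v $ 3)\<^sup>2 < (v $ 1)\<^sup>2"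
    by (auto simp: power2_eq_square intro: add_nonneg_pos add_pos_nonneg)
  with *(2) show "v $ 1 \<ge> 1" "\<bar>v $ 2\<bar> < v $ 1" "\<bar>v $ 3\<bar> < v $ 1"
    using power2_le_imp_le[of 1 "v $ 1"] power2_less_imp_less[of "\<bar>v $ 2\<bar>" "v $ 1"]
      power2_less_imp_less[of "\<bar>v $ 3\<bar>" "v $ 1"] by simp_all
qed

text \<open>The reversed Cauchy-Schwarz inequality: on one sheet the difference of the two squares
  is itself a sum of three squares.\<close>

lemma mink_form_ge_1:
  assumes "u \<in> H2" "v \<in> H2"
  shows "mink_form u v \<ge> 1"
proof -
  have u: "(u $ 1)\<^sup>2 = 1 + (u $ 2)\<^sup>2 + (u $ 3)\<^sup>2" "u $ 1 > 0" 
   and v: "(v $ 1)\<^sup>2 = 1 + (v $ 2)\<^sup>2 + (v $ 3)\<^sup>2" "v $ 1 > 0"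
    using assms by (auto simp: H2_def mink_form_def power2_eq_square)
  have "(1 + u $ 2 * v $ 2 + u $ 3 * v $ 3)\<^sup>2 \<le> (u $ 1 * v $ 1)\<^sup>2"
  proof -
    have "(u $ 1 * v $ 1)\<^sup>2 - (1 + u $ 2 * v $ 2 + u $ 3 * v $ 3)\<^sup>2
      = (u $ 2 - v $ 2)\<^sup>2 + (u $ 3 - v $ 3)\<^sup>2 + (u $ 2 * v $ 3 - u $ 3 * v $ 2)\<^sup>2"
      unfolding power_mult_distrib u v by (simp add: power2_eq_square algebra_simps)
    then show ?thesis by (smt (verit) zero_le_power2)
  qed
  then have "1 + u $ 2 * v $ 2 + u $ 3 * v $ 3 \<le> u $ 1 * v $ 1"
    using u v by (meson abs_le_square_iff abs_ge_self order_trans power2_le_imp_le mult_pos_pos less_imp_le)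
  then show ?thesis by (simp add: mink_form_def)
qed

text \<open>The three sides of the triangle with angles \<open>\<pi>/2\<close> (between \<open>L1\<close> and \<open>L2\<close>), \<open>\<pi>/3\<close>
  (between \<open>L2\<close> and \<open>L3\<close>) and ultraparallel sides \<open>L1\<close>, \<open>L3\<close>.\<close>

datatype side = L1 | L2 | L3

text \<open>For x = cosh(\<delta>/2) the constant y is sinh(\<delta>/2). The normals below have
  pairwise products 0, 1/2 and x: \<open>\<kappa>\<close> is fixed by the angle \<pi>/3 between
  \<open>L2\<close> and \<open>L3\<close>, and \<open>\<alpha>\<close> then gives the normal of
  \<open>L2\<close> norm -1.\<close>

locale triangle =
  fixes x y \<kappa> \<alpha> :: real
  assumes x: "1 < x" and y: "0 < y" "y * y = x * x - 1"
    and \<kappa>: "2 * (y * \<kappa>) = 1" and \<alpha>: "0 < \<alpha>" "\<alpha> * \<alpha> = \<kappa> * \<kappa> + 1"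
begin

lemma \<kappa>_pos: "0 < \<kappa>"
  using \<kappa> y(1) by (metis mult_less_cancel_left_pos mult_zero_right zero_less_numeral zero_less_one)

lemma y_less_x: "y < x"
proof (rule ccontr)
  assume "\<not> y < x"
  then have "x * x \<le> y * y" using x by (intro mult_mono) auto
  then show False using y by simp
qed

definition normal :: "side \<Rightarrow> real ^ 3" where
  "normal s = (case s of L1 \<Rightarrow> vector [0, 0, 1] | L2 \<Rightarrow> vector [\<kappa>, \<alpha>, 0] | L3 \<Rightarrow> vector [y, 0, - x])"

definition ht :: "side \<Rightarrow> real ^ 3 \<Rightarrow> real" where
  "ht s v = mink_form v (normal s)"

text \<open>A pure quaternion n of norm -1 satisfies n n = 1 and has conjugate -n, so v goes to -n v
  n. This negates n and fixes its orthogonal complement, whose elements anticommute with n. Going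
  through \<open>c_map\<close> turns products of reflections into products of quaternions.\<close>

definition refl :: "side \<Rightarrow> real ^ 3 ^ 3" where
  "refl s = c_map (pure_quat (normal s))"

lemma normal_norm: "mink_form (normal s) (normal s) = - 1"
  using y \<alpha> by (cases s) (simp_all add: normal_def mink_form_def)

lemma quat_norm_normal: "quat_norm (pure_quat (normal s)) = - 1"
  using normal_norm by (simp add: mink_form_norm)

lemma normal_square: "pure_quat (normal s) * pure_quat (normal s) = 1"
  using normal_norm[of s] by (simp add: pure_quat_def quat_defs mink_form_def)

lemma ht_eq:
  "ht L1 v = - v $ 3" "ht L2 v = \<kappa> * v $ 1 - \<alpha> * v $ 2" "ht L3 v = y * v $ 1 + x * v $ 3"
  by (simp_all add: ht_def normal_def mink_form_def)

lemma refl_apply: "refl s *v v = v + (2 * ht s v) *\<^sub>R normal s"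
proof -
  obtain a b c where n: "normal s = vector [a, b, c]" "a * a = b * b + c * c - 1"
    using normal_norm[of s] that[of "normal s $ 1" "normal s $ 2" "normal s $ 3"]
    by (simp add: vec_eq_iff forall_3 mink_form_def)
  show ?thesis
    unfolding refl_def ht_def c_map_apply n vec_eq_iff forall_3
    by (simp add: n(1) pure_coords_def pure_quat_def quat_cnj_def times_quat_def mink_form_def)
      (intro conjI; use n(2) in algebra)
qed

lemma refl_refl: "refl s ** refl s = mat 1"
  by (simp add: refl_def normal_square c_map_1 flip: c_map_mult)

lemma refl_refl_vec [simp]: "refl s *v (refl s *v v) = v"
  by (simp add: matrix_vector_mul_assoc refl_refl)

lemma det_refl: "det (refl s) = - 1"
  by (simp add: refl_def det_c_map quat_norm_normal)

lemma mink_form_refl: "mink_form (refl s *v u) (refl s *v v) = mink_form u v"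
  by (rule mink_form_isometry) (simp add: refl_def mink_form_c_map quat_norm_normal)

text \<open>The coefficients 0, 1 and 2x are twice the pairwise products of the normals.\<close>

lemma ht_refl:
  "ht s (refl s *v v) = - ht s v"
  "ht L1 (refl L2 *v v) = ht L1 v" "ht L2 (refl L1 *v v) = ht L2 v"
  "ht L2 (refl L3 *v v) = ht L2 v + ht L3 v" "ht L3 (refl L2 *v v) = ht L3 v + ht L2 v"
  "ht L1 (refl L3 *v v) = ht L1 v + 2 * x * ht L3 v" "ht L3 (refl L1 *v v) = ht L3 v + 2 * x * ht L1 v"
  unfolding refl_apply ht_def mink_form_linear normal_norm
  using \<kappa> by (simp_all add: normal_def mink_form_def algebra_simps)

lemma mink_form_refl_ht: "mink_form u (refl s *v v) = mink_form u v + 2 * ht s v * ht s u"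
  by (simp add: refl_apply mink_form_linear ht_def)

lemma refl_fixes: "ht s v = 0 \<Longrightarrow> refl s *v v = v"
  by (simp add: refl_apply)

text \<open>The only danger is a swap of the two sheets. Points on opposite sheets have form at most
  -1, whereas the form of v and its mirror image is 1 + 2 h^2, with h the height of v.\<close>

lemma refl_H2:
  assumes "v \<in> H2"
  shows "refl s *v v \<in> H2"
proof -
  let ?w = "refl s *v v"
  have v: "mink_form v v = 1" "v $ 1 > 0" using assms by (auto simp: H2_def)
  have w: "mink_form ?w ?w = 1" using v by (simp add: mink_form_refl)
  have "?w $ 1 > 0"
  proof (rule ccontr)
    assume neg: "\<not> ?w $ 1 > 0"
    have "?w $ 1 \<noteq> 0"
    proof
      assume "?w $ 1 = 0"
      then have "- (?w $ 2 * ?w $ 2 + ?w $ 3 * ?w $ 3) = 1" using w by (simp add: mink_form_def)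
      then show False by (smt (verit) zero_le_square)
    qed
    with neg have "- ?w \<in> H2" using w by (simp add: H2_def mink_form_def)
    then have "mink_form v (- ?w) \<ge> 1" using mink_form_ge_1 assms by blast
    moreover have "mink_form v (- ?w) = - mink_form v ?w" by (simp add: mink_form_def)
    ultimately have "mink_form v ?w \<le> - 1" by simp
    moreover have "mink_form v ?w = 1 + 2 * (ht s v * ht s v)"
      using v by (simp add: mink_form_refl_ht)
    ultimately show False by (smt (verit) zero_le_square)
  qed
  with w show ?thesis by (simp add: H2_def)
qed

lemma L1_L3_disjoint:
  assumes "v \<in> H2" "ht L1 v \<le> 0"
  shows "ht L3 v > 0"
  using assms x y H2_first_gt(1)[of v] by (simp add: ht_eq add_pos_nonneg)

text \<open>Reflections are allowed from the negative side only, so the points of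
  \<open>chamber\<close> are irreducible. The number of steps is recorded because the uniqueness
  proof is an induction on it.\<close>

inductive steps :: "nat \<Rightarrow> real ^ 3 \<Rightarrow> real ^ 3 \<Rightarrow> bool" where
  steps_0: "steps 0 v v"
| steps_Suc: "ht s v < 0 \<Longrightarrow> steps n (refl s *v v) w \<Longrightarrow> steps (Suc n) v w"

definition chamber :: "(real ^ 3) set" where
  "chamber = {v \<in> H2. \<forall>s. ht s v \<ge> 0}"

lemma steps_trans: "steps m u v \<Longrightarrow> steps n v w \<Longrightarrow> steps (m + n) u w"
  by (induction rule: steps.induct) (auto intro: steps.intros)

lemma steps_1: "ht s v < 0 \<Longrightarrow> steps (Suc 0) v (refl s *v v)"
  using steps_Suc[of s v 0] steps_0 by simp

lemma steps_H2: "steps n v w \<Longrightarrow> v \<in> H2 \<Longrightarrow> w \<in> H2"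
  by (induction rule: steps.induct) (auto intro: refl_H2)

lemma L1_L2_commute: "refl L1 *v (refl L2 *v v) = refl L2 *v (refl L1 *v v)"
  unfolding refl_apply[of L1 "refl L2 *v v"] refl_apply[of L2 "refl L1 *v v"] ht_refl
  by (simp add: refl_apply)

text \<open>Both products are the reflection with normal
  \<open>normal L2 + normal L3\<close>.\<close>

lemma L2_L3_braid:
  "refl L2 *v (refl L3 *v (refl L2 *v v)) = refl L3 *v (refl L2 *v (refl L3 *v v))"
proof -
  have "refl L2 *v (refl L3 *v (refl L2 *v v))
      = v + (2 * ht L2 v) *\<^sub>R normal L2 + (2 * (ht L3 v + ht L2 v)) *\<^sub>R normal L3 + (2 * ht L3 v) *\<^sub>R normal L2"
    by (subst refl_apply[of L2 "refl L3 *v (refl L2 *v v)", unfolded ht_refl],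
        subst refl_apply[of L3 "refl L2 *v v", unfolded ht_refl], subst refl_apply[of L2 v])
      (simp add: algebra_simps)
  moreover have "refl L3 *v (refl L2 *v (refl L3 *v v))
      = v + (2 * ht L3 v) *\<^sub>R normal L3 + (2 * (ht L3 v + ht L2 v)) *\<^sub>R normal L2 + (2 * ht L2 v) *\<^sub>R normal L3"
    by (subst refl_apply[of L3 "refl L2 *v (refl L3 *v v)", unfolded ht_refl],
        subst refl_apply[of L2 "refl L3 *v v", unfolded ht_refl], subst refl_apply[of L3 v])
      (simp add: algebra_simps)
  ultimately show ?thesis by (simp add: algebra_simps)
qed

text \<open>Both sides of a peak close up after the same number of steps; \<open>L1\<close> and \<open>L3\<close> form no peak because
  their negative half-planes are disjoint.\<close>

lemma peak:
  assumes "v \<in> H2" "ht s v < 0" "ht t v < 0" "s \<noteq> t"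
  obtains k w where "steps k (refl s *v v) w" "steps k (refl t *v v) w"
proof -
  have P12: "\<exists>k w. steps k (refl L1 *v v) w \<and> steps k (refl L2 *v v) w" if "ht L1 v < 0" "ht L2 v < 0"
  proof -
    have "steps (Suc 0) (refl L1 *v v) (refl L2 *v (refl L1 *v v))"
      "steps (Suc 0) (refl L2 *v v) (refl L1 *v (refl L2 *v v))"
      using that by (auto intro!: steps_1 simp: ht_refl)
    then show ?thesis by (auto simp: L1_L2_commute)
  qed
  have P23: "\<exists>k w. steps k (refl L2 *v v) w \<and> steps k (refl L3 *v v) w" if "ht L2 v < 0" "ht L3 v < 0"
  proof -
    have "steps (Suc 0 + Suc 0) (refl L2 *v v) (refl L2 *v (refl L3 *v (refl L2 *v v)))"
      "steps (Suc 0 + Suc 0) (refl L3 *v v) (refl L3 *v (refl L2 *v (refl L3 *v v)))"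
      using that by (intro steps_trans[OF steps_1 steps_1]; simp add: ht_refl)+
    then show ?thesis by (auto simp: L2_L3_braid)
  qed
  have P13: "\<not> (ht L1 v < 0 \<and> ht L3 v < 0)"
    using L1_L3_disjoint[OF assms(1)] by fastforce
  show ?thesis
    using assms P12 P23 P13 that by (cases s; cases t) blast+
qed

text \<open>Random descent: since peaks are balanced, all reductions of a point have the same length and
  the same result.\<close>

lemma steps_descend:
  assumes "steps n v p" "v \<in> H2" "p \<in> chamber" "steps k v w"
  shows "k \<le> n \<and> steps (n - k) w p"
  using assms
proof (induction n arbitrary: v k w rule: less_induct)
  case (less n)
  show ?case
  proof (cases k)
    case 0
    then show ?thesis using less.prems by (auto elim: steps.cases)
  next
    case (Suc k')
    then obtain s where s: "ht s v < 0" "steps k' (refl s *v v) w"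
      using less.prems(4) by (auto elim: steps.cases)
    from less.prems(1) show ?thesis
    proof cases
      case steps_0
      then have "ht s v \<ge> 0" using less.prems(3) by (simp add: chamber_def)
      then show ?thesis using s by simp
    next
      case (steps_Suc t n')
      \<comment> \<open>The reduction of known length n' starts from the branch t. The common point
        u of the peak lies j steps away on either branch, so the reduction can be moved to the
        branch s without changing its length.\<close>
      have sv: "steps n' (refl s *v v) p"
      proof (cases "s = t")
        case False
        obtain j u where u: "steps j (refl s *v v) u" "steps j (refl t *v v) u"
          using peak[OF less.prems(2) s(1) steps_Suc(2) False] .
        have "j \<le> n' \<and> steps (n' - j) u p"
          using less.IH[of n' "refl t *v v"] steps_Suc less.prems u refl_H2 by blast
        then show ?thesis using steps_trans[OF u(1), of "n' - j" p] by simp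
      qed (use steps_Suc in simp)
      have "k' \<le> n' \<and> steps (n' - k') w p"
        using less.IH[of n' "refl s *v v" k' w] sv s steps_Suc less.prems refl_H2 by simp
      then show ?thesis using Suc steps_Suc(1) by simp
    qed
  qed
qed

lemma steps_unique:
  assumes "v \<in> H2" "steps n v p" "p \<in> chamber" "steps m v q" "q \<in> chamber"
  shows "p = q"
proof -
  have "m \<le> n \<and> steps (n - m) q p" "n \<le> m" using steps_descend assms by blast+
  then show ?thesis by (auto elim: steps.cases)
qed

text \<open>On the pair (a, b) of heights over \<open>L2\<close> and \<open>L3\<close> the two
  reflections act as (-a, a + b) and (a + b, -b), a dihedral group of order 6. Three steps,
  alternating between the sides, always suffice.\<close>

lemma reduce_L2_L3:
  assumes "v \<in> H2"
  obtains n w where "steps n v w" "ht L2 w \<ge> 0" "ht L3 w \<ge> 0"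
proof -
  have A: "\<exists>n w. steps n v w \<and> ht L2 w \<ge> 0 \<and> ht L3 w \<ge> 0" if "ht L2 v \<ge> 0" "ht L2 v + ht L3 v \<ge> 0" for v
  proof (cases "ht L3 v \<ge> 0")
    case False
    then show ?thesis using that steps_1[of L3 v] ht_refl(1)[of L3 v] ht_refl(4)[of v] by force
  qed (use that steps_0 in blast)
  have B: "\<exists>n w. steps n v w \<and> ht L2 w \<ge> 0 \<and> ht L3 w \<ge> 0" if "ht L3 v \<ge> 0" "ht L2 v + ht L3 v \<ge> 0" for v
  proof (cases "ht L2 v \<ge> 0")
    case False
    then show ?thesis using that steps_1[of L2 v] ht_refl(1)[of L2 v] ht_refl(5)[of v] by force
  qed (use that steps_0 in blast)
  have C: "\<exists>n w. steps n v w \<and> ht L2 w \<ge> 0 \<and> ht L3 w \<ge> 0" if "ht L2 v \<ge> 0" for v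
  proof (cases "ht L3 v \<ge> 0")
    case False
    then show ?thesis using B[of "refl L3 *v v"] that steps_Suc[of L3 v] by (auto simp: ht_refl)
  qed (use that steps_0 in blast)
  have "\<exists>n w. steps n v w \<and> ht L2 w \<ge> 0 \<and> ht L3 w \<ge> 0"
  proof (cases "ht L2 v \<ge> 0")
    case False
    then show ?thesis using C[of "refl L2 *v v"] steps_Suc[of L2 v] by (auto simp: ht_refl)
  qed (use C in blast)
  then show ?thesis using that by blast
qed

text \<open>An interior direction of the triangle, deliberately not normalised: its height over
  \<open>L1\<close> is exactly 1, so the drop of the form under a reflection in \<open>L1\<close> is
  simply twice the height lost.\<close>

definition base :: "real ^ 3" where "base = vector [2 * x / y, 0, - 1]"

lemma ht_base: "ht s base > 0"
  using x y \<kappa>_pos by (cases s) (auto simp: ht_eq base_def)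

lemma base_pos:
  assumes "v \<in> H2"
  shows "mink_form base v > 0"
proof -
  have "2 * x / y > 1" using y_less_x x y(1) by (simp add: less_divide_eq)
  then have "2 * x / y * v $ 1 > v $ 1" using H2_first_gt(1)[OF assms]
      mult_strict_right_mono[of 1 "2 * x / y" "v $ 1"] by simp
  then show ?thesis using H2_first_gt[OF assms] by (simp add: base_def mink_form_def)
qed

text \<open>On the hyperboloid the form is the hyperbolic cosine of the distance, so steps approach
  every point of the triangle. The vector p is arbitrary because \<open>base\<close> does not lie on
  the hyperboloid.\<close>

lemma steps_mink_form_le:
  assumes "steps n v w" "\<And>s. ht s p \<ge> 0"
  shows "mink_form p w \<le> mink_form p v"
  using assms(1)
proof induction
  case (steps_Suc s v n w)
  have "ht s v * ht s p \<le> 0"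
    using steps_Suc assms(2)[of s] by (simp add: mult_nonpos_nonneg)
  then show ?case using steps_Suc by (simp add: mink_form_refl_ht)
qed simp

text \<open>After a reflection in \<open>L1\<close> the process stops unless \<open>L3\<close> becomes negative, and then the distance to
  \<open>L1\<close> was bounded below. So every round lowers the distance from \<open>base\<close> by a definite amount.\<close>

lemma steps_exists:
  assumes "v \<in> H2"
  shows "\<exists>n. \<exists>p\<in>chamber. steps n v p"
proof -
  have ht1: "ht L1 base = 1" by (simp add: ht_eq base_def)
  have main: "\<exists>n. \<exists>p\<in>chamber. steps n v p"
    if "v \<in> H2" "ht L2 v \<ge> 0" "ht L3 v \<ge> 0" "mink_form base v < 2 * (y / x) * real N" for v N
    using that
  proof (induction N arbitrary: v)
    case 0
    then show ?case using base_pos[of v] by simp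
  next
    case (Suc N)
    show ?case
    proof (cases "ht L1 v \<ge> 0")
      case True
      then have "v \<in> chamber" using Suc.prems by (simp add: chamber_def) (metis side.exhaust)
      then show ?thesis using steps_0 by blast
    next
      case False
      let ?w = "refl L1 *v v"
      have w: "?w \<in> H2" "ht L1 ?w > 0" "ht L2 ?w \<ge> 0"
        using Suc.prems False by (simp_all add: ht_refl refl_H2)
      show ?thesis
      proof (cases "ht L3 ?w \<ge> 0")
        case True
        then have "?w \<in> chamber" using w by (simp add: chamber_def) (metis side.exhaust less_imp_le)
        then show ?thesis using False steps_1[of L1 v] by force
      next
        case neg: False
        \<comment> \<open>Negative height over \<open>L3\<close> means that x times the height over
          \<open>L1\<close> exceeds y times the first coordinate, and the latter is at least 1. This
          yields the uniform bound y/x.\<close>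
        have "y * ?w $ 1 \<ge> y" using H2_first_gt(1)[OF w(1)] y by simp
        then have "x * ht L1 ?w \<ge> y" using neg by (simp add: ht_eq)
        then have "ht L1 v \<le> - (y / x)" using x by (simp add: ht_refl field_simps)
        then have "mink_form base ?w \<le> mink_form base v - 2 * (y / x)"
          using ht1 by (simp add: mink_form_refl_ht)
        then have M: "mink_form base ?w < 2 * (y / x) * real N"
          using Suc.prems(4) unfolding of_nat_Suc distrib_left by linarith
        obtain n u where u: "steps n ?w u" "ht L2 u \<ge> 0" "ht L3 u \<ge> 0"
          using reduce_L2_L3[OF w(1)] .
        have "u \<in> H2" "mink_form base u < 2 * (y / x) * real N"
          using steps_H2[OF u(1) w(1)] steps_mink_form_le[OF u(1) less_imp_le[OF ht_base]] M by auto
        then obtain m p where "p \<in> chamber" "steps m u p" using Suc.IH u by blast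
        then have "steps (Suc (n + m)) v p"
          using steps_trans[OF u(1)] False by (auto intro!: steps_Suc[of L1])
        then show ?thesis using \<open>p \<in> chamber\<close> by blast
      qed
    qed
  qed
  obtain n w where w: "steps n v w" "ht L2 w \<ge> 0" "ht L3 w \<ge> 0"
    using reduce_L2_L3[OF assms] .
  have "2 * (y / x) > 0" using x y by simp
  then obtain N where "mink_form base w < real N * (2 * (y / x))"
    using reals_Archimedean3 by blast
  then have "\<exists>n. \<exists>p\<in>chamber. steps n w p"
    using main[of w N] w steps_H2[OF w(1) assms] by (simp add: mult.commute)
  then show ?thesis using steps_trans[OF w(1)] by blast
qed

section \<open>The folding map\<close>

definition fold :: "real ^ 3 \<Rightarrow> real ^ 3" where
  "fold v = (SOME p. p \<in> chamber \<and> (\<exists>n. steps n v p))"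

lemma fold:
  assumes "v \<in> H2"
  shows "fold v \<in> chamber" "\<exists>n. steps n v (fold v)"
proof -
  have "fold v \<in> chamber \<and> (\<exists>n. steps n v (fold v))"
    unfolding fold_def by (rule someI_ex) (use steps_exists[OF assms] in blast)
  then show "fold v \<in> chamber" "\<exists>n. steps n v (fold v)" by auto
qed

lemma fold_eqI: "v \<in> H2 \<Longrightarrow> steps n v p \<Longrightarrow> p \<in> chamber \<Longrightarrow> fold v = p"
  using fold steps_unique by blast

lemma fold_chamber: "p \<in> chamber \<Longrightarrow> fold p = p"
  by (rule fold_eqI[OF _ steps_0]) (auto simp: chamber_def)

text \<open>Off the line of s, exactly one of v and its mirror image is on the negative side, and
  its first step leads to the other one.\<close>

lemma fold_refl:
  assumes "v \<in> H2"
  shows "fold (refl s *v v) = fold v"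
proof -
  have neg: "fold (refl s *v w) = fold w" if "w \<in> H2" "ht s w < 0" for w
    using fold_eqI[OF that(1)] steps_Suc[OF that(2)] fold[OF refl_H2[OF that(1)]] by metis
  show ?thesis
  proof (cases "ht s v" "0::real" rule: linorder_cases)
    case less
    then show ?thesis by (rule neg[OF assms])
  next
    case equal
    then show ?thesis by (simp add: refl_fixes)
  next
    case greater
    then show ?thesis using neg[of "refl s *v v"] refl_H2[OF assms] by (simp add: ht_refl)
  qed
qed

lemma mink_form_fold_le:
  assumes "p \<in> chamber" "v \<in> H2"
  shows "mink_form p (fold v) \<le> mink_form p v"
  using fold(2)[OF assms(2)] steps_mink_form_le[of _ v "fold v" p] assms(1)
  by (auto simp: chamber_def)

end

section \<open>The reflection group and its rotations\<close>

text \<open>Hyperbolic convergence implies coordinatewise convergence. This is what turns distance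
  estimates for \<open>fold\<close> into continuity.\<close>

lemma tendsto_H2:
  assumes p: "p \<in> H2" and f: "eventually (\<lambda>z. f z \<in> H2) F"
    and lim: "((\<lambda>z. mink_form p (f z)) \<longlongrightarrow> 1) F"
  shows "(f \<longlongrightarrow> p) F"
proof (rule vec_tendstoI)
  fix i
  define b where "b z = mink_form p (f z)" for z
  have p1: "(p $ 1)\<^sup>2 = 1 + (p $ 2)\<^sup>2 + (p $ 3)\<^sup>2" "p $ 1 > 0" "mink_form p p = 1"
    using p by (auto simp: H2_def mink_form_def power2_eq_square)
  text \<open>On the orthogonal complement of \<open>p\<close> the form is negative definite.\<close>
  have bound: "\<bar>f z $ i - b z * p $ i\<bar> \<le> p $ 1 * sqrt ((b z)\<^sup>2 - 1)" if z: "f z \<in> H2" for z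
  proof -
    define w where "w = f z - b z *\<^sub>R p"
    have "mink_form w w = mink_form (f z) (f z) - 2 * b z * b z + b z * b z * mink_form p p"
      using mink_form_sym[of "f z" p] by (simp add: w_def mink_form_linear b_def algebra_simps)
    then have ww: "(w $ 2)\<^sup>2 + (w $ 3)\<^sup>2 - (w $ 1)\<^sup>2 = (b z)\<^sup>2 - 1"
      using p1 z by (simp add: H2_def mink_form_def power2_eq_square)
    have "mink_form p w = 0" using p1 by (simp add: w_def mink_form_linear b_def)
    then have eq: "p $ 1 * w $ 1 = p $ 2 * w $ 2 + p $ 3 * w $ 3" by (simp add: mink_form_def)
    \<comment> \<open>Lagrange's identity for the last two coordinates, whose squares sum to the
      square of \<open>p $ 1\<close> minus 1.\<close>
    have "(p $ 1 * w $ 1)\<^sup>2 + (p $ 2 * w $ 3 - p $ 3 * w $ 2)\<^sup>2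
        = ((p $ 1)\<^sup>2 - 1) * ((w $ 2)\<^sup>2 + (w $ 3)\<^sup>2)"
      unfolding eq p1(1) by (simp add: power2_eq_square algebra_simps)
    then have "(p $ 1 * w $ 1)\<^sup>2 \<le> ((p $ 1)\<^sup>2 - 1) * ((w $ 2)\<^sup>2 + (w $ 3)\<^sup>2)"
      using zero_le_power2[of "p $ 2 * w $ 3 - p $ 3 * w $ 2"] by linarith
    then have "(w $ 2)\<^sup>2 + (w $ 3)\<^sup>2 \<le> (p $ 1)\<^sup>2 * ((w $ 2)\<^sup>2 + (w $ 3)\<^sup>2 - (w $ 1)\<^sup>2)"
      by (simp add: power_mult_distrib algebra_simps)
    then have n: "(w $ 2)\<^sup>2 + (w $ 3)\<^sup>2 \<le> (p $ 1)\<^sup>2 * ((b z)\<^sup>2 - 1)" by (simp add: ww)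
    have "b z \<ge> 1" using mink_form_ge_1[OF p z] by (simp add: b_def)
    then have b2: "(b z)\<^sup>2 - 1 \<ge> 0" by simp
    have "(w $ i)\<^sup>2 \<le> (w $ 2)\<^sup>2 + (w $ 3)\<^sup>2"
      using ww b2 exhaust_3[of i] by auto
    with n have "(w $ i)\<^sup>2 \<le> (p $ 1 * sqrt ((b z)\<^sup>2 - 1))\<^sup>2"
      using b2 by (simp add: power_mult_distrib)
    then have "\<bar>w $ i\<bar> \<le> p $ 1 * sqrt ((b z)\<^sup>2 - 1)"
      using p1(2) b2 power2_le_imp_le[of "\<bar>w $ i\<bar>" "p $ 1 * sqrt ((b z)\<^sup>2 - 1)"] by simp
    then show ?thesis by (simp add: w_def)
  qed
  have blim: "(b \<longlongrightarrow> 1) F" using lim by (simp add: b_def[abs_def])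
  have "((\<lambda>z. p $ 1 * sqrt ((b z)\<^sup>2 - 1)) \<longlongrightarrow> p $ 1 * sqrt (1\<^sup>2 - 1)) F"
    by (intro tendsto_intros blim)
  then have "((\<lambda>z. p $ 1 * sqrt ((b z)\<^sup>2 - 1)) \<longlongrightarrow> 0) F" by simp
  moreover have "eventually (\<lambda>z. norm (f z $ i - b z * p $ i) \<le> p $ 1 * sqrt ((b z)\<^sup>2 - 1)) F"
    using f by (rule eventually_mono) (simp add: bound)
  ultimately have "((\<lambda>z. f z $ i - b z * p $ i) \<longlongrightarrow> 0) F"
    by (rule Lim_null_comparison[rotated])
  moreover have "((\<lambda>z. b z * p $ i) \<longlongrightarrow> 1 * p $ i) F"
    by (intro tendsto_intros blim)
  ultimately have "((\<lambda>z. (f z $ i - b z * p $ i) + b z * p $ i) \<longlongrightarrow> 0 + 1 * p $ i) F"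
    by (rule tendsto_add)
  then show "((\<lambda>z. f z $ i) \<longlongrightarrow> p $ i) F" by simp
qed

context triangle
begin

text \<open>Closure under left multiplication by the generators is enough for a group, since they
  are involutions.\<close>

inductive_set reflection_group :: "(real ^ 3 ^ 3) set" where
  reflection_group_one: "mat 1 \<in> reflection_group"
| reflection_group_refl_mult: "A \<in> reflection_group \<Longrightarrow> refl s ** A \<in> reflection_group"

definition rotation_group :: "(real ^ 3 ^ 3) set" where
  "rotation_group = {A \<in> reflection_group. det A = 1}"

lemma reflection_group_refl: "refl s \<in> reflection_group"
  using reflection_group_refl_mult[OF reflection_group_one, of s] by simp

lemma reflection_group_mult:
  "A \<in> reflection_group \<Longrightarrow> B \<in> reflection_group \<Longrightarrow> A ** B \<in> reflection_group"
  by (induction rule: reflection_group.induct)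
    (auto intro: reflection_group.intros simp: matrix_mul_assoc[symmetric])

lemma reflection_group_inverse:
  assumes "A \<in> reflection_group"
  obtains B where "B \<in> reflection_group" "A ** B = mat 1" "B ** A = mat 1"
proof -
  have "\<exists>B\<in>reflection_group. A ** B = mat 1 \<and> B ** A = mat 1"
    using assms
  proof induction
    case reflection_group_one
    show ?case by (intro bexI[of _ "mat 1"]) (auto intro: reflection_group.intros)
  next
    case (reflection_group_refl_mult A s)
    then obtain B where B: "B \<in> reflection_group" "A ** B = mat 1" "B ** A = mat 1" by blast
    have "refl s ** A ** (B ** refl s) = refl s ** (A ** B) ** refl s"
      "B ** refl s ** (refl s ** A) = B ** (refl s ** refl s) ** A"
      by (simp_all only: matrix_mul_assoc)
    with B show ?case
      by (intro bexI[of _ "B ** refl s"])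
        (auto simp: refl_refl intro: reflection_group_mult reflection_group_refl)
  qed
  with that show ?thesis by blast
qed

lemma det_reflection_group: "A \<in> reflection_group \<Longrightarrow> det A = 1 \<or> det A = - 1"
  by (induction rule: reflection_group.induct) (auto simp: det_mul det_refl)

lemma reflection_group_H2: "A \<in> reflection_group \<Longrightarrow> v \<in> H2 \<Longrightarrow> A *v v \<in> H2"
  by (induction rule: reflection_group.induct)
    (auto intro: refl_H2 simp: matrix_vector_mul_assoc[symmetric])

lemma fold_reflection_group: "A \<in> reflection_group \<Longrightarrow> v \<in> H2 \<Longrightarrow> fold (A *v v) = fold v"
  by (induction rule: reflection_group.induct)
    (auto simp: matrix_vector_mul_assoc[symmetric] fold_refl reflection_group_H2)

lemma mink_form_reflection_group:
  "A \<in> reflection_group \<Longrightarrow> mink_form (A *v u) (A *v v) = mink_form u v"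
  by (induction rule: reflection_group.induct)
    (auto simp: matrix_vector_mul_assoc[symmetric] mink_form_refl)

lemma fold_reachable:
  assumes "v \<in> H2"
  obtains A where "A \<in> reflection_group" "A *v v = fold v"
proof -
  have "\<exists>A\<in>reflection_group. A *v v = w" if "steps n v w" for n v w
    using that
  proof induction
    case (steps_0 v)
    show ?case by (intro bexI[of _ "mat 1"]) (auto intro: reflection_group.intros)
  next
    case (steps_Suc s v n w)
    then obtain A where "A \<in> reflection_group" "A *v (refl s *v v) = w" by blast
    then show ?case
      by (intro bexI[of _ "A ** refl s"])
        (auto simp: matrix_vector_mul_assoc intro: reflection_group_mult reflection_group_refl)
  qed
  with fold(2)[OF assms] that show ?thesis by blast
qed

text \<open>Let A carry q0 to \<open>fold q0\<close>. Folding \<open>A *v q\<close> brings it no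
  farther from \<open>fold q0\<close>, and A is an isometry, so the form of \<open>fold q0\<close>
  and \<open>fold q\<close> is squeezed between 1 and that of q0 and q.\<close>

lemma continuous_on_fold: "continuous_on H2 fold"
  unfolding continuous_on_def
proof
  fix q0 assume q0: "q0 \<in> H2"
  obtain A where A: "A \<in> reflection_group" "A *v q0 = fold q0" using fold_reachable[OF q0] .
  have p: "fold q0 \<in> H2" using fold(1)[OF q0] by (simp add: chamber_def)
  have ev: "eventually (\<lambda>q. q \<in> H2) (at q0 within H2)"
    by (simp add: eventually_at_filter)
  have le: "mink_form (fold q0) (fold q) \<le> mink_form q0 q" if "q \<in> H2" for q
    using mink_form_fold_le[OF fold(1)[OF q0] reflection_group_H2[OF A(1) that]] A(2)
    by (metis A(1) fold_reflection_group mink_form_reflection_group that)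
  have ge: "mink_form (fold q0) (fold q) \<ge> 1" if "q \<in> H2" for q
    using mink_form_ge_1[OF p] fold(1)[OF that] by (simp add: chamber_def)
  have "((\<lambda>q. mink_form q0 q) \<longlongrightarrow> mink_form q0 q0) (at q0 within H2)"
    unfolding mink_form_def by (intro tendsto_intros)
  then have lim: "((\<lambda>q. mink_form q0 q) \<longlongrightarrow> 1) (at q0 within H2)"
    using q0 by (simp add: H2_def)
  have "((\<lambda>q. mink_form (fold q0) (fold q)) \<longlongrightarrow> 1) (at q0 within H2)"
    by (rule tendsto_sandwich[OF _ _ tendsto_const lim])
      (use ev le ge in \<open>auto elim: eventually_mono\<close>)
  moreover have "eventually (\<lambda>q. fold q \<in> H2) (at q0 within H2)"
    using ev fold(1) by (auto elim!: eventually_mono simp: chamber_def)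
  ultimately show "(fold \<longlongrightarrow> fold q0) (at q0 within H2)"
    using tendsto_H2[OF p] by blast
qed

section \<open>Stabilizers of points of the triangle\<close>

definition open_chamber :: "(real ^ 3) set" where
  "open_chamber = {v \<in> H2. \<forall>s. ht s v > 0}"

lemma open_chamber_subset: "open_chamber \<subseteq> chamber"
  by (auto simp: open_chamber_def chamber_def less_imp_le)

lemma open_chamber_nonempty: obtains q0 where "q0 \<in> open_chamber"
proof -
  define c where "c = 1 / sqrt (mink_form base base)"
  have "2 * x / y > 1" using y_less_x x y(1) by (simp add: less_divide_eq)
  from less_1_mult[OF this this] have "2 * x / y * (2 * x / y) > 1" .
  then have b: "mink_form base base > 0" by (simp add: mink_form_def base_def)
  then have c: "c > 0" "c * c * mink_form base base = 1"
    by (simp_all add: c_def field_simps)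
  have "c *\<^sub>R base \<in> open_chamber"
    using c ht_base x y
    by (simp add: open_chamber_def H2_def ht_def mink_form_linear mult.assoc) (simp add: base_def)
  then show ?thesis using that by blast
qed

text \<open>Generators are multiplied on the right because the first step of a reduction is the
  rightmost factor of the resulting element.\<close>

inductive_set vertex_group :: "real ^ 3 \<Rightarrow> (real ^ 3 ^ 3) set" for p where
  vertex_group_one: "mat 1 \<in> vertex_group p"
| vertex_group_mult_refl: "A \<in> vertex_group p \<Longrightarrow> ht s p = 0 \<Longrightarrow> A ** refl s \<in> vertex_group p"

text \<open>If the whole reduction does not lower the form with p, no single step does. Each step
  then has zero product of heights, and since v has nonzero height over s, the side s passes through
  p.\<close>

lemma steps_vertex_group:
  assumes "steps n v w" "p \<in> chamber" "mink_form p v \<le> mink_form p w"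
  shows "\<exists>A\<in>vertex_group p. A *v v = w"
  using assms
proof induction
  case (steps_0 v)
  show ?case by (intro bexI[of _ "mat 1"]) (auto intro: vertex_group.intros)
next
  case (steps_Suc s v n w)
  have "ht s p \<ge> 0" using steps_Suc.prems by (simp add: chamber_def)
  then have neg: "ht s v * ht s p \<le> 0" using steps_Suc by (simp add: mult_nonpos_nonneg)
  have "mink_form p w \<le> mink_form p (refl s *v v)"
    using steps_mink_form_le[OF steps_Suc.hyps(2)] steps_Suc.prems(1) by (simp add: chamber_def)
  then have "ht s v * ht s p = 0"
    using neg steps_Suc.prems(2) unfolding mink_form_refl_ht by linarith
  then have s: "ht s p = 0" using steps_Suc by simp
  then have "mink_form p (refl s *v v) \<le> mink_form p w"
    using steps_Suc.prems by (simp add: mink_form_refl_ht)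
  then obtain A where "A \<in> vertex_group p" "A *v (refl s *v v) = w"
    using steps_Suc by blast
  then show ?case using s
    by (intro bexI[of _ "A ** refl s"]) (auto simp: matrix_vector_mul_assoc intro: vertex_group.intros)
qed

text \<open>A fixes p and preserves the form, so the reduction of \<open>A *v q\<close> to q is one
  that does not lower the form with p.\<close>

lemma stabilizer_step:
  assumes "p \<in> chamber" "q \<in> chamber" "A \<in> reflection_group" "A *v p = p"
  obtains B where "B \<in> vertex_group p" "B *v (A *v q) = q"
proof -
  have q: "q \<in> H2" using assms by (simp add: chamber_def)
  have "fold (A *v q) = q" using assms q by (simp add: fold_reflection_group fold_chamber)
  then obtain n where n: "steps n (A *v q) q"
    using fold(2)[OF reflection_group_H2[OF assms(3) q]] by metis
  have "mink_form p (A *v q) = mink_form p q"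
    using mink_form_reflection_group[OF assms(3), of p q] assms(4) by simp
  then show ?thesis using steps_vertex_group[OF n assms(1)] that by auto
qed

definition vertex2 :: "real ^ 3" where "vertex2 = vector [\<alpha>, \<kappa>, 0]"
text \<open>The unscaled vector is orthogonal to the normals of \<open>L2\<close> and
  \<open>L3\<close> and has norm 3/4, which explains the factor.\<close>

definition vertex3 :: "real ^ 3" where
  "vertex3 = (2 / sqrt 3) *\<^sub>R vector [x * \<alpha>, x * \<kappa>, - (y * \<alpha>)]"

lemma vertex2_H2: "vertex2 \<in> H2"
  using \<alpha> by (simp add: H2_def mink_form_def vertex2_def)

lemma ht_vertex2: "ht L1 vertex2 = 0" "ht L2 vertex2 = 0" "ht L3 vertex2 > 0"
  using \<alpha> y by (simp_all add: ht_eq vertex2_def)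

lemma vertex3_H2: "vertex3 \<in> H2"
proof -
  have "4 * (y * y * (\<kappa> * \<kappa>)) = 1" using \<kappa> by algebra
  then have "(x * \<alpha>) * (x * \<alpha>) - (x * \<kappa>) * (x * \<kappa>) - (y * \<alpha>) * (y * \<alpha>) = 3 / 4"
    using y(2) \<alpha>(2) by algebra
  then have "mink_form (vector [x * \<alpha>, x * \<kappa>, - (y * \<alpha>)]) (vector [x * \<alpha>, x * \<kappa>, - (y * \<alpha>)]) = 3 / 4"
    by (simp add: mink_form_def)
  then have "mink_form vertex3 vertex3 = (2 / sqrt 3) * (2 / sqrt 3) * (3 / 4)"
    by (simp add: vertex3_def mink_form_linear)
  then show ?thesis using x \<alpha> by (simp add: H2_def) (simp add: vertex3_def)
qed

lemma ht_vertex3: "ht L1 vertex3 > 0" "ht L2 vertex3 = 0" "ht L3 vertex3 = 0"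
  using \<alpha> y by (simp_all add: ht_eq vertex3_def)

lemma chamberI:
  assumes "v \<in> H2" "ht L1 v \<ge> 0" "ht L2 v \<ge> 0" "ht L3 v \<ge> 0"
  shows "v \<in> chamber"
proof -
  have "ht s v \<ge> 0" for s using assms by (cases s) auto
  with assms(1) show ?thesis by (simp add: chamber_def)
qed

lemma vertex2_chamber: "vertex2 \<in> chamber" and vertex3_chamber: "vertex3 \<in> chamber"
  using vertex2_H2 vertex3_H2 ht_vertex2 ht_vertex3 by (auto intro!: chamberI)

text \<open>No side passes through p, so \<open>vertex_group p\<close> is trivial and A fixes the
  whole triangle pointwise. The triangle spans the space.\<close>

lemma open_chamber_fixed:
  assumes "p \<in> open_chamber" "A \<in> reflection_group" "A *v p = p"
  shows "A = mat 1"
proof -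
  have fixed: "A *v q = q" if "q \<in> chamber" for q
  proof -
    have "p \<in> chamber" using assms(1) open_chamber_subset by blast
    from stabilizer_step[OF this that assms(2,3)]
    obtain B where B: "B \<in> vertex_group p" "B *v (A *v q) = q" .
    have "ht s p > 0" for s using assms(1) by (simp add: open_chamber_def)
    then have "ht s p \<noteq> 0" for s by (metis less_irrefl)
    then have "B = mat 1" using B(1) by (auto elim: vertex_group.cases)
    with B show ?thesis by simp
  qed
  \<comment> \<open>The feet of the common perpendicular on \<open>L1\<close> and \<open>L3\<close>;
    together with \<open>vertex2\<close> they form a basis.\<close>
  let ?e = "vector [1, 0, 0] :: real ^ 3" and ?f = "vector [x, 0, - y] :: real ^ 3"
  have "?e \<in> chamber" "?f \<in> chamber"
    using x y \<kappa>_pos by (auto intro!: chamberI simp: H2_def mink_form_def ht_eq)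
  note f = fixed[OF this(1)] fixed[OF this(2)] fixed[OF vertex2_chamber]
  have "A *v v = v" for v
  proof -
    have v: "v = (v $ 1 + x * v $ 3 / y - \<alpha> * v $ 2 / \<kappa>) *\<^sub>R ?e + (- v $ 3 / y) *\<^sub>R ?f
        + (v $ 2 / \<kappa>) *\<^sub>R vertex2"
      using y \<kappa>_pos by (simp add: vec_eq_iff forall_3 vertex2_def field_simps)
    show ?thesis
      by (subst (1 2) v) (simp only: matrix_vector_right_distrib matrix_vector_mult_scaleR f)
  qed
  then show ?thesis by (simp add: matrix_eq)
qed

text \<open>Some C in the vertex group brings the image of an interior point under the inverse of A
  back to that point. The composite fixes an interior point and hence is the identity, so A is
  C.\<close>

lemma stabilizer_vertex_group:
  assumes "p \<in> chamber" "A \<in> reflection_group" "A *v p = p"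
  shows "A \<in> vertex_group p"
proof -
  obtain B where B: "B \<in> reflection_group" "A ** B = mat 1" "B ** A = mat 1"
    using reflection_group_inverse[OF assms(2)] .
  have Bp: "B *v p = p" using assms(3) B(3) by (metis matrix_vector_mul_assoc matrix_vector_mul_lid)
  obtain q0 where q0: "q0 \<in> open_chamber" using open_chamber_nonempty .
  obtain C where C: "C \<in> vertex_group p" "C *v (B *v q0) = q0"
    using stabilizer_step[OF assms(1) _ B(1) Bp] q0 open_chamber_subset by blast
  have "C \<in> reflection_group"
    using C(1) by induction (auto intro: reflection_group.intros reflection_group_mult reflection_group_refl)
  then have "C ** B = mat 1"
    using open_chamber_fixed[OF q0] C(2) B(1) by (simp add: matrix_vector_mul_assoc reflection_group_mult)
  then have "C = A" using B(2,3) by (metis matrix_mul_assoc matrix_mul_lid matrix_mul_rid)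
  with C show ?thesis by simp
qed

lemma rotation_group_one: "mat 1 \<in> rotation_group"
  by (simp add: rotation_group_def reflection_group_one)

lemma rotation_group_mult: "A \<in> rotation_group \<Longrightarrow> B \<in> rotation_group \<Longrightarrow> A ** B \<in> rotation_group"
  by (simp add: rotation_group_def reflection_group_mult det_mul)

lemma rotation_group_subset: "A \<in> rotation_group \<Longrightarrow> A \<in> reflection_group"
  by (simp add: rotation_group_def)

lemma rotation_group_refl2: "refl s ** refl t \<in> rotation_group"
  by (simp add: rotation_group_def reflection_group_mult reflection_group_refl det_mul det_refl)

lemma rotation_group_inverse:
  assumes "A \<in> rotation_group"
  obtains B where "B \<in> rotation_group" "A ** B = mat 1" "B ** A = mat 1"
proof -
  obtain B where B: "B \<in> reflection_group" "A ** B = mat 1" "B ** A = mat 1"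
    using reflection_group_inverse[OF rotation_group_subset[OF assms]] .
  have "det A * det B = 1" using B(2) det_mul[of A B] by simp
  then have "B \<in> rotation_group" using assms B(1) by (simp add: rotation_group_def)
  with B that show ?thesis by blast
qed

lemma L1_L2_commute_matrix: "refl L1 ** refl L2 = refl L2 ** refl L1"
  by (simp add: matrix_eq L1_L2_commute flip: matrix_vector_mul_assoc)

lemma L2_L3_braid_matrix: "refl L2 ** refl L3 ** refl L2 = refl L3 ** refl L2 ** refl L3"
  by (simp add: matrix_eq L2_L3_braid flip: matrix_vector_mul_assoc)

lemma mult_refl_refl: "A ** refl s ** refl s = A"
  by (simp add: refl_refl flip: matrix_mul_assoc)

lemma vertex_group_vertex2:
  "vertex_group vertex2 \<subseteq> {mat 1, refl L1, refl L2, refl L1 ** refl L2}"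
proof
  fix A assume "A \<in> vertex_group vertex2"
  then show "A \<in> {mat 1, refl L1, refl L2, refl L1 ** refl L2}"
  proof induction
    case (vertex_group_mult_refl A s)
    then have s: "s = L1 \<or> s = L2" using ht_vertex2(3) by (cases s) auto
    have "refl L2 ** refl L1 ** refl L2 = refl L1"
      by (metis L1_L2_commute_matrix mult_refl_refl)
    with s vertex_group_mult_refl.IH show ?case
      by (auto simp: mult_refl_refl refl_refl L1_L2_commute_matrix)
  qed simp
qed

lemma vertex_group_vertex3:
  "vertex_group vertex3 \<subseteq> {mat 1, refl L2, refl L3, refl L2 ** refl L3, refl L3 ** refl L2,
    refl L2 ** refl L3 ** refl L2}"
proof
  fix A assume "A \<in> vertex_group vertex3"
  then show "A \<in> {mat 1, refl L2, refl L3, refl L2 ** refl L3, refl L3 ** refl L2,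
    refl L2 ** refl L3 ** refl L2}"
  proof induction
    case (vertex_group_mult_refl A s)
    then have s: "s = L2 \<or> s = L3" using ht_vertex3(1) by (cases s) auto
    have "refl L2 ** refl L3 ** refl L2 ** refl L3 = refl L3 ** refl L2"
      by (simp add: L2_L3_braid_matrix mult_refl_refl)
    with s vertex_group_mult_refl.IH show ?case
      by (auto simp: mult_refl_refl refl_refl simp flip: L2_L3_braid_matrix)
  qed simp
qed

lemma stabilizer_vertex2: "stabilizer rotation_group vertex2 = {mat 1, refl L1 ** refl L2}"
proof (intro equalityI subsetI)
  fix A assume "A \<in> stabilizer rotation_group vertex2"
  then have A: "A \<in> rotation_group" "A *v vertex2 = vertex2" by (auto simp: stabilizer_def)
  then have "A \<in> vertex_group vertex2"
    using stabilizer_vertex_group[OF vertex2_chamber] rotation_group_subset by blast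
  then show "A \<in> {mat 1, refl L1 ** refl L2}"
    using A(1) vertex_group_vertex2 by (auto simp: rotation_group_def det_refl)
qed (auto simp: stabilizer_def rotation_group_one rotation_group_refl2 refl_fixes ht_vertex2
    simp flip: matrix_vector_mul_assoc)

lemma stabilizer_vertex3:
  "stabilizer rotation_group vertex3 = {mat 1, refl L2 ** refl L3, refl L3 ** refl L2}"
proof (intro equalityI subsetI)
  fix A assume "A \<in> stabilizer rotation_group vertex3"
  then have A: "A \<in> rotation_group" "A *v vertex3 = vertex3" by (auto simp: stabilizer_def)
  then have "A \<in> vertex_group vertex3"
    using stabilizer_vertex_group[OF vertex3_chamber] rotation_group_subset by blast
  then show "A \<in> {mat 1, refl L2 ** refl L3, refl L3 ** refl L2}"
    using A(1) vertex_group_vertex3 by (auto simp: rotation_group_def det_refl det_mul)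
qed (auto simp: stabilizer_def rotation_group_one rotation_group_refl2 refl_fixes ht_vertex3
    simp flip: matrix_vector_mul_assoc)

lemma card_stabilizer_vertex2: "card (stabilizer rotation_group vertex2) = 2"
proof -
  obtain q0 where q0: "q0 \<in> open_chamber" using open_chamber_nonempty .
  then have "ht L1 ((refl L1 ** refl L2) *v q0) < ht L1 (mat 1 *v q0)"
    by (simp add: ht_refl open_chamber_def flip: matrix_vector_mul_assoc)
  then have "mat 1 \<noteq> refl L1 ** refl L2" by fastforce
  then show ?thesis by (simp add: stabilizer_vertex2)
qed

text \<open>The three elements are told apart by the signs of the heights of the images of an
  interior point.\<close>

lemma card_stabilizer_vertex3: "card (stabilizer rotation_group vertex3) = 3"
proof -
  obtain q0 where "q0 \<in> open_chamber" using open_chamber_nonempty .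
  then have q0: "ht L2 q0 > 0" "ht L3 q0 > 0" by (auto simp: open_chamber_def)
  have h: "ht L2 ((refl L2 ** refl L3) *v q0) = - (ht L2 q0 + ht L3 q0)"
    "ht L2 ((refl L3 ** refl L2) *v q0) = ht L3 q0"
    "ht L3 ((refl L3 ** refl L2) *v q0) = - (ht L2 q0 + ht L3 q0)"
    by (simp_all add: ht_refl flip: matrix_vector_mul_assoc)
  have "mat 1 \<noteq> refl L2 ** refl L3" "mat 1 \<noteq> refl L3 ** refl L2" "refl L2 ** refl L3 \<noteq> refl L3 ** refl L2"
    using h q0 by (auto dest!: arg_cong[of _ _ "\<lambda>A. A *v q0"])
  then show ?thesis by (simp add: stabilizer_vertex3)
qed

lemma vertex2_eqI:
  assumes "p \<in> H2" "ht L1 p = 0" "ht L2 p = 0"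
  shows "p = vertex2"
proof -
  have p: "p $ 3 = 0" "\<kappa> * p $ 1 = \<alpha> * p $ 2" "p $ 1 * p $ 1 - p $ 2 * p $ 2 = 1" "p $ 1 > 0"
    using assms by (auto simp: ht_eq H2_def mink_form_def)
  then have "p $ 1 * p $ 1 = \<alpha> * \<alpha>" using \<alpha>(2) by algebra
  then have 1: "p $ 1 = \<alpha>" using p(4) \<alpha>(1) by (metis abs_of_pos abs_mult_self_eq power2_eq_square real_sqrt_abs)
  then have "p $ 2 = \<kappa>" using p(2) \<alpha>(1) by (simp add: mult.commute)
  with 1 p(1) show ?thesis by (simp add: vec_eq_iff forall_3 vertex2_def)
qed

lemma vertex3_eqI:
  assumes "p \<in> H2" "ht L2 p = 0" "ht L3 p = 0"
  shows "p = vertex3"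
proof -
  have p: "\<kappa> * p $ 1 = \<alpha> * p $ 2" "y * p $ 1 = - x * p $ 3" "p $ 1 > 0" and p1: "mink_form p p = 1"
    using assms by (auto simp: ht_eq H2_def)
  have v: "\<kappa> * vertex3 $ 1 = \<alpha> * vertex3 $ 2" "y * vertex3 $ 1 = - x * vertex3 $ 3" "vertex3 $ 1 > 0"
    and v1: "mink_form vertex3 vertex3 = 1"
    using vertex3_H2 ht_vertex3 by (auto simp: ht_eq H2_def)
  define r where "r = p $ 1 / vertex3 $ 1"
  have r: "r > 0" using p v by (simp add: r_def)
  have 1: "p $ 1 = r * vertex3 $ 1" using v by (simp add: r_def)
  have "\<alpha> * p $ 2 = \<alpha> * (r * vertex3 $ 2)" using 1 p(1) v(1) by algebra
  moreover have "x * p $ 3 = x * (r * vertex3 $ 3)" using 1 p(2) v(2) by algebra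
  ultimately have pr: "p = r *\<^sub>R vertex3"
    using 1 \<alpha> x by (simp add: vec_eq_iff forall_3)
  then have "r * r = 1" using p1 v1 by (simp add: mink_form_linear)
  then have "r = 1" using r by (metis abs_of_pos abs_mult_self_eq mult.right_neutral power2_eq_square real_sqrt_abs real_sqrt_one)
  with pr show ?thesis by simp
qed

text \<open>Away from the two corners at most one side passes through p, so the vertex group
  contains at most one reflection besides the identity.\<close>

lemma chamber_rotation_stabilizer:
  assumes "p \<in> chamber" "A \<in> rotation_group" "A *v p = p" "A \<noteq> mat 1"
  shows "p = vertex2 \<or> p = vertex3"
proof (rule ccontr)
  assume not: "\<not> ?thesis"
  have "p \<in> H2" using assms by (simp add: chamber_def)
  then have one: "s = t" if "ht s p = 0" "ht t p = 0" for s t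
    using that vertex2_eqI[of p] vertex3_eqI[of p] not L1_L3_disjoint[of p]
    by (cases s; cases t) auto
  have "B = mat 1 \<or> (\<exists>s. ht s p = 0 \<and> B = refl s)" if "B \<in> vertex_group p" for B
    using that by induction (auto simp: refl_refl dest: one)
  then have "A = mat 1 \<or> (\<exists>s. A = refl s)"
    using stabilizer_vertex_group assms rotation_group_subset by blast
  then show False using assms by (auto simp: rotation_group_def det_refl)
qed

end

section \<open>Elliptic coordinates on the half-plane\<close>

text \<open>Confocal ellipses and hyperbolas with foci \<open>\<plusminus>1\<close>: the map \<open>sin\<close> of the half-strip in the coordinates
  \<open>s = sin\<close>, \<open>t = sinh\<close>.\<close>

definition elliptic :: "real \<Rightarrow> real \<Rightarrow> complex" where
  "elliptic s t = Complex (s * sqrt (1 + t\<^sup>2)) (t * sqrt (1 - s\<^sup>2))"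

text \<open>The focal distances of sin(u + iv) are cosh v + sin u and cosh v - sin u. Their half
  difference and half sum invert \<open>elliptic\<close> by formulas continuous on the whole plane,
  without a branch of the arcsine.\<close>

definition ell_s :: "complex \<Rightarrow> real" where
  "ell_s w = (cmod (w + 1) - cmod (w - 1)) / 2"

definition ell_t :: "complex \<Rightarrow> real" where
  "ell_t w = sqrt (((cmod (w + 1) + cmod (w - 1)) / 2)\<^sup>2 - 1)"

lemma ell_s_bound: "\<bar>ell_s w\<bar> \<le> 1"
  using norm_triangle_ineq3[of "w + 1" "w - 1"] by (simp add: ell_s_def)

lemma ell_sum_ge: "(cmod (w + 1) + cmod (w - 1)) / 2 \<ge> 1"
  using norm_triangle_ineq4[of "w + 1" "w - 1"] by simp

lemma ell_t_nonneg: "ell_t w \<ge> 0"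
proof -
  have "1\<^sup>2 \<le> ((cmod (w + 1) + cmod (w - 1)) / 2)\<^sup>2"
    using ell_sum_ge[of w] by (intro power_mono) auto
  then show ?thesis by (simp add: ell_t_def)
qed

lemma cmod_elliptic:
  assumes "\<bar>s\<bar> \<le> 1"
  shows "cmod (elliptic s t + 1) = sqrt (1 + t\<^sup>2) + s" "cmod (elliptic s t - 1) = sqrt (1 + t\<^sup>2) - s"
proof -
  have s2: "1 - s\<^sup>2 \<ge> 0" using assms by (simp add: abs_square_le_1)
  have r: "sqrt (1 + t\<^sup>2) \<ge> 1" by simp
  have t2: "(sqrt (1 + t\<^sup>2))\<^sup>2 = 1 + t\<^sup>2" by simp
  have "(cmod (elliptic s t + 1))\<^sup>2 = (sqrt (1 + t\<^sup>2) + s)\<^sup>2"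
    using s2 t2 by (simp add: elliptic_def cmod_power2 power_mult_distrib power2_sum algebra_simps)
  then show "cmod (elliptic s t + 1) = sqrt (1 + t\<^sup>2) + s"
    using r assms by (simp add: power2_eq_iff_nonneg)
  have "(cmod (elliptic s t - 1))\<^sup>2 = (sqrt (1 + t\<^sup>2) - s)\<^sup>2"
    using s2 t2 by (simp add: elliptic_def cmod_power2 power_mult_distrib power2_diff algebra_simps)
  then show "cmod (elliptic s t - 1) = sqrt (1 + t\<^sup>2) - s"
    using r assms by (simp add: power2_eq_iff_nonneg)
qed

lemma ell_elliptic:
  assumes "\<bar>s\<bar> \<le> 1" "t \<ge> 0"
  shows "ell_s (elliptic s t) = s" "ell_t (elliptic s t) = t"
  using assms by (simp_all add: ell_s_def ell_t_def cmod_elliptic)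

lemma elliptic_ell:
  assumes "Im w \<ge> 0"
  shows "elliptic (ell_s w) (ell_t w) = w"
proof -
  define p q where "p = cmod (w + 1)" and "q = cmod (w - 1)"
  have p2: "p\<^sup>2 = (Re w + 1)\<^sup>2 + (Im w)\<^sup>2" and q2: "q\<^sup>2 = (Re w - 1)\<^sup>2 + (Im w)\<^sup>2"
    by (simp_all add: p_def q_def cmod_power2)
  have T: "(p + q) / 2 \<ge> 1" using ell_sum_ge by (simp add: p_def q_def)
  have t2: "(ell_t w)\<^sup>2 = ((p + q) / 2)\<^sup>2 - 1"
  proof -
    have "1\<^sup>2 \<le> ((p + q) / 2)\<^sup>2" using T by (intro power_mono) auto
    then show ?thesis by (simp add: ell_t_def p_def q_def)
  qed
  have s: "ell_s w = (p - q) / 2" by (simp add: ell_s_def p_def q_def)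
  have s2: "1 - (ell_s w)\<^sup>2 \<ge> 0" using ell_s_bound[of w] by (simp add: abs_square_le_1)
  have "sqrt (1 + (ell_t w)\<^sup>2) = (p + q) / 2"
    unfolding t2 using T by simp
  then have "ell_s w * sqrt (1 + (ell_t w)\<^sup>2) = (p - q) / 2 * ((p + q) / 2)"
    by (simp only: s)
  also have "\<dots> = (p\<^sup>2 - q\<^sup>2) / 4" by (simp add: power2_eq_square algebra_simps)
  also have "\<dots> = Re w" unfolding p2 q2 by (simp add: power2_eq_square algebra_simps)
  finally have re: "ell_s w * sqrt (1 + (ell_t w)\<^sup>2) = Re w" .
  have "(ell_t w * sqrt (1 - (ell_s w)\<^sup>2))\<^sup>2 = (((p + q) / 2)\<^sup>2 - 1) * (1 - ((p - q) / 2)\<^sup>2)"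
    using s2 by (simp add: power_mult_distrib t2 s)
  also have "\<dots> = (p\<^sup>2 + q\<^sup>2) / 2 - 1 - ((p\<^sup>2 - q\<^sup>2) / 4)\<^sup>2"
    by (simp add: power2_eq_square algebra_simps add_divide_distrib diff_divide_distrib)
  also have "\<dots> = (Im w)\<^sup>2"
    unfolding p2 q2 by (simp add: power2_eq_square algebra_simps add_divide_distrib diff_divide_distrib)
  finally have "ell_t w * sqrt (1 - (ell_s w)\<^sup>2) = Im w"
    using assms s2 ell_t_nonneg[of w] by (simp add: power2_eq_iff_nonneg)
  with re show ?thesis by (simp add: elliptic_def complex_eq_iff)
qed

lemma Im_elliptic_eq_0:
  assumes "\<bar>s\<bar> \<le> 1"
  shows "Im (elliptic s t) = 0 \<longleftrightarrow> t = 0 \<or> s = 1 \<or> s = - 1"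
  by (auto simp: elliptic_def power2_eq_1_iff)

lemma Im_elliptic_nonneg: "\<bar>s\<bar> \<le> 1 \<Longrightarrow> t \<ge> 0 \<Longrightarrow> Im (elliptic s t) \<ge> 0"
  by (simp add: elliptic_def abs_square_le_1)

context triangle
begin

section \<open>Strip coordinates on the triangle\<close>

definition slope :: "real ^ 3 \<Rightarrow> real" where "slope v = v $ 3 / v $ 1"

text \<open>The height \<open>v $ 2\<close> at which the side \<open>L2\<close> meets the half-plane line of slope \<open>Y\<close>.\<close>

definition side2 :: "real \<Rightarrow> real" where
  "side2 Y = (\<kappa> / \<alpha>) / sqrt (1 - Y\<^sup>2 - (\<kappa> / \<alpha>)\<^sup>2)"

text \<open>The slope is -y/x on \<open>L3\<close> and 0 on \<open>L1\<close>; the affine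
  normalisation moves these values to -1 and 1.\<close>

definition strip_s :: "real ^ 3 \<Rightarrow> real" where "strip_s v = 1 + 2 * x * slope v / y"
definition strip_t :: "real ^ 3 \<Rightarrow> real" where "strip_t v = side2 (slope v) - v $ 2"

definition half_plane :: "real ^ 3 \<Rightarrow> complex" where
  "half_plane v = elliptic (strip_s v) (strip_t v)"

text \<open>The value r is the first coordinate forced by the equation r^2 (1 - Y^2) = 1 + h^2 of
  the hyperboloid along slope Y.\<close>

definition of_strip :: "real \<Rightarrow> real \<Rightarrow> real ^ 3" where
  "of_strip s t = (let Y = y * (s - 1) / (2 * x); h = side2 Y - t; r = sqrt (1 + h\<^sup>2) / sqrt (1 - Y\<^sup>2)
     in vector [r, h, Y * r])"

definition of_half_plane :: "complex \<Rightarrow> real ^ 3" where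
  "of_half_plane w = of_strip (ell_s w) (ell_t w)"

text \<open>In the Klein model the corner of \<open>L2\<close> and \<open>L3\<close> has coordinates
  \<open>\<kappa> / \<alpha>\<close> and -y/x; it lies inside the unit disk. This makes the root in
  \<open>side2\<close> positive over the whole strip, and it bounds \<open>core\<close>
  later.\<close>

lemma slope_bound_c: "(\<kappa> / \<alpha>)\<^sup>2 + (y / x)\<^sup>2 < 1"
proof -
  have "4 * (y * y * (\<kappa> * \<kappa>)) = 1" using \<kappa> by algebra
  then have "(4 * (y * y) + 1) * (\<kappa> * \<kappa>) = \<alpha> * \<alpha>" using \<alpha>(2) by (simp add: algebra_simps)
  then have "(4 * (y * y) + 1) * (\<kappa> / \<alpha>)\<^sup>2 = 1" using \<alpha>(1) by (simp add: power2_eq_square)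
  moreover have "(\<kappa> / \<alpha>)\<^sup>2 > 0" using \<kappa>_pos \<alpha>(1) by simp
  moreover have "4 * (y * y) + 1 > x * x" using y less_1_mult[OF x x] by simp
  ultimately have "x * x * (\<kappa> / \<alpha>)\<^sup>2 < 1" by (metis mult_strict_right_mono)
  moreover have "x * x * (y / x)\<^sup>2 = y * y" using x by (simp add: power2_eq_square)
  ultimately have "x * x * ((\<kappa> / \<alpha>)\<^sup>2 + (y / x)\<^sup>2) < x * x * 1"
    unfolding distrib_left using y(2) by linarith
  then show ?thesis using x by (simp add: mult_less_cancel_left)
qed

lemma slope_bounds:
  assumes "\<bar>Y\<bar> \<le> y / x"
  shows "1 - Y\<^sup>2 - (\<kappa> / \<alpha>)\<^sup>2 > 0" "1 - Y\<^sup>2 > 0"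
proof -
  have "Y\<^sup>2 \<le> (y / x)\<^sup>2" using assms by (metis abs_ge_zero power2_abs power_mono)
  then show "1 - Y\<^sup>2 - (\<kappa> / \<alpha>)\<^sup>2 > 0" using slope_bound_c by simp
  then show "1 - Y\<^sup>2 > 0" using zero_le_power2[of "\<kappa> / \<alpha>"] by linarith
qed

text \<open>Both conditions compare \<open>p $ 2\<close> with a positive bound. They hold trivially
  if \<open>p $ 2\<close> is not positive; otherwise squaring reduces both to the same
  inequality.\<close>

lemma ht_L2_strip_t:
  assumes p: "p \<in> H2" and Y: "\<bar>slope p\<bar> \<le> y / x"
  shows "ht L2 p \<ge> 0 \<longleftrightarrow> strip_t p \<ge> 0" "ht L2 p = 0 \<longleftrightarrow> strip_t p = 0"
proof -
  define c where "c = \<kappa> / \<alpha>"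
  define D where "D = 1 - (slope p)\<^sup>2 - c\<^sup>2"
  have c: "c > 0" using \<kappa>_pos \<alpha> by (simp add: c_def)
  have D: "D > 0" "1 - (slope p)\<^sup>2 > 0" using slope_bounds[OF Y] by (simp_all add: D_def c_def)
  have p1: "p $ 1 > 0" using p by (simp add: H2_def)
  have "p $ 3 = slope p * p $ 1" using p1 by (simp add: slope_def)
  then have q: "(p $ 1)\<^sup>2 * (1 - (slope p)\<^sup>2) = 1 + (p $ 2)\<^sup>2"
    using p by (simp add: H2_def mink_form_def power2_eq_square algebra_simps)
  have h: "ht L2 p = \<alpha> * (c * p $ 1 - p $ 2)" using \<alpha> by (simp add: ht_eq c_def right_diff_distrib)
  have t: "strip_t p = c / sqrt D - p $ 2" by (simp add: strip_t_def side2_def D_def c_def)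
  have pos: "c * p $ 1 > 0" "c / sqrt D > 0" using c p1 D by simp_all
  have "(p $ 2 \<le> c * p $ 1 \<longleftrightarrow> p $ 2 \<le> c / sqrt D) \<and> (p $ 2 = c * p $ 1 \<longleftrightarrow> p $ 2 = c / sqrt D)"
  proof (cases "p $ 2 > 0")
    case False
    then show ?thesis using pos by linarith
  next
    case True
    have "(p $ 2)\<^sup>2 \<le> (c * p $ 1)\<^sup>2 \<longleftrightarrow> (p $ 2)\<^sup>2 * (1 - (slope p)\<^sup>2) \<le> (c * p $ 1)\<^sup>2 * (1 - (slope p)\<^sup>2)"
      using D by simp
    also have "(c * p $ 1)\<^sup>2 * (1 - (slope p)\<^sup>2) = c\<^sup>2 * (1 + (p $ 2)\<^sup>2)"
      by (simp add: power_mult_distrib mult.assoc q)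
    also have "(p $ 2)\<^sup>2 * (1 - (slope p)\<^sup>2) \<le> c\<^sup>2 * (1 + (p $ 2)\<^sup>2) \<longleftrightarrow> (p $ 2)\<^sup>2 * D \<le> c\<^sup>2"
      by (simp add: D_def algebra_simps)
    also have "\<dots> \<longleftrightarrow> (p $ 2)\<^sup>2 \<le> (c / sqrt D)\<^sup>2"
      using D by (simp add: power_divide pos_le_divide_eq)
    finally have 1: "(p $ 2)\<^sup>2 \<le> (c * p $ 1)\<^sup>2 \<longleftrightarrow> (p $ 2)\<^sup>2 \<le> (c / sqrt D)\<^sup>2" .
    have "(p $ 2)\<^sup>2 = (c * p $ 1)\<^sup>2 \<longleftrightarrow> (p $ 2)\<^sup>2 * (1 - (slope p)\<^sup>2) = (c * p $ 1)\<^sup>2 * (1 - (slope p)\<^sup>2)"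
      using D by simp
    also have "(c * p $ 1)\<^sup>2 * (1 - (slope p)\<^sup>2) = c\<^sup>2 * (1 + (p $ 2)\<^sup>2)"
      by (simp add: power_mult_distrib mult.assoc q)
    also have "(p $ 2)\<^sup>2 * (1 - (slope p)\<^sup>2) = c\<^sup>2 * (1 + (p $ 2)\<^sup>2) \<longleftrightarrow> (p $ 2)\<^sup>2 * D = c\<^sup>2"
      by (simp add: D_def algebra_simps)
    also have "\<dots> \<longleftrightarrow> (p $ 2)\<^sup>2 = (c / sqrt D)\<^sup>2"
      using D by (simp add: power_divide eq_divide_eq)
    finally have 2: "(p $ 2)\<^sup>2 = (c * p $ 1)\<^sup>2 \<longleftrightarrow> (p $ 2)\<^sup>2 = (c / sqrt D)\<^sup>2" .
    have sq: "a\<^sup>2 \<le> b\<^sup>2 \<longleftrightarrow> a \<le> b" "a\<^sup>2 = b\<^sup>2 \<longleftrightarrow> a = b" if "0 < a" "0 < b" for a b :: real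
      using that by (simp_all add: power2_eq_iff_nonneg)
    show ?thesis using 1 2 sq True pos by metis
  qed
  moreover have "ht L2 p \<ge> 0 \<longleftrightarrow> p $ 2 \<le> c * p $ 1"
    unfolding h using \<alpha>(1) by (simp add: zero_le_mult_iff)
  moreover have "ht L2 p = 0 \<longleftrightarrow> p $ 2 = c * p $ 1"
    unfolding h using \<alpha>(1) by auto
  moreover have "strip_t p \<ge> 0 \<longleftrightarrow> p $ 2 \<le> c / sqrt D" "strip_t p = 0 \<longleftrightarrow> p $ 2 = c / sqrt D"
    unfolding t by auto
  ultimately show "ht L2 p \<ge> 0 \<longleftrightarrow> strip_t p \<ge> 0" "ht L2 p = 0 \<longleftrightarrow> strip_t p = 0"
    by simp_all
qed

lemma slope_chamber:
  assumes "p \<in> chamber"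
  shows "\<bar>slope p\<bar> \<le> y / x" "\<bar>strip_s p\<bar> \<le> 1" "strip_t p \<ge> 0"
proof -
  have ht: "ht s p \<ge> 0" for s using assms by (simp add: chamber_def)
  have p: "p \<in> H2" "p $ 1 > 0" "p $ 3 \<le> 0" "y * p $ 1 + x * p $ 3 \<ge> 0" "ht L2 p \<ge> 0"
    using assms ht[of L1] ht[of L2] ht[of L3] by (simp_all add: ht_eq) (simp_all add: chamber_def H2_def)
  have "slope p \<le> 0" using p by (simp add: slope_def divide_nonpos_pos)
  moreover have "- (y / x) \<le> slope p" using p x by (simp add: slope_def field_simps)
  ultimately show 1: "\<bar>slope p\<bar> \<le> y / x" by simp
  have "- 1 \<le> x * slope p / y" using \<open>- (y / x) \<le> slope p\<close> x y by (simp add: field_simps)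
  moreover have "x * slope p / y \<le> 0" using \<open>slope p \<le> 0\<close> x y
    by (simp add: divide_nonpos_pos mult_nonneg_nonpos)
  ultimately show "\<bar>strip_s p\<bar> \<le> 1" by (simp add: strip_s_def)
  show "strip_t p \<ge> 0" using ht_L2_strip_t[OF p(1) 1] p by simp
qed

text \<open>The sides \<open>L1\<close>, \<open>L3\<close> and \<open>L2\<close> become the edges of
  the half-strip at 1, -1 and 0, and \<open>elliptic\<close> flattens all three into the real
  axis.\<close>

lemma Im_half_plane:
  assumes "p \<in> chamber"
  shows "Im (half_plane p) \<ge> 0" "Im (half_plane p) = 0 \<longleftrightarrow> (\<exists>s. ht s p = 0)"
proof -
  have p: "p \<in> H2" "p $ 1 > 0" using assms by (auto simp: chamber_def H2_def)
  show "Im (half_plane p) \<ge> 0"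
    using slope_chamber[OF assms] by (simp add: half_plane_def Im_elliptic_nonneg)
  have 1: "strip_s p = 1 \<longleftrightarrow> ht L1 p = 0" using p x y by (simp add: strip_s_def slope_def ht_eq)
  have 3: "strip_s p = - 1 \<longleftrightarrow> ht L3 p = 0"
    using p x y by (simp add: strip_s_def slope_def ht_eq field_simps) argo
  have "Im (half_plane p) = 0 \<longleftrightarrow> ht L1 p = 0 \<or> ht L2 p = 0 \<or> ht L3 p = 0"
    using slope_chamber[OF assms] 1 3 ht_L2_strip_t[OF p(1)]
    by (auto simp: half_plane_def Im_elliptic_eq_0)
  also have "\<dots> \<longleftrightarrow> (\<exists>s. ht s p = 0)" by (metis side.exhaust)
  finally show "Im (half_plane p) = 0 \<longleftrightarrow> (\<exists>s. ht s p = 0)" .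
qed

lemma of_strip:
  assumes "\<bar>s\<bar> \<le> 1" "t \<ge> 0"
  shows "of_strip s t \<in> chamber" "strip_s (of_strip s t) = s" "strip_t (of_strip s t) = t"
proof -
  define Y where "Y = y * (s - 1) / (2 * x)"
  define h where "h = side2 Y - t"
  define r where "r = sqrt (1 + h\<^sup>2) / sqrt (1 - Y\<^sup>2)"
  have v: "of_strip s t = vector [r, h, Y * r]"
    by (simp add: of_strip_def Let_def Y_def h_def r_def)
  have Y0: "Y \<le> 0" using assms x y
    by (simp add: Y_def divide_nonpos_pos mult_nonneg_nonpos)
  have "y * (- 2) \<le> y * (s - 1)" using assms y by (intro mult_left_mono) auto
  then have Y1: "- (y / x) \<le> Y" using x by (simp add: Y_def field_simps)
  have Y: "\<bar>Y\<bar> \<le> y / x" using Y0 Y1 by simp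
  have r: "r > 0" "r\<^sup>2 * (1 - Y\<^sup>2) = 1 + h\<^sup>2"
    using slope_bounds[OF Y] by (auto simp: r_def add_pos_nonneg power_divide)
  have H: "of_strip s t \<in> H2"
    using r by (simp add: v H2_def mink_form_def power2_eq_square algebra_simps)
  have sl: "slope (of_strip s t) = Y" using r by (simp add: v slope_def)
  show s: "strip_s (of_strip s t) = s" using x y by (simp add: strip_s_def sl) (simp add: Y_def)
  show t: "strip_t (of_strip s t) = t" by (simp add: strip_t_def sl) (simp add: v h_def)
  have "ht L1 (of_strip s t) \<ge> 0" using Y0 r by (simp add: ht_eq v mult_nonpos_nonneg)
  moreover have "ht L2 (of_strip s t) \<ge> 0" using ht_L2_strip_t[OF H] sl Y t assms by simp
  moreover have "ht L3 (of_strip s t) \<ge> 0"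
  proof -
    have "y + x * Y \<ge> 0" using Y1 x by (simp add: field_simps)
    then have "(y + x * Y) * r \<ge> 0" using r by simp
    then show ?thesis by (simp add: ht_eq v algebra_simps)
  qed
  ultimately show "of_strip s t \<in> chamber"
    by (rule chamberI[OF H])
qed

lemma of_strip_strip:
  assumes "p \<in> chamber"
  shows "of_strip (strip_s p) (strip_t p) = p"
proof -
  have p: "p \<in> H2" "p $ 1 > 0" using assms by (auto simp: chamber_def H2_def)
  have sl: "y * (strip_s p - 1) / (2 * x) = slope p" using x y by (simp add: strip_s_def)
  have p3: "p $ 3 = slope p * p $ 1" using p by (simp add: slope_def)
  then have q: "(p $ 1)\<^sup>2 * (1 - (slope p)\<^sup>2) = 1 + (p $ 2)\<^sup>2"
    using p by (simp add: H2_def mink_form_def power2_eq_square algebra_simps)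
  have "1 - (slope p)\<^sup>2 > 0" using slope_bounds slope_chamber(1)[OF assms] by blast
  then have "sqrt (1 + (p $ 2)\<^sup>2) / sqrt (1 - (slope p)\<^sup>2) = p $ 1"
    using p by (simp add: real_sqrt_mult flip: q)
  moreover have "side2 (slope p) - strip_t p = p $ 2" by (simp add: strip_t_def)
  ultimately show ?thesis
    unfolding of_strip_def Let_def sl by (simp only:) (simp add: vec_eq_iff forall_3 p3)
qed

lemma half_plane_of_half_plane:
  assumes "Im w \<ge> 0"
  shows "of_half_plane w \<in> chamber" "half_plane (of_half_plane w) = w"
  using of_strip[OF ell_s_bound ell_t_nonneg] elliptic_ell[OF assms]
  by (simp_all add: of_half_plane_def half_plane_def)

lemma of_half_plane_half_plane: "p \<in> chamber \<Longrightarrow> of_half_plane (half_plane p) = p"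
  using slope_chamber[of p] of_strip_strip[of p]
  by (simp add: of_half_plane_def half_plane_def ell_elliptic)

lemma continuous_on_half_plane: "continuous_on chamber half_plane"
proof -
  have 1: "\<forall>v\<in>chamber. v $ 1 \<noteq> 0" by (auto simp: chamber_def H2_def)
  have 2: "\<forall>v\<in>chamber. sqrt (1 - (slope v)\<^sup>2 - (\<kappa> / \<alpha>)\<^sup>2) \<noteq> 0"
    using slope_bounds(1)[OF slope_chamber(1)] by (metis less_irrefl real_sqrt_eq_zero_cancel_iff)
  have y0: "y \<noteq> 0" using y by simp
  have slope: "continuous_on chamber slope"
    unfolding slope_def[abs_def] by (intro continuous_on_divide continuous_on_component continuous_on_id 1)
  have "continuous_on chamber (\<lambda>v. side2 (slope v))"
    unfolding side2_def by (intro continuous_on_divide continuous_on_real_sqrt continuous_on_diff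
        continuous_on_power slope continuous_on_const 2)
  then have t: "continuous_on chamber strip_t"
    unfolding strip_t_def[abs_def] by (intro continuous_on_diff continuous_on_component continuous_on_id)
  have s: "continuous_on chamber strip_s"
    unfolding strip_s_def[abs_def] using y0
    by (intro continuous_on_divide continuous_on_add continuous_on_mult slope continuous_on_const) auto
  show ?thesis
    unfolding half_plane_def[abs_def] elliptic_def
    by (intro continuous_on_Complex continuous_on_mult continuous_on_real_sqrt continuous_on_diff
        continuous_on_add continuous_on_power continuous_on_const s t)
qed

lemma continuous_on_of_half_plane: "continuous_on UNIV of_half_plane"
proof -
  define Y where "Y w = y * (ell_s w - 1) / (2 * x)" for w
  define h where "h w = side2 (Y w) - ell_t w" for w
  define r where "r w = sqrt (1 + (h w)\<^sup>2) / sqrt (1 - (Y w)\<^sup>2)" for w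
  \<comment> \<open>\<open>ell_s\<close> takes values in [-1, 1] everywhere, so the slope stays
    admissible also for w below the real axis.\<close>
  have Y: "\<bar>Y w\<bar> \<le> y / x" for w
  proof -
    have "\<bar>ell_s w - 1\<bar> \<le> 2" using ell_s_bound[of w] by linarith
    then have "y * \<bar>ell_s w - 1\<bar> \<le> y * 2" using y by (intro mult_left_mono) auto
    then have "y * \<bar>ell_s w - 1\<bar> / (2 * x) \<le> y * 2 / (2 * x)"
      using x by (intro divide_right_mono) auto
    moreover have "\<bar>Y w\<bar> = y * \<bar>ell_s w - 1\<bar> / (2 * x)"
      using x y(1) by (simp add: Y_def abs_mult del: times_divide_eq_right)
    ultimately show ?thesis by simp
  qed
  have ne: "\<forall>w\<in>UNIV. sqrt (1 - (Y w)\<^sup>2 - (\<kappa> / \<alpha>)\<^sup>2) \<noteq> 0" "\<forall>w\<in>UNIV. sqrt (1 - (Y w)\<^sup>2) \<noteq> 0"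
    using slope_bounds[OF Y] by (metis less_irrefl real_sqrt_eq_zero_cancel_iff)+
  have ell: "continuous_on UNIV ell_s" "continuous_on UNIV ell_t"
    unfolding ell_s_def ell_t_def by (auto intro!: continuous_intros)
  have cY: "continuous_on UNIV Y"
    unfolding Y_def[abs_def] using x
    by (intro continuous_on_divide continuous_on_mult continuous_on_diff ell continuous_on_const) auto
  have ch: "continuous_on UNIV h"
    unfolding h_def[abs_def] side2_def
    by (intro continuous_on_diff continuous_on_divide continuous_on_real_sqrt continuous_on_power
        continuous_on_const cY ell ne)
  have cr: "continuous_on UNIV r"
    unfolding r_def[abs_def]
    by (intro continuous_on_diff continuous_on_add continuous_on_divide continuous_on_real_sqrt
        continuous_on_power continuous_on_const cY ch ne)
  have eq: "of_half_plane w = vector [r w, h w, Y w * r w]" for w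
    by (simp add: of_half_plane_def of_strip_def Let_def r_def h_def Y_def)
  have "continuous_on UNIV (\<lambda>w. of_half_plane w $ i)" for i
    using exhaust_3[of i] cr ch continuous_on_mult[OF cY cr] by (elim disjE) (simp_all add: eq)
  then have "continuous_on UNIV (\<lambda>w. \<chi> i. of_half_plane w $ i)"
    by (intro continuous_on_vec_lambda)
  then show ?thesis by simp
qed

end

section \<open>The orbit space\<close>

lemma c_map_uminus: "c_map (- q) = c_map q"
proof -
  have "quat_cnj (- q) = - quat_cnj q" by (simp add: quat_cnj_def uminus_quat_def)
  then show ?thesis by (simp add: c_map_def)
qed

context triangle
begin

section \<open>The image of the trefoil group is the rotation group\<close>

lemma rho_gen_reflections:
  "c_map (rho_gen x gen_a) = refl L3 ** refl L1"
  "c_map (rho_gen x gen_b) = refl L1 ** refl L3 ** refl L2 ** refl L3"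
proof -
  have y_sqrt: "sqrt (x\<^sup>2 - 1) = y"
    using y by (intro real_sqrt_unique) (simp_all add: power2_eq_square)
  have "4 * (y * y * (\<kappa> * \<kappa>)) = 1" using \<kappa> by algebra
  then have "(2 * \<alpha>)\<^sup>2 * (y * y) = 4 * x\<^sup>2 - 3"
    using y(2) \<alpha>(2) unfolding power2_eq_square by algebra
  then have "(4 * x\<^sup>2 - 3) / (y * y) = (2 * \<alpha>)\<^sup>2"
    using y(1) by (simp add: divide_eq_eq)
  then have "(4 * x\<^sup>2 - 3) / (x\<^sup>2 - 1) = (2 * \<alpha>)\<^sup>2"
    unfolding y(2) by (simp only: power2_eq_square)
  then have \<alpha>_sqrt: "1 / 2 * sqrt ((4 * x\<^sup>2 - 3) / (x\<^sup>2 - 1)) = \<alpha>"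
    using \<alpha>(1) by (simp only: real_sqrt_abs)
  \<comment> \<open>The form in which the coefficient of j appears in the product of the four
    normals below.\<close>
  have \<beta>: "(2 * x\<^sup>2 - 1) / (2 * y) = \<kappa> * (x * x) + y / 2"
  proof -
    have "(\<kappa> * (x * x) + y / 2) * (2 * y) = 2 * x\<^sup>2 - 1"
      using \<kappa> y(2) unfolding power2_eq_square by algebra
    then show ?thesis using y(1) by (simp add: divide_eq_eq)
  qed
  have a: "rho_gen x gen_a = - (pure_quat (normal L3) * pure_quat (normal L1))"
    by (simp add: rho_gen_def y_sqrt quat_j_def of_real_def quat_defs pure_quat_def normal_def)
  show "c_map (rho_gen x gen_a) = refl L3 ** refl L1"
    by (simp add: a c_map_uminus c_map_mult refl_def)
  have 13: "pure_quat (normal L1) * pure_quat (normal L3) = Quat (- x) 0 y 0"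
    and 23: "pure_quat (normal L2) * pure_quat (normal L3) = Quat (- (1 / 2)) (\<alpha> * x) (\<kappa> * x) (- (\<alpha> * y))"
    using \<kappa> by (simp_all add: quat_defs pure_quat_def normal_def algebra_simps)
  have "rho_gen x gen_b = Quat x (- \<alpha>) (- (\<kappa> * (x * x) + y / 2)) 0"
    by (simp add: rho_gen_def y_sqrt \<alpha>_sqrt \<beta> quat_i_def quat_j_def of_real_def quat_defs
      del: times_divide_eq_left)
  also have "\<dots> = Quat (- x) 0 y 0 * Quat (- (1 / 2)) (\<alpha> * x) (\<kappa> * x) (- (\<alpha> * y))"
  proof -
    have "x = x / 2 + y * (\<kappa> * x)" using \<kappa> by algebra
    moreover have "- \<alpha> = - (x * (\<alpha> * x)) + y * (\<alpha> * y)" using y(2) by algebra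
    ultimately show ?thesis by (simp add: times_quat_def algebra_simps)
  qed
  finally have "rho_gen x gen_b = (pure_quat (normal L1) * pure_quat (normal L3))
      * (pure_quat (normal L2) * pure_quat (normal L3))"
    by (simp only: 13 23)
  then show "c_map (rho_gen x gen_b) = refl L1 ** refl L3 ** refl L2 ** refl L3"
    by (simp add: c_map_mult refl_def matrix_mul_assoc)
qed

lemma rho'_image_subset: "rho' x ` carrier trefoil_group \<subseteq> rotation_group"
proof -
  have gen: "c_map (rho_gen x g) \<in> rotation_group" for g
    using rotation_group_mult[OF rotation_group_refl2 rotation_group_refl2, of L1 L3 L2 L3]
      rotation_group_refl2[of L3 L1]
    by (cases g) (simp_all add: rho_gen_reflections matrix_mul_assoc)
  have gen_inv: "c_map (inv\<^bsub>unit_quats\<^esub> (rho_gen x g)) \<in> rotation_group" for g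
  proof -
    have "rho_gen x g \<in> carrier unit_quats" using rho_gen_unit[OF x] by auto
    from group.l_inv[OF group_unit_quats this]
    have 1: "c_map (inv\<^bsub>unit_quats\<^esub> (rho_gen x g)) ** c_map (rho_gen x g) = mat 1"
      by (simp add: unit_quats_def c_map_1 flip: c_map_mult)
    obtain B where B: "B \<in> rotation_group" "c_map (rho_gen x g) ** B = mat 1"
      using rotation_group_inverse[OF gen] by blast
    have "c_map (inv\<^bsub>unit_quats\<^esub> (rho_gen x g)) = B"
      using 1 B(2) by (metis matrix_mul_assoc matrix_mul_lid matrix_mul_rid)
    then show ?thesis using B(1) by simp
  qed
  have "c_map (word_val unit_quats (rho_gen x) w) \<in> rotation_group" for w
  proof (induction w)
    case Nil
    then show ?case by (simp add: word_val_def unit_quats_def c_map_1 rotation_group_one)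
  next
    case (Cons p w)
    obtain g e where p: "p = (g, e)" by (cases p)
    have "c_map (word_val unit_quats (rho_gen x) (p # w))
        = c_map (if e then rho_gen x g else inv\<^bsub>unit_quats\<^esub> (rho_gen x g))
            ** c_map (word_val unit_quats (rho_gen x) w)"
      by (simp add: p word_val_def c_map_mult[symmetric] unit_quats_def)
    then show ?case using Cons gen[of g] gen_inv[of g] by (simp add: rotation_group_mult)
  qed
  then show ?thesis by (auto simp: rho'_image[OF x])
qed

lemma rho'_image_eq: "rho' x ` carrier trefoil_group = rotation_group"
proof
  let ?I = "rho' x ` carrier trefoil_group"
  interpret I: subgroup ?I SO012 by (rule subgroup_rho'_image[OF x])
  have mult: "A ** B \<in> ?I" if "A \<in> ?I" "B \<in> ?I" for A B
    using I.m_closed[OF that] by (simp add: SO012_def)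
  have inv: "B \<in> ?I" if A: "A \<in> ?I" "A ** B = mat 1" for A B
  proof -
    have "inv\<^bsub>SO012\<^esub> A ** A = mat 1"
      using group.l_inv[OF group_SO012, of A] I.subset A(1) by (auto simp: SO012_def)
    then have "inv\<^bsub>SO012\<^esub> A = B" using A(2) by (metis matrix_mul_assoc matrix_mul_lid matrix_mul_rid)
    then show ?thesis using I.m_inv_closed[OF A(1)] by simp
  qed
  have rho_gen_in: "c_map (rho_gen x g) \<in> ?I" for g
  proof -
    have "word_val unit_quats (rho_gen x) [(g, True)] = rho_gen x g"
      by (simp add: word_val_def unit_quats_def)
    then show ?thesis unfolding rho'_image[OF x] by (metis rangeI)
  qed
  have 31: "refl L3 ** refl L1 \<in> ?I" and b: "refl L1 ** refl L3 ** refl L2 ** refl L3 \<in> ?I"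
    using rho_gen_in[of gen_a] rho_gen_in[of gen_b] by (simp_all add: rho_gen_reflections)
  have inv2: "refl t ** refl s \<in> ?I" if "refl s ** refl t \<in> ?I" for s t
    by (rule inv[OF that]) (simp add: matrix_mul_assoc mult_refl_refl refl_refl)
  have 13: "refl L1 ** refl L3 \<in> ?I" by (rule inv2[OF 31])
  \<comment> \<open>The image of ab: the reflections in \<open>L1\<close> and \<open>L3\<close>
    cancel in the middle.\<close>
  have "refl L2 ** refl L3 \<in> ?I"
    using mult[OF 31 b] by (simp add: matrix_mul_assoc mult_refl_refl refl_refl)
  from mult[OF this 31] have 21: "refl L2 ** refl L1 \<in> ?I"
    by (simp add: matrix_mul_assoc mult_refl_refl)
  have s1: "refl s ** refl L1 \<in> ?I" for s
    using 31 21 I.one_closed by (cases s) (simp_all add: refl_refl SO012_def)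
  have s1': "refl L1 ** refl s \<in> ?I" for s using inv2 s1 by blast
  \<comment> \<open>The group is generated by single reflections, which change parity, so the
    induction carries the odd elements too, corrected by \<open>refl L1\<close>.\<close>
  have "(det A = 1 \<longrightarrow> A \<in> ?I) \<and> (det A = - 1 \<longrightarrow> refl L1 ** A \<in> ?I)" if "A \<in> reflection_group" for A
    using that
  proof induction
    case reflection_group_one
    then show ?case using I.one_closed by (simp add: SO012_def)
  next
    case (reflection_group_refl_mult A s)
    have "refl s ** A = (refl s ** refl L1) ** (refl L1 ** A)"
      by (simp add: matrix_mul_assoc mult_refl_refl)
    moreover have "refl L1 ** (refl s ** A) = (refl L1 ** refl s) ** A"
      by (simp add: matrix_mul_assoc)
    ultimately show ?case using reflection_group_refl_mult.IH mult s1 s1'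
      by (auto simp: det_mul det_refl)
  qed
  then show "rotation_group \<subseteq> ?I" by (auto simp: rotation_group_def)
qed (rule rho'_image_subset)

section \<open>Discreteness\<close>

lemma open_chamber_discrete:
  assumes "A \<in> reflection_group" "B \<in> reflection_group" "q \<in> H2"
    "A *v q \<in> open_chamber" "B *v q \<in> chamber"
  shows "A = B"
proof -
  obtain C where C: "C \<in> reflection_group" "A ** C = mat 1" "C ** A = mat 1"
    using reflection_group_inverse[OF assms(1)] .
  have "A *v q = B *v q"
    using assms open_chamber_subset by (metis fold_chamber fold_reflection_group subset_iff)
  then have "(B ** C) *v (A *v q) = A *v q"
    by (metis C(3) matrix_mul_assoc matrix_vector_mul_assoc matrix_mul_rid)
  then have "B ** C = mat 1"
    using open_chamber_fixed[OF assms(4)] reflection_group_mult[OF assms(2) C(1)] by blast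
  then show ?thesis using C by (metis matrix_mul_assoc matrix_mul_lid matrix_mul_rid)
qed

lemma open_ht: "open {v. \<forall>s. ht s v > 0}"
proof -
  have "{v. \<forall>s. ht s v > 0} = {v. ht L1 v > 0} \<inter> {v. ht L2 v > 0} \<inter> {v. ht L3 v > 0}"
    by (auto intro: side.exhaust) (metis side.exhaust)
  moreover have "open {v. ht s v > 0}" for s
    unfolding ht_def mink_form_def by (intro open_Collect_less continuous_intros)
  ultimately show ?thesis by (simp only: open_Int)
qed

text \<open>Let C be the inverse of A. Moving an interior point q by \<open>C ** B\<close> keeps it
  in the open triangle for all matrices B near A; among group elements only A does this.\<close>

lemma discrete_rotation_group: "discrete rotation_group"
proof (rule discreteI)
  fix A assume A: "A \<in> rotation_group"
  obtain q where q: "q \<in> open_chamber" using open_chamber_nonempty .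
  then have qH: "q \<in> H2" by (simp add: open_chamber_def)
  obtain C where C: "C \<in> rotation_group" "A ** C = mat 1" "C ** A = mat 1"
    using rotation_group_inverse[OF A] .
  define T where "T = (\<lambda>B. (C ** B) *v q) -` {v. \<forall>s. ht s v > 0}"
  have "continuous_on UNIV (\<lambda>B :: real ^ 3 ^ 3. ((C ** B) *v q) $ i)" for i
    unfolding matrix_vector_mult_def matrix_matrix_mult_def sum_3
    by (simp add: sum_3) (intro continuous_intros)
  then have "continuous_on UNIV (\<lambda>B :: real ^ 3 ^ 3. \<chi> i. ((C ** B) *v q) $ i)"
    by (intro continuous_on_vec_lambda)
  then have "continuous_on UNIV (\<lambda>B :: real ^ 3 ^ 3. (C ** B) *v q)" by simp
  then have "open T" unfolding T_def using open_ht by (metis continuous_on_open_vimage open_UNIV inf_top_right)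
  moreover have "T \<inter> rotation_group = {A}"
  proof (intro equalityI subsetI)
    fix B assume B: "B \<in> T \<inter> rotation_group"
    then have "C ** B \<in> reflection_group" "B \<in> rotation_group"
      using C(1) rotation_group_mult rotation_group_subset by blast+
    moreover from this have "(C ** B) *v q \<in> open_chamber"
      using B reflection_group_H2[OF _ qH] by (auto simp: T_def open_chamber_def)
    ultimately have "C ** B = mat 1"
      using open_chamber_discrete[of "C ** B" "mat 1" q] q qH open_chamber_subset
      by (auto intro: reflection_group_one)
    then show "B \<in> {A}" using C by (metis matrix_mul_assoc matrix_mul_lid matrix_mul_rid singletonI)
  next
    fix B assume "B \<in> {A}"
    then show "B \<in> T \<inter> rotation_group" using A C q by (simp add: T_def open_chamber_def)
  qed
  ultimately show "A isolated_in rotation_group" using A by (auto simp: isolated_in_def)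
qed

section \<open>Orbits and the double of the triangle\<close>

lemma Gorbit_eqI:
  assumes "A \<in> rotation_group" "A *v u = v"
  shows "Gorbit rotation_group u = Gorbit rotation_group v"
proof -
  obtain B where B: "B \<in> rotation_group" "B ** A = mat 1"
    using rotation_group_inverse[OF assms(1)] by metis
  have "B *v v = u" using B(2) assms(2) by (metis matrix_vector_mul_assoc matrix_vector_mul_lid)
  then have u: "C *v u = (C ** B) *v v" for C by (metis matrix_vector_mul_assoc)
  have v: "C *v v = (C ** A) *v u" for C using assms(2) by (metis matrix_vector_mul_assoc)
  show ?thesis
    unfolding Gorbit_def
    using u v rotation_group_mult[OF _ assms(1)] rotation_group_mult[OF _ B(1)] by fast
qed

lemma Gorbit_self: "v \<in> Gorbit rotation_group v"
  using rotation_group_one by (force simp: Gorbit_def)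

lemma Gorbit_eq_iff: "Gorbit rotation_group u = Gorbit rotation_group v \<longleftrightarrow> v \<in> Gorbit rotation_group u"
  using Gorbit_self[of v] Gorbit_eqI[of _ u v] by (auto simp: Gorbit_def)

lemma fold_Gorbit: "v \<in> H2 \<Longrightarrow> u \<in> Gorbit rotation_group v \<Longrightarrow> fold u = fold v"
  by (auto simp: Gorbit_def fold_reflection_group rotation_group_subset)

text \<open>Rotations have index two, so a reflection orbit splits at most into the orbits of
  \<open>fold v\<close> and of its mirror image. Any side may serve as mirror, because a product of
  two reflections is a rotation.\<close>

lemma Gorbit_fold_cases:
  assumes "v \<in> H2"
  shows "Gorbit rotation_group v = Gorbit rotation_group (fold v)
    \<or> (\<forall>s. Gorbit rotation_group v = Gorbit rotation_group (refl s *v fold v))"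
proof -
  obtain A where A: "A \<in> reflection_group" "A *v v = fold v" using fold_reachable[OF assms] .
  show ?thesis
  proof (cases "det A = 1")
    case True
    then show ?thesis using A Gorbit_eqI[of A v] by (simp add: rotation_group_def)
  next
    case False
    then have "refl s ** A \<in> rotation_group" for s
      using det_reflection_group[OF A(1)] A(1)
      by (auto simp: rotation_group_def det_mul det_refl intro: reflection_group.intros)
    moreover have "(refl s ** A) *v v = refl s *v fold v" for s
      using A(2) by (simp flip: matrix_vector_mul_assoc)
    ultimately show ?thesis using Gorbit_eqI by blast
  qed
qed

lemma Gorbit_fold_side:
  "v \<in> H2 \<Longrightarrow> ht s (fold v) = 0 \<Longrightarrow> Gorbit rotation_group v = Gorbit rotation_group (fold v)"
  using Gorbit_fold_cases[of v] refl_fixes[of s "fold v"] by metis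

lemma chamber_H2: "p \<in> chamber \<Longrightarrow> p \<in> H2"
  by (simp add: chamber_def)

lemma open_chamberI:
  assumes "p \<in> chamber" "\<not> (\<exists>s. ht s p = 0)"
  shows "p \<in> open_chamber"
  using assms by (auto simp: chamber_def open_chamber_def order_less_le)

text \<open>The two copies of the triangle become the upper and the lower half-plane. They are glued
  along the real axis, where the cases agree.\<close>

definition orbit_coord :: "real ^ 3 \<Rightarrow> complex" where
  "orbit_coord v = (if fold v \<in> Gorbit rotation_group v then half_plane (fold v)
     else cnj (half_plane (fold v)))"

definition orbit_point :: "complex \<Rightarrow> real ^ 3" where
  "orbit_point w = (if 0 \<le> Im w then of_half_plane w else refl L1 *v of_half_plane (cnj w))"

lemma orbit_coord_Gorbit:
  assumes "v \<in> H2" "u \<in> Gorbit rotation_group v"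
  shows "orbit_coord u = orbit_coord v"
  using assms fold_Gorbit[OF assms] Gorbit_eq_iff[of v u] by (simp add: orbit_coord_def)

text \<open>Over the open triangle the reducing element is unique, so its determinant decides which
  copy the orbit belongs to.\<close>

lemma fold_in_Gorbit_iff:
  assumes "A \<in> reflection_group" "v \<in> H2" "A *v v \<in> open_chamber"
  shows "fold v = A *v v" "fold v \<in> Gorbit rotation_group v \<longleftrightarrow> A \<in> rotation_group"
proof -
  show eq: "fold v = A *v v"
    using assms open_chamber_subset by (metis fold_chamber fold_reflection_group subset_iff)
  show "fold v \<in> Gorbit rotation_group v \<longleftrightarrow> A \<in> rotation_group"
  proof
    assume "fold v \<in> Gorbit rotation_group v"
    then obtain B where B: "B \<in> rotation_group" "fold v = B *v v" by (auto simp: Gorbit_def)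
    have "A = B"
      using open_chamber_discrete[OF assms(1) _ assms(2,3)] B fold(1)[OF assms(2)] rotation_group_subset
      by metis
    with B show "A \<in> rotation_group" by simp
  qed (auto simp: eq Gorbit_def)
qed

lemma orbit_point_H2: "orbit_point w \<in> H2"
  using half_plane_of_half_plane(1)[of w] half_plane_of_half_plane(1)[of "cnj w"]
  by (auto simp: orbit_point_def chamber_H2 refl_H2)

lemma orbit_coord_orbit_point: "orbit_coord (orbit_point w) = w"
proof (cases "Im w \<ge> 0")
  case True
  then show ?thesis
    using half_plane_of_half_plane[OF True]
    by (simp add: orbit_point_def orbit_coord_def fold_chamber Gorbit_self)
next
  case False
  define p where "p = of_half_plane (cnj w)"
  have p: "p \<in> chamber" "half_plane p = cnj w"
    using half_plane_of_half_plane[of "cnj w"] False by (simp_all add: p_def)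
  have po: "p \<in> open_chamber" using open_chamberI[OF p(1)] Im_half_plane(2)[OF p(1)] p(2) False by simp
  have "refl L1 \<notin> rotation_group" by (simp add: rotation_group_def det_refl)
  then have "fold (refl L1 *v p) = p \<and> p \<notin> Gorbit rotation_group (refl L1 *v p)"
    using fold_in_Gorbit_iff[OF reflection_group_refl refl_H2[OF chamber_H2[OF p(1)]], of L1 L1] po
    by simp
  then show ?thesis using False p by (simp add: orbit_point_def orbit_coord_def p_def)
qed

lemma Gorbit_orbit_point:
  assumes "v \<in> H2"
  shows "Gorbit rotation_group (orbit_point (orbit_coord v)) = Gorbit rotation_group v"
proof -
  have p: "fold v \<in> chamber" using fold(1)[OF assms] .
  show ?thesis
  proof (cases "fold v \<in> Gorbit rotation_group v")
    case True
    then show ?thesis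
      using p Im_half_plane(1)[OF p] Gorbit_eq_iff[of v "fold v"]
      by (simp add: orbit_coord_def orbit_point_def of_half_plane_half_plane)
  next
    case False
    then have "\<not> (\<exists>s. ht s (fold v) = 0)"
      using Gorbit_fold_side[OF assms] Gorbit_self by metis
    then have "Im (half_plane (fold v)) \<noteq> 0" using Im_half_plane(2)[OF p] by blast
    then have "Im (half_plane (fold v)) > 0" using Im_half_plane(1)[OF p] by linarith
    moreover have "Gorbit rotation_group v = Gorbit rotation_group (refl L1 *v fold v)"
      using Gorbit_fold_cases[OF assms] False Gorbit_self by metis
    ultimately show ?thesis
      using False p by (simp add: orbit_coord_def orbit_point_def of_half_plane_half_plane)
  qed
qed

lemma continuous_on_orbit_coord: "continuous_on H2 orbit_coord"
  unfolding continuous_on_def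
proof
  fix v assume v: "v \<in> H2"
  have p: "fold v \<in> chamber" using fold(1)[OF v] .
  have cont: "continuous_on H2 (\<lambda>v. half_plane (fold v))"
    using continuous_on_compose2[OF continuous_on_half_plane continuous_on_fold] fold(1) by blast
  then have lim: "((\<lambda>v. half_plane (fold v)) \<longlongrightarrow> half_plane (fold v)) (at v within H2)"
    using v by (simp add: continuous_on_def)
  have ev: "eventually (\<lambda>u. u \<in> H2) (at v within H2)" by (simp add: eventually_at_filter)
  show "(orbit_coord \<longlongrightarrow> orbit_coord v) (at v within H2)"
  proof (cases "\<exists>s. ht s (fold v) = 0")
    case True
    then have "Im (half_plane (fold v)) = 0" using Im_half_plane(2)[OF p] by simp
    then have real: "cnj (half_plane (fold v)) = half_plane (fold v)" by (simp add: complex_eq_iff)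
    \<comment> \<open>Conjugation is an isometry fixing the real limit, so the choice of case for u
      does not affect the distance.\<close>
    have "dist (orbit_coord u) (orbit_coord v) = dist (half_plane (fold u)) (half_plane (fold v))" for u
      using complex_mod_cnj[of "half_plane (fold u) - half_plane (fold v)"]
      by (auto simp: orbit_coord_def real dist_norm)
    then show ?thesis using lim by (simp add: tendsto_iff)
  next
    case False
    then have po: "fold v \<in> open_chamber" using open_chamberI[OF p] by simp
    obtain A where A: "A \<in> reflection_group" "A *v v = fold v" using fold_reachable[OF v] .
    \<comment> \<open>The same A moves all points near v into the open triangle, so the choice of
      copy is locally constant.\<close>
    have "((\<lambda>u. A *v u) \<longlongrightarrow> A *v v) (at v within H2)"
      by (intro tendsto_intros bounded_linear.tendsto[OF matrix_vector_mul_bounded_linear])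
    then have "eventually (\<lambda>u. A *v u \<in> {v. \<forall>s. ht s v > 0}) (at v within H2)"
      by (rule topological_tendstoD[OF _ open_ht]) (use po A in \<open>simp add: open_chamber_def\<close>)
    then have "eventually (\<lambda>u. orbit_coord u
        = (if A \<in> rotation_group then half_plane (fold u) else cnj (half_plane (fold u)))) (at v within H2)"
      using ev
    proof eventually_elim
      case (elim u)
      then have "A *v u \<in> open_chamber"
        using reflection_group_H2[OF A(1)] by (simp add: open_chamber_def)
      from fold_in_Gorbit_iff(2)[OF A(1) elim(2) this] show ?case by (simp add: orbit_coord_def)
    qed
    moreover have "orbit_coord v
        = (if A \<in> rotation_group then half_plane (fold v) else cnj (half_plane (fold v)))"
      using fold_in_Gorbit_iff(2)[OF A(1) v] A(2) po by (simp add: orbit_coord_def)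
    moreover have "((\<lambda>u. if A \<in> rotation_group then half_plane (fold u) else cnj (half_plane (fold u)))
      \<longlongrightarrow> (if A \<in> rotation_group then half_plane (fold v) else cnj (half_plane (fold v)))) (at v within H2)"
      using lim by (auto intro: tendsto_cnj)
    ultimately show ?thesis by (simp add: tendsto_cong)
  qed
qed

lemma continuous_map_Gorbit:
  "continuous_map (top_of_set H2) (orbit_space rotation_group) (Gorbit rotation_group)"
  by (auto simp: continuous_map_def topspace_orbit_space openin_orbit_space)

lemma continuous_map_orbit_point:
  "continuous_map euclidean (orbit_space rotation_group) (\<lambda>w. Gorbit rotation_group (orbit_point w))"
proof -
  have c1: "continuous_map (top_of_set {w. 0 \<le> Im w}) (top_of_set H2) of_half_plane"
    using continuous_on_subset[OF continuous_on_of_half_plane] half_plane_of_half_plane(1) chamber_H2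
    by (auto simp: continuous_map_in_subtopology)
  have "continuous_on UNIV (\<lambda>w. refl L1 *v of_half_plane (cnj w))"
    by (intro bounded_linear.continuous_on[OF matrix_vector_mul_bounded_linear]
        continuous_on_compose2[OF continuous_on_of_half_plane] continuous_intros) auto
  then have c2: "continuous_map (top_of_set {w. Im w \<le> 0}) (top_of_set H2) (\<lambda>w. refl L1 *v of_half_plane (cnj w))"
    using half_plane_of_half_plane(1) chamber_H2 refl_H2
    by (auto simp: continuous_map_in_subtopology elim: continuous_on_subset)
  have "continuous_map euclidean (orbit_space rotation_group)
    (\<lambda>w. if 0 \<le> Im w then Gorbit rotation_group (of_half_plane w)
      else Gorbit rotation_group (refl L1 *v of_half_plane (cnj w)))"
  proof (rule continuous_map_cases_le)
    show "Gorbit rotation_group (of_half_plane w) = Gorbit rotation_group (refl L1 *v of_half_plane (cnj w))"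
      if "0 = Im w" for w
    proof -
      have w: "cnj w = w" using that by (simp add: complex_eq_iff)
      have p: "of_half_plane w \<in> chamber" "Im (half_plane (of_half_plane w)) = 0"
        using half_plane_of_half_plane[of w] that by simp_all
      then obtain s where "ht s (of_half_plane w) = 0" using Im_half_plane(2) by blast
      \<comment> \<open>On the side s the reflection \<open>refl s\<close> can be inserted for free;
        it completes \<open>refl L1\<close> to a rotation.\<close>
      then have "(refl L1 ** refl s) *v of_half_plane w = refl L1 *v of_half_plane w"
        by (simp add: refl_fixes flip: matrix_vector_mul_assoc)
      from Gorbit_eqI[OF rotation_group_refl2 this] show ?thesis by (simp add: w)
    qed
  qed (use continuous_map_compose[OF c1 continuous_map_Gorbit] continuous_map_compose[OF c2 continuous_map_Gorbit]
      in \<open>auto simp: o_def intro: continuous_intros\<close>)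
  then show ?thesis by (simp add: orbit_point_def if_distrib)
qed

lemma orbit_space_homeomorphic:
  "orbit_space rotation_group homeomorphic_space top_of_set (ball (0::complex) 1)"
proof -
  define f where "f S = the_elem (orbit_coord ` S)" for S
  have f: "f (Gorbit rotation_group v) = orbit_coord v" if "v \<in> H2" for v
  proof -
    have "orbit_coord ` Gorbit rotation_group v = {orbit_coord v}"
      using orbit_coord_Gorbit[OF that] Gorbit_self by blast
    then show ?thesis by (simp add: f_def)
  qed
  have "continuous_map (orbit_space rotation_group) euclidean f"
    unfolding continuous_map_def
  proof (intro conjI allI impI)
    fix W :: "complex set" assume "openin euclidean W"
    then have "openin (top_of_set H2) {v \<in> H2. orbit_coord v \<in> W}"
      using continuous_openin_preimage_gen[OF continuous_on_orbit_coord, of W]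
      by (simp add: vimage_def Int_def)
    moreover have "{v \<in> H2. Gorbit rotation_group v \<in> {S \<in> Gorbit rotation_group ` H2. f S \<in> W}}
        = {v \<in> H2. orbit_coord v \<in> W}" by (auto simp: f)
    ultimately show "openin (orbit_space rotation_group)
        {S \<in> topspace (orbit_space rotation_group). f S \<in> W}"
      by (auto simp: openin_orbit_space topspace_orbit_space)
  qed auto
  then have "homeomorphic_maps (orbit_space rotation_group) euclidean f
      (\<lambda>w. Gorbit rotation_group (orbit_point w))"
    using continuous_map_orbit_point
    by (auto simp: homeomorphic_maps_def topspace_orbit_space f Gorbit_orbit_point orbit_point_H2
        orbit_coord_orbit_point)
  then have 1: "orbit_space rotation_group homeomorphic_space (euclidean :: complex topology)"
    by (auto simp: homeomorphic_space_def)
  have "(UNIV :: complex set) homeomorphic ball (0::complex) 1"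
    using homeomorphic_ball01_UNIV homeomorphic_sym by blast
  then have "(euclidean :: complex topology) homeomorphic_space top_of_set (ball (0::complex) 1)"
    unfolding homeomorphic_space_def homeomorphic_maps_def homeomorphic_def homeomorphism_def
    by (auto simp: continuous_map_in_subtopology)
  with 1 show ?thesis by (rule homeomorphic_space_trans)
qed

text \<open>A nontrivial rotation fixing v is conjugated into one fixing \<open>fold v\<close>. The
  conjugating B may be orientation-reversing; the conjugate still has determinant 1.\<close>

lemma cone_points_rotation_group:
  "cone_points rotation_group = {Gorbit rotation_group vertex2, Gorbit rotation_group vertex3}"
proof (intro equalityI subsetI)
  fix S assume "S \<in> cone_points rotation_group"
  then obtain v where v: "v \<in> H2" "S = Gorbit rotation_group v" "stabilizer rotation_group v \<noteq> {mat 1}"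
    by (auto simp: cone_points_def)
  have "mat 1 \<in> stabilizer rotation_group v" by (simp add: stabilizer_def rotation_group_one)
  with v(3) obtain A where A: "A \<in> rotation_group" "A *v v = v" "A \<noteq> mat 1"
    by (auto simp: stabilizer_def)
  obtain B where B: "B \<in> reflection_group" "B *v v = fold v" using fold_reachable[OF v(1)] .
  obtain C where C: "C \<in> reflection_group" "B ** C = mat 1" "C ** B = mat 1"
    using reflection_group_inverse[OF B(1)] .
  let ?D = "B ** A ** C"
  have "det B * det C = 1" using C(2) det_mul[of B C] by simp
  then have "?D \<in> rotation_group"
    using A(1) B(1) C(1) by (simp add: rotation_group_def reflection_group_mult det_mul)
  moreover have "?D *v fold v = fold v"
  proof -
    have "C *v fold v = v" using B(2) C(3) by (metis matrix_vector_mul_assoc matrix_vector_mul_lid)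
    then show ?thesis by (simp add: A(2) B(2) flip: matrix_vector_mul_assoc)
  qed
  moreover have "?D \<noteq> mat 1"
  proof
    assume D: "?D = mat 1"
    have "A = C ** ?D ** B" using C(3) by (metis matrix_mul_assoc matrix_mul_lid matrix_mul_rid)
    then show False using D C(3) A(3) by simp
  qed
  ultimately have "fold v = vertex2 \<or> fold v = vertex3"
    using chamber_rotation_stabilizer[OF fold(1)[OF v(1)]] by blast
  \<comment> \<open>Both corners lie on \<open>L2\<close>, where v and its folded point share a
    rotation orbit.\<close>
  then show "S \<in> {Gorbit rotation_group vertex2, Gorbit rotation_group vertex3}"
    using Gorbit_fold_side[OF v(1), of L2] ht_vertex2(2) ht_vertex3(2) v(2) by auto
next
  fix S assume "S \<in> {Gorbit rotation_group vertex2, Gorbit rotation_group vertex3}"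
  moreover have "stabilizer rotation_group vertex2 \<noteq> {mat 1}" "stabilizer rotation_group vertex3 \<noteq> {mat 1}"
    using card_stabilizer_vertex2 card_stabilizer_vertex3 by auto
  ultimately show "S \<in> cone_points rotation_group"
    using vertex2_H2 vertex3_H2 by (auto simp: cone_points_def)
qed

end

section \<open>Area and the end\<close>

lemma closed_H2: "closed H2"
proof -
  have H2: "H2 = {v. mink_form v v = 1} \<inter> {v. 1 \<le> v $ 1}"
    using H2_first_gt(1) by (auto simp: H2_def)
  show ?thesis
    unfolding H2 mink_form_def
    by (intro closed_Int closed_Collect_eq closed_Collect_le continuous_intros)
qed

definition hyperboloid_point :: "real \<times> real \<Rightarrow> real ^ 3" where
  "hyperboloid_point p = vector [sqrt (1 + (fst p)\<^sup>2 + (snd p)\<^sup>2), fst p, snd p]"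

lemma hyperboloid_point_sel [simp]:
  "hyperboloid_point p $ 1 = sqrt (1 + (fst p)\<^sup>2 + (snd p)\<^sup>2)"
  "hyperboloid_point p $ 2 = fst p" "hyperboloid_point p $ 3 = snd p"
  by (simp_all add: hyperboloid_point_def)

lemma hyperboloid_point_H2: "hyperboloid_point p \<in> H2"
proof -
  have "1 + (fst p)\<^sup>2 + (snd p)\<^sup>2 > 0" by (simp add: add_pos_nonneg)
  then show ?thesis by (simp add: H2_def mink_form_def power2_eq_square)
qed

lemma H2_hyperboloid_point: "v \<in> H2 \<Longrightarrow> hyperboloid_point (v $ 2, v $ 3) = v"
proof -
  assume v: "v \<in> H2"
  then have "1 + (v $ 2)\<^sup>2 + (v $ 3)\<^sup>2 = (v $ 1)\<^sup>2" "v $ 1 > 0"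
    by (auto simp: H2_def mink_form_def power2_eq_square)
  then show ?thesis by (simp add: vec_eq_iff forall_3)
qed

lemma continuous_on_hyperboloid_point: "continuous_on UNIV hyperboloid_point"
proof -
  have "continuous_on UNIV (\<lambda>p :: real \<times> real. sqrt (1 + (fst p)\<^sup>2 + (snd p)\<^sup>2))"
    by (intro continuous_on_real_sqrt continuous_on_add continuous_on_power continuous_on_const
        continuous_on_fst continuous_on_snd continuous_on_id)
  moreover have "continuous_on UNIV (fst :: real \<times> real \<Rightarrow> real)" "continuous_on UNIV (snd :: real \<times> real \<Rightarrow> real)"
    by (rule continuous_on_fst[OF continuous_on_id] continuous_on_snd[OF continuous_on_id])+
  ultimately have "continuous_on UNIV (\<lambda>p. hyperboloid_point p $ i)" for i
    using exhaust_3[of i] by (elim disjE) simp_all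
  then have "continuous_on UNIV (\<lambda>p. \<chi> i. hyperboloid_point p $ i)"
    by (intro continuous_on_vec_lambda)
  then show ?thesis by simp
qed

lemma connected_H2_lower: "connected {v \<in> H2. v $ 2 < 0}"
proof -
  have "{v \<in> H2. v $ 2 < 0} = hyperboloid_point ` ({..<0} \<times> UNIV)"
  proof (intro equalityI subsetI)
    fix v assume v: "v \<in> {v \<in> H2. v $ 2 < 0}"
    then have "v = hyperboloid_point (v $ 2, v $ 3)" by (simp add: H2_hyperboloid_point)
    with v show "v \<in> hyperboloid_point ` ({..<0} \<times> UNIV)" by (intro image_eqI) auto
  qed (auto simp: hyperboloid_point_H2)
  moreover have "connected (({..<0} \<times> UNIV) :: (real \<times> real) set)"
    by (intro convex_connected convex_Times) auto
  moreover have "continuous_on ({..<0} \<times> UNIV) hyperboloid_point"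
    using continuous_on_hyperboloid_point continuous_on_subset by blast
  ultimately show ?thesis by (simp only: connected_continuous_image)
qed

lemma harea_rectangle:
  assumes D: "D \<in> sets borel" and pos: "0 \<le> l" "0 \<le> b" "0 \<le> r"
    and sub: "\<And>s t. - 2 * l < s \<Longrightarrow> s < - l \<Longrightarrow> - b < t \<Longrightarrow> t < 0 \<Longrightarrow>
      hyperboloid_point (s, t) \<in> D \<and> r \<le> 1 / sqrt (1 + s\<^sup>2 + t\<^sup>2)"
  shows "ennreal (r * (l * b)) \<le> harea D"
proof -
  let ?R = "{- 2 * l <..< - l} \<times> {- b <..< 0}"
  have "emeasure (lborel :: (real \<times> real) measure) ?R
      = emeasure lborel {- 2 * l <..< - l} * emeasure lborel {- b <..< 0}"
    unfolding lborel_prod[symmetric] by (rule lborel.emeasure_pair_measure_Times) auto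
  also have "\<dots> = ennreal (l * b)" using pos by (simp add: ennreal_mult)
  finally have "ennreal (r * (l * b)) = ennreal r * emeasure lborel ?R"
    using pos by (simp add: ennreal_mult)
  also have "\<dots> = (\<integral>\<^sup>+ p. ennreal r * indicator ?R p \<partial>lborel)"
    by (rule nn_integral_cmult_indicator[symmetric]) (simp add: borel_open open_Times)
  also have "\<dots> \<le> harea D"
    unfolding harea_def
  proof (intro nn_integral_mono)
    fix p :: "real \<times> real"
    obtain s t where p: "p = (s, t)" by (cases p)
    show "ennreal r * indicator ?R p \<le> (case p of (s, t) \<Rightarrow>
      indicator D (vector [sqrt (1 + s\<^sup>2 + t\<^sup>2), s, t] :: real ^ 3)
        * ennreal (1 / sqrt (1 + s\<^sup>2 + t\<^sup>2)))"
      using sub[of s t] by (auto simp: p hyperboloid_point_def indicator_def intro: ennreal_leI)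
  qed
  finally show ?thesis .
qed

lemma connected_clopen_component:
  assumes "connectedin X E" "openin X E" "closedin X E" "E \<noteq> {}"
  shows "E \<in> connected_components_of X"
proof -
  obtain a where a: "a \<in> E" using assms(4) by blast
  then have aX: "a \<in> topspace X" using openin_subset[OF assms(2)] by blast
  have "connectedin X (connected_component_of_set X a)" by (rule connectedin_connected_component_of)
  from connectedin_clopen_cases[OF this assms(3,2)]
  have "connected_component_of_set X a \<subseteq> E \<or> disjnt (connected_component_of_set X a) E" .
  moreover have "a \<in> connected_component_of_set X a" using aX by (simp add: connected_component_of_refl)
  ultimately have "connected_component_of_set X a \<subseteq> E" using a by (auto simp: disjnt_def)
  moreover have "E \<subseteq> connected_component_of_set X a" by (rule connected_component_of_maximal[OF assms(1) a])
  ultimately show ?thesis using aX by (auto simp: connected_components_of_def)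
qed

context triangle
begin

lemma orbifold_area_rotation_group: "orbifold_area rotation_group = \<infinity>"
proof -
  have eq: "open_chamber = H2 \<inter> {v. \<forall>s. ht s v > 0}" by (auto simp: open_chamber_def)
  have borel: "open_chamber \<in> sets borel"
    unfolding eq by (intro sets.Int borel_closed borel_open closed_H2 open_ht)
  have inj: "inj_on (Gorbit rotation_group) open_chamber"
  proof (rule inj_onI)
    fix u v assume uv: "u \<in> open_chamber" "v \<in> open_chamber"
      "Gorbit rotation_group u = Gorbit rotation_group v"
    then have "fold v = fold u"
      using fold_Gorbit[of u v] Gorbit_self[of v] by (simp add: open_chamber_def)
    then show "u = v" using uv open_chamber_subset fold_chamber by (metis subset_iff)
  qed
  have large: "ennreal (y / x * real n / 4) \<le> harea open_chamber" if n: "n \<ge> 1" for n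
  proof -
    let ?n = "real n"
    have yx: "0 < y / x" "y / x < 1" using x y(1) y_less_x by simp_all
    \<comment> \<open>For s < -n the first coordinate exceeds n, so t may range down to -(y/x) n
      without crossing \<open>L3\<close>. There 1 + s^2 + t^2 is at most 16 n^2, so the area bound
      grows linearly in n.\<close>
    have "ennreal (1 / (4 * ?n) * (?n * (y / x * ?n))) \<le> harea open_chamber"
    proof (rule harea_rectangle[OF borel])
      fix s t assume st: "- 2 * ?n < s" "s < - ?n" "- (y / x * ?n) < t" "t < 0"
      let ?v = "hyperboloid_point (s, t)"
      have v: "?v \<in> H2" by (rule hyperboloid_point_H2)
      have "\<bar>?v $ 2\<bar> < ?v $ 1" using H2_first_gt(2)[OF v] .
      then have v1: "?v $ 1 > ?n" using st(2) by simp
      have "ht L1 ?v > 0" using st by (simp add: ht_eq)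
      moreover have "ht L2 ?v > 0"
      proof -
        have "?v $ 1 > 0" using v by (simp add: H2_def)
        with \<kappa>_pos have "\<kappa> * ?v $ 1 > 0" by (rule mult_pos_pos)
        moreover have "\<alpha> * ?v $ 2 < 0" using st n \<alpha>(1) by (simp add: mult_pos_neg)
        ultimately show ?thesis unfolding ht_eq by linarith
      qed
      moreover have "ht L3 ?v > 0"
      proof -
        have "y * ?v $ 1 > y * ?n" using v1 y(1) by (rule mult_strict_left_mono)
        moreover have "x * t > - (y * ?n)" using st(3) x by (simp add: field_simps)
        ultimately show ?thesis unfolding ht_eq by simp
      qed
      ultimately have "ht s' ?v > 0" for s' by (cases s') auto
      then have 1: "?v \<in> open_chamber" using v by (simp add: open_chamber_def)
      have "\<bar>s\<bar> \<le> \<bar>2 * ?n\<bar>" using st by simp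
      then have "s\<^sup>2 \<le> (2 * ?n)\<^sup>2" by (simp only: abs_le_square_iff)
      moreover have "t\<^sup>2 \<le> ?n\<^sup>2"
      proof -
        have "y / x * ?n \<le> 1 * ?n" using yx by (intro mult_right_mono) auto
        then have "\<bar>t\<bar> \<le> \<bar>?n\<bar>" using st by simp
        then show ?thesis by (simp only: abs_le_square_iff)
      qed
      moreover have "1 \<le> ?n\<^sup>2" using n by simp
      ultimately have "1 + s\<^sup>2 + t\<^sup>2 \<le> (4 * ?n)\<^sup>2" by (simp add: power_mult_distrib)
      then have "sqrt (1 + s\<^sup>2 + t\<^sup>2) \<le> 4 * ?n" by (rule real_le_lsqrt[rotated 2, rotated]) (simp_all)
      moreover have "sqrt (1 + s\<^sup>2 + t\<^sup>2) > 0" by (simp add: add_pos_nonneg)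
      ultimately have "1 / (4 * ?n) \<le> 1 / sqrt (1 + s\<^sup>2 + t\<^sup>2)" 
        using n by (intro divide_left_mono mult_pos_pos) auto
      with 1 show "?v \<in> open_chamber \<and> 1 / (4 * ?n) \<le> 1 / sqrt (1 + s\<^sup>2 + t\<^sup>2)" by blast
    qed (use x y(1) in auto)
    also have "1 / (4 * ?n) * (?n * (y / x * ?n)) = y / x * ?n / 4" using n by simp
    finally show ?thesis .
  qed
  have "harea open_chamber = \<infinity>"
  proof (rule ccontr)
    assume "harea open_chamber \<noteq> \<infinity>"
    then obtain r where r: "0 \<le> r" "harea open_chamber = ennreal r"
      by (cases "harea open_chamber") auto
    have "y / x / 4 > 0" using x y(1) by simp
    then obtain n where n: "r < real n * (y / x / 4)" using reals_Archimedean3 by blast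
    then have "n \<ge> 1" using r by (cases n) auto
    from large[OF this] r have "y / x * real n / 4 \<le> r" by simp
    with n show False by (simp add: mult.commute)
  qed
  moreover have "harea open_chamber \<le> orbifold_area rotation_group"
    unfolding orbifold_area_def
    by (rule SUP_upper) (use borel inj in \<open>auto simp: open_chamber_def\<close>)
  ultimately show ?thesis by (simp add: top_unique)
qed

text \<open>Below the axis \<open>v $ 2 = 0\<close> only the sides \<open>L1\<close> and \<open>L3\<close> are crossed, which are perpendicular
  to it.\<close>

lemma fold_below_axis:
  assumes "v \<in> H2" "v $ 2 \<le> 0"
  shows "fold v $ 2 = v $ 2"
proof -
  have "w $ 2 = v $ 2" if "steps n v w" "v \<in> H2" "v $ 2 \<le> 0" for n v w
    using that
  proof induction
    case (steps_Suc s v n w)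
    have "\<kappa> * v $ 1 > 0" using steps_Suc.prems \<kappa>_pos by (simp add: H2_def)
    moreover have "\<alpha> * v $ 2 \<le> 0" using steps_Suc.prems \<alpha>(1) by (simp add: mult_nonneg_nonpos)
    ultimately have "s \<noteq> L2" using steps_Suc.hyps(1) by (auto simp: ht_eq)
    then have "(refl s *v v) $ 2 = v $ 2" by (cases s) (auto simp: refl_apply normal_def)
    then show ?case using steps_Suc refl_H2 by simp
  qed simp
  then show ?thesis using fold(2)[OF assms(1)] assms by blast
qed

lemma refl_L1_components: "(refl L1 *v v) $ 1 = v $ 1" "(refl L1 *v v) $ 2 = v $ 2" "(refl L1 *v v) $ 3 = - v $ 3"
  by (simp_all add: refl_apply normal_def ht_eq)

text \<open>The predicate P treats the end (negative second coordinate) and the geodesic (zero)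
  together. Folding preserves this coordinate below the axis, and \<open>refl L1\<close> preserves
  it everywhere.\<close>

lemma Gorbit_below_axis_iff:
  assumes "v \<in> H2" and P: "\<And>a. P a \<Longrightarrow> a \<le> 0"
  shows "Gorbit rotation_group v \<in> Gorbit rotation_group ` {u \<in> H2. P (u $ 2)} \<longleftrightarrow> P (fold v $ 2)"
proof
  assume "Gorbit rotation_group v \<in> Gorbit rotation_group ` {u \<in> H2. P (u $ 2)}"
  then obtain u where u: "u \<in> H2" "P (u $ 2)" "Gorbit rotation_group v = Gorbit rotation_group u" by blast
  then have "fold v = fold u" using fold_Gorbit[OF u(1), of v] Gorbit_self[of v] by simp
  then show "P (fold v $ 2)" using fold_below_axis[OF u(1)] u(2) P by simp
next
  assume *: "P (fold v $ 2)"
  have "fold v \<in> H2" using fold(1)[OF assms(1)] chamber_H2 by blast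
  then have "fold v \<in> {u \<in> H2. P (u $ 2)}" "refl L1 *v fold v \<in> {u \<in> H2. P (u $ 2)}"
    using * refl_H2 by (auto simp: refl_L1_components)
  then show "Gorbit rotation_group v \<in> Gorbit rotation_group ` {u \<in> H2. P (u $ 2)}"
    using Gorbit_fold_cases[OF assms(1)] by blast
qed

lemma openin_orbit_space_fold:
  assumes "open U"
  shows "openin (orbit_space rotation_group) {Gorbit rotation_group v | v. v \<in> H2 \<and> fold v $ 2 \<in> U}"
proof -
  have "continuous_on H2 (\<lambda>v. fold v $ 2)"
    by (intro continuous_on_component continuous_on_fold)
  then have "openin (top_of_set H2) {v \<in> H2. fold v $ 2 \<in> U}"
    using continuous_openin_preimage_gen[OF _ assms] by (simp add: vimage_def Int_def)
  moreover have "{v \<in> H2. Gorbit rotation_group v \<in> {Gorbit rotation_group v | v. v \<in> H2 \<and> fold v $ 2 \<in> U}}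
      = {v \<in> H2. fold v $ 2 \<in> U}"
    using fold_Gorbit Gorbit_self by auto
  ultimately show ?thesis by (auto simp: openin_orbit_space)
qed

text \<open>The part of the triangle on or above the axis, together with its mirror image in
  \<open>L1\<close>; its orbits make up the complement of the end.\<close>

definition core :: "(real ^ 3) set" where
  "core = {v \<in> H2. 0 \<le> v $ 2 \<and> 0 \<le> ht L2 v \<and> x * v $ 3 \<le> y * v $ 1 \<and> - (x * v $ 3) \<le> y * v $ 1}"

text \<open>In the Klein model \<open>core\<close> lies in a rectangle whose corners are inside the
  unit disk by \<open>slope_bound_c\<close>; the margin e bounds the first coordinate.\<close>

lemma compact_core: "compact core"
proof -
  have "core = H2 \<inter> {v. 0 \<le> v $ 2} \<inter> {v. 0 \<le> ht L2 v} \<inter> {v. x * v $ 3 \<le> y * v $ 1} \<inter> {v. - (x * v $ 3) \<le> y * v $ 1}"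
    by (auto simp: core_def)
  moreover have "closed \<dots>"
    unfolding ht_def mink_form_def
    by (intro closed_Int closed_H2 closed_Collect_le continuous_intros)
  ultimately have "closed core" by simp
  moreover have "bounded core"
  proof -
    define e where "e = 1 - (\<kappa> / \<alpha>)\<^sup>2 - (y / x)\<^sup>2"
    have e: "e > 0" using slope_bound_c by (simp add: e_def)
    have "norm v \<le> 3 / sqrt e" if "v \<in> core" for v
    proof -
      have v: "v \<in> H2" "0 \<le> v $ 2" "\<alpha> * v $ 2 \<le> \<kappa> * v $ 1" "\<bar>x * v $ 3\<bar> \<le> y * v $ 1"
        using that by (auto simp: core_def ht_eq)
      have v1: "v $ 1 > 0" "(v $ 1)\<^sup>2 = 1 + (v $ 2)\<^sup>2 + (v $ 3)\<^sup>2"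
        using v(1) by (auto simp: H2_def mink_form_def power2_eq_square)
      have "v $ 2 \<le> \<kappa> / \<alpha> * v $ 1" using v(3) \<alpha>(1) by (simp add: field_simps)
      then have "(v $ 2)\<^sup>2 \<le> (\<kappa> / \<alpha> * v $ 1)\<^sup>2" using v(2) by (intro power_mono)
      moreover have "\<bar>v $ 3\<bar> \<le> y / x * v $ 1" using v(4) x by (simp add: abs_mult field_simps)
      then have "\<bar>v $ 3\<bar>\<^sup>2 \<le> (y / x * v $ 1)\<^sup>2" by (intro power_mono) auto
      ultimately have "(v $ 1)\<^sup>2 \<le> 1 + (\<kappa> / \<alpha>)\<^sup>2 * (v $ 1)\<^sup>2 + (y / x)\<^sup>2 * (v $ 1)\<^sup>2"
        unfolding v1(2)[symmetric] power_mult_distrib using v1(2) by simp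
      then have "e * (v $ 1)\<^sup>2 \<le> 1" by (simp add: e_def left_diff_distrib)
      then have "(v $ 1)\<^sup>2 \<le> (1 / sqrt e)\<^sup>2" using e by (simp add: power_divide field_simps)
      then have "v $ 1 \<le> 1 / sqrt e" using e power2_le_imp_le[of "v $ 1" "1 / sqrt e"] by simp
      moreover have "norm v \<le> (\<Sum>i\<in>UNIV. \<bar>v $ i\<bar>)" by (rule norm_le_l1_cart)
      ultimately show ?thesis using H2_first_gt[OF v(1)] by (simp add: sum_3)
    qed
    then show ?thesis unfolding bounded_iff by blast
  qed
  ultimately show ?thesis by (simp add: compact_eq_bounded_closed)
qed

lemma chamber_core: "p \<in> chamber \<Longrightarrow> 0 \<le> p $ 2 \<Longrightarrow> p \<in> core \<and> refl L1 *v p \<in> core"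
proof -
  assume p: "p \<in> chamber" "0 \<le> p $ 2"
  have ht: "ht s p \<ge> 0" for s using p(1) by (simp add: chamber_def)
  have pH: "p \<in> H2" using chamber_H2 p by blast
  have "p $ 3 \<le> 0" "0 \<le> y * p $ 1 + x * p $ 3" using ht[of L1] ht[of L3] by (simp_all add: ht_eq)
  moreover from this(1) have "x * p $ 3 \<le> 0" using x by (simp add: mult_nonneg_nonpos)
  moreover have "y * p $ 1 \<ge> 0" using pH y by (simp add: H2_def)
  ultimately show ?thesis
    using pH ht[of L2] p(2) refl_H2[OF pH, of L1] by (simp add: core_def ht_refl refl_L1_components)
qed

lemma fold_core: "v \<in> core \<Longrightarrow> fold v $ 2 = v $ 2"
proof -
  assume v: "v \<in> core"
  then have vH: "v \<in> H2" by (simp add: core_def)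
  show ?thesis
  proof (cases "v $ 3 \<le> 0")
    case True
    then have "v \<in> chamber" using v by (intro chamberI) (auto simp: core_def ht_eq)
    then show ?thesis by (simp add: fold_chamber)
  next
    case False
    then have "refl L1 *v v \<in> chamber"
      using v refl_H2[OF vH, of L1] by (intro chamberI) (auto simp: core_def ht_eq refl_L1_components)
    then have "fold v = refl L1 *v v" using fold_refl[OF vH, of L1] fold_chamber by simp
    then show ?thesis by (simp add: refl_L1_components)
  qed
qed

lemma Gorbit_core:
  "Gorbit rotation_group ` core = Gorbit rotation_group ` H2 - Gorbit rotation_group ` {u \<in> H2. u $ 2 < 0}"
proof (intro equalityI subsetI)
  fix S assume "S \<in> Gorbit rotation_group ` core"
  then obtain v where v: "v \<in> core" "S = Gorbit rotation_group v" by blast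
  then have "v \<in> H2" "\<not> fold v $ 2 < 0" using fold_core by (auto simp: core_def)
  then show "S \<in> Gorbit rotation_group ` H2 - Gorbit rotation_group ` {u \<in> H2. u $ 2 < 0}"
    using Gorbit_below_axis_iff[of v "\<lambda>a. a < 0"] v(2) by simp
next
  fix S assume S: "S \<in> Gorbit rotation_group ` H2 - Gorbit rotation_group ` {u \<in> H2. u $ 2 < 0}"
  then obtain v where v: "v \<in> H2" "S = Gorbit rotation_group v" by blast
  then have "0 \<le> fold v $ 2" using S Gorbit_below_axis_iff[of v "\<lambda>a. a < 0"] by force
  then have "fold v \<in> core" "refl L1 *v fold v \<in> core" using chamber_core fold(1)[OF v(1)] by blast+
  then show "S \<in> Gorbit rotation_group ` core" using Gorbit_fold_cases[OF v(1)] v(2) by blast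
qed

section \<open>The common perpendicular, the closed geodesic and the end\<close>

definition end_axis :: "real \<Rightarrow> real ^ 3" where
  "end_axis h = vector [cosh h, 0, sinh h]"

lemma axis_H2: "end_axis h \<in> H2"
  using cosh_square_eq[of h] by (simp add: end_axis_def H2_def mink_form_def flip: power2_eq_square)

lemma range_axis: "range end_axis = {v \<in> H2. v $ 2 = 0}"
proof (intro equalityI subsetI)
  fix v assume v: "v \<in> {v \<in> H2. v $ 2 = 0}"
  then have *: "(v $ 1)\<^sup>2 = 1 + (v $ 3)\<^sup>2" "v $ 1 > 0" "v $ 2 = 0"
    by (auto simp: H2_def mink_form_def power2_eq_square)
  have s: "sinh (arsinh (v $ 3)) = v $ 3" by simp
  have "(cosh (arsinh (v $ 3)))\<^sup>2 = (v $ 1)\<^sup>2" unfolding cosh_square_eq s *(1) by simp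
  then have "cosh (arsinh (v $ 3)) = v $ 1" using *(2) by (simp add: power2_eq_iff_nonneg)
  with s *(3) have "v = end_axis (arsinh (v $ 3))" by (simp add: end_axis_def vec_eq_iff forall_3)
  then show "v \<in> range end_axis" by blast
qed (auto simp: axis_H2, simp add: end_axis_def)

lemma axis_inj: "end_axis s = end_axis t \<longleftrightarrow> s = t"
  by (auto simp: end_axis_def vec_eq_iff forall_3)

lemma geodesic_line_axis: "geodesic_line end_axis"
proof -
  have "hdist (end_axis s) (end_axis t) = \<bar>s - t\<bar>" for s t
  proof -
    have "mink_form (end_axis s) (end_axis t) = cosh \<bar>s - t\<bar>"
      by (simp add: mink_form_def end_axis_def cosh_diff)
    moreover have "arcosh (cosh \<bar>s - t\<bar>) = \<bar>s - t\<bar>" by (rule arcosh_cosh_real) simp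
    ultimately show ?thesis by (simp only: hdist_def)
  qed
  then show ?thesis using axis_H2 by (auto simp: geodesic_line_def)
qed

lemma refl_L1_axis: "refl L1 *v end_axis h = end_axis (- h)"
  by (simp add: vec_eq_iff forall_3 refl_L1_components) (simp add: end_axis_def)

text \<open>The second coordinate of \<open>fold v\<close> is constant on orbits and continuous; it
  is negative on E, zero on C and positive elsewhere, in particular at the cone points. So E is
  clopen off C, and it is connected as the image of a half-plane.\<close>

lemma end_component:
  defines "X \<equiv> orbit_space rotation_group"
  defines "C \<equiv> Gorbit rotation_group ` range end_axis"
  defines "E \<equiv> Gorbit rotation_group ` {v \<in> H2. v $ 2 < 0}"
  shows "E \<in> connected_components_of (subtopology X (topspace X - C))"
    and "compactin X (topspace X - E)" and "cone_points rotation_group \<inter> (C \<union> E) = {}"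
proof -
  have inE: "Gorbit rotation_group v \<in> E \<longleftrightarrow> fold v $ 2 < 0"
    and inC: "Gorbit rotation_group v \<in> C \<longleftrightarrow> fold v $ 2 = 0" if "v \<in> H2" for v
    using Gorbit_below_axis_iff[OF that, of "\<lambda>a. a < 0"] Gorbit_below_axis_iff[OF that, of "\<lambda>a. a = 0"]
    by (simp_all add: E_def C_def range_axis)
  have top: "topspace X = Gorbit rotation_group ` H2" by (simp add: X_def topspace_orbit_space)
  define Y where "Y = subtopology X (topspace X - C)"
  have E_eq: "E = {Gorbit rotation_group v | v. v \<in> H2 \<and> fold v $ 2 \<in> {..<0}}"
    using inE by (auto simp: E_def)
  have EY: "E \<subseteq> topspace X - C" using inE inC by (auto simp: E_eq top)
  have topY: "topspace Y = topspace X - C" by (auto simp: Y_def)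
  define F where "F = {Gorbit rotation_group v | v. v \<in> H2 \<and> fold v $ 2 \<in> {0<..}}"
  have "openin X E" "openin X F" unfolding E_eq F_def X_def by (intro openin_orbit_space_fold; simp)+
  moreover have FY: "F = topspace Y - E"
  proof -
    have "S \<in> F \<longleftrightarrow> S \<in> topspace X - C - E" for S
    proof
      assume "S \<in> F"
      then obtain v where "v \<in> H2" "fold v $ 2 > 0" "S = Gorbit rotation_group v" by (auto simp: F_def)
      then show "S \<in> topspace X - C - E" using inE[of v] inC[of v] by (auto simp: top)
    next
      assume S: "S \<in> topspace X - C - E"
      then obtain v where v: "v \<in> H2" "S = Gorbit rotation_group v" by (auto simp: top)
      then have "fold v $ 2 > 0" using S inE[of v] inC[of v] by auto
      then show "S \<in> F" using v by (auto simp: F_def)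
    qed
    then show ?thesis by (auto simp: topY)
  qed
  ultimately have "openin Y E" "openin Y F"
    using EY topY by (auto simp: Y_def openin_subtopology)
  then have "openin Y E" "closedin Y E"
    using FY EY topY by (auto simp: closedin_def)
  moreover have "connectedin Y E"
  proof -
    have "connectedin (top_of_set H2) {v \<in> H2. v $ 2 < 0}"
      using connected_H2_lower by (simp add: connectedin_subtopology)
    from connectedin_continuous_map_image[OF continuous_map_Gorbit this]
    show ?thesis using EY by (simp add: Y_def connectedin_subtopology E_def X_def)
  qed
  moreover have "E \<noteq> {}"
  proof -
    have "hyperboloid_point (- 1, 0) \<in> {v \<in> H2. v $ 2 < 0}" by (simp add: hyperboloid_point_H2)
    then show ?thesis unfolding E_def by blast
  qed
  ultimately show "E \<in> connected_components_of (subtopology X (topspace X - C))"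
    unfolding Y_def[symmetric] by (intro connected_clopen_component)
  have "compactin (top_of_set H2) core"
    using compact_core by (auto simp: compactin_subtopology core_def)
  from image_compactin[OF this continuous_map_Gorbit]
  show "compactin X (topspace X - E)" by (simp add: X_def topspace_orbit_space Gorbit_core E_def)
  have "vertex2 $ 2 > 0" "vertex3 $ 2 > 0"
    using \<kappa>_pos x by (simp_all add: vertex2_def vertex3_def)
  then show "cone_points rotation_group \<inter> (C \<union> E) = {}"
    using inE[OF vertex2_H2] inC[OF vertex2_H2] inE[OF vertex3_H2] inC[OF vertex3_H2]
    by (auto simp: cone_points_rotation_group fold_chamber vertex2_chamber vertex3_chamber)
qed

context
  fixes \<delta> :: real
  assumes \<delta>: "0 < \<delta>" and cosh: "x = cosh (\<delta> / 2)" and sinh: "y = sinh (\<delta> / 2)"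
begin

lemma ht_L3_axis: "ht L3 (end_axis h) = sinh (h + \<delta> / 2)"
proof -
  have "ht L3 (end_axis h) = y * cosh h + x * sinh h" by (simp add: ht_eq end_axis_def)
  also have "\<dots> = sinh (h + \<delta> / 2)" unfolding cosh sinh by (simp add: sinh_add)
  finally show ?thesis .
qed

text \<open>On the axis \<open>refl L3\<close> is the point reflection about -\<delta>/2 and
  \<open>refl L1\<close> the one about 0, so their product translates by \<delta>.\<close>

lemma refl_L3_axis: "refl L3 *v end_axis h = end_axis (- (h + \<delta>))"
proof -
  have d: "h + \<delta> = (h + \<delta> / 2) + \<delta> / 2" by simp
  have h: "cosh h = cosh (h + \<delta> / 2) * cosh (\<delta> / 2) - sinh (h + \<delta> / 2) * sinh (\<delta> / 2)"
    "sinh h = sinh (h + \<delta> / 2) * cosh (\<delta> / 2) - cosh (h + \<delta> / 2) * sinh (\<delta> / 2)"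
    using cosh_diff[of "h + \<delta> / 2" "\<delta> / 2"] sinh_diff[of "h + \<delta> / 2" "\<delta> / 2"] by simp_all
  have "cosh (h + \<delta>) = cosh h + 2 * sinh (h + \<delta> / 2) * y"
    "- sinh (h + \<delta>) = sinh h - 2 * sinh (h + \<delta> / 2) * x"
    unfolding h cosh sinh by (subst d, simp only: cosh_add sinh_add, simp)+
  moreover have "end_axis (- (h + \<delta>)) = vector [cosh (h + \<delta>), 0, - sinh (h + \<delta>)]"
    unfolding end_axis_def by (simp only: cosh_minus sinh_minus)
  ultimately show ?thesis
    by (simp add: refl_apply ht_L3_axis vec_eq_iff forall_3) (simp add: end_axis_def normal_def)
qed

lemma Gorbit_axis_shift: "Gorbit rotation_group (end_axis (h + of_int n * \<delta>)) = Gorbit rotation_group (end_axis h)"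
proof -
  have step: "Gorbit rotation_group (end_axis (h + \<delta>)) = Gorbit rotation_group (end_axis h)" for h
  proof (rule Gorbit_eqI[OF rotation_group_refl2])
    show "(refl L3 ** refl L1) *v end_axis (h + \<delta>) = end_axis h"
      by (simp add: refl_L1_axis refl_L3_axis flip: matrix_vector_mul_assoc)
  qed
  have nat: "Gorbit rotation_group (end_axis (h + real n * \<delta>)) = Gorbit rotation_group (end_axis h)" for h n
  proof (induction n)
    case (Suc n)
    have eq: "h + real (Suc n) * \<delta> = h + real n * \<delta> + \<delta>" by (simp add: algebra_simps)
    show ?case unfolding eq step by (rule Suc)
  qed simp
  show ?thesis
  proof (cases n rule: int_cases2)
    case (nonneg m)
    then show ?thesis using nat by simp
  next
    case (nonpos m)
    then show ?thesis using nat[of "h + of_int n * \<delta>" m] by simp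
  qed
qed

lemma axis_fold:
  assumes "\<bar>h\<bar> \<le> \<delta> / 2"
  shows "end_axis (- \<bar>h\<bar>) \<in> chamber" "fold (end_axis h) = end_axis (- \<bar>h\<bar>)"
proof -
  have "ht L1 (end_axis (- \<bar>h\<bar>)) \<ge> 0" "ht L2 (end_axis (- \<bar>h\<bar>)) \<ge> 0"
    using \<kappa>_pos by (simp_all add: ht_eq end_axis_def)
  moreover have "ht L3 (end_axis (- \<bar>h\<bar>)) \<ge> 0" unfolding ht_L3_axis using assms by simp
  ultimately show c: "end_axis (- \<bar>h\<bar>) \<in> chamber" by (intro chamberI axis_H2)
  have "end_axis h = end_axis (- \<bar>h\<bar>) \<or> end_axis h = refl L1 *v end_axis (- \<bar>h\<bar>)"
    unfolding refl_L1_axis by (auto simp: abs_if)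
  then show "fold (end_axis h) = end_axis (- \<bar>h\<bar>)"
    using fold_chamber[OF c] fold_refl[OF axis_H2] by metis
qed

text \<open>Folding leaves only s = -t to exclude. Then one of the two parameters is positive, hence
  less than \<delta>/2, so the folded point is interior and reached by the odd element
  \<open>refl L1\<close>. At \<delta>/2 itself the argument fails: both ends of the interval lie in
  one orbit.\<close>

lemma Gorbit_axis_inj:
  assumes s: "- (\<delta> / 2) \<le> s" "s < \<delta> / 2" and t: "- (\<delta> / 2) \<le> t" "t < \<delta> / 2"
    and eq: "Gorbit rotation_group (end_axis s) = Gorbit rotation_group (end_axis t)"
  shows "s = t"
proof (rule ccontr)
  assume ne: "s \<noteq> t"
  have "fold (end_axis s) = fold (end_axis t)"
    using fold_Gorbit[OF axis_H2, of "end_axis s" t] Gorbit_self[of "end_axis s"] eq by simp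
  then have "\<bar>s\<bar> = \<bar>t\<bar>" using axis_fold(2)[of s] axis_fold(2)[of t] s t by (simp add: axis_inj)
  with ne have st: "s = - t" "t \<noteq> 0" by (auto simp: abs_if split: if_splits)
  define r where "r = \<bar>t\<bar>"
  have r: "0 < r" "r < \<delta> / 2" using st s t by (auto simp: r_def abs_if)
  have eq': "Gorbit rotation_group (end_axis r) = Gorbit rotation_group (end_axis (- r))"
    using eq st by (auto simp: r_def abs_if)
  have "ht L1 (end_axis (- r)) > 0" "ht L2 (end_axis (- r)) > 0"
    using \<kappa>_pos r by (simp_all add: ht_eq end_axis_def)
  moreover have "ht L3 (end_axis (- r)) > 0" unfolding ht_L3_axis using r by simp
  ultimately have "ht u (end_axis (- r)) > 0" for u by (cases u) auto
  then have po: "end_axis (- r) \<in> open_chamber" by (simp add: open_chamber_def axis_H2)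
  then have f: "fold (end_axis r) = end_axis (- r) \<and> (fold (end_axis r) \<in> Gorbit rotation_group (end_axis r) \<longleftrightarrow> refl L1 \<in> rotation_group)"
    using fold_in_Gorbit_iff[OF reflection_group_refl axis_H2, of L1 r] by (simp add: refl_L1_axis)
  moreover have "fold (end_axis r) \<in> Gorbit rotation_group (end_axis r)" using f eq' Gorbit_self by metis
  ultimately have "refl L1 \<in> rotation_group" by blast
  then show False by (simp add: rotation_group_def det_refl)
qed

lemma Gorbit_axis_iff:
  "Gorbit rotation_group (end_axis s) = Gorbit rotation_group (end_axis t) \<longleftrightarrow> (\<exists>n::int. s - t = of_int n * \<delta>)"
proof
  assume eq: "Gorbit rotation_group (end_axis s) = Gorbit rotation_group (end_axis t)"
  \<comment> \<open>Rounding to a nearest integer moves u into the half-open interval of length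
    \<delta> centred at 0.\<close>
  define k where "k u = \<lfloor>u / \<delta> + 1 / 2\<rfloor>" for u
  have k: "- (\<delta> / 2) \<le> u - of_int (k u) * \<delta>" "u - of_int (k u) * \<delta> < \<delta> / 2" for u
  proof -
    have "of_int (k u) \<le> u / \<delta> + 1 / 2" "u / \<delta> + 1 / 2 < of_int (k u) + 1"
      unfolding k_def by linarith+
    then have "of_int (k u) * \<delta> \<le> (u / \<delta> + 1 / 2) * \<delta>" "(u / \<delta> + 1 / 2) * \<delta> < (of_int (k u) + 1) * \<delta>"
      using \<delta> by (simp_all add: mult_right_mono)
    then show "- (\<delta> / 2) \<le> u - of_int (k u) * \<delta>" "u - of_int (k u) * \<delta> < \<delta> / 2"
      using \<delta> by (simp_all add: algebra_simps)
  qed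
  have "Gorbit rotation_group (end_axis (u - of_int (k u) * \<delta>)) = Gorbit rotation_group (end_axis u)" for u
    using Gorbit_axis_shift[of u "- k u"] by simp
  then have "s - of_int (k s) * \<delta> = t - of_int (k t) * \<delta>"
    using eq by (intro Gorbit_axis_inj k) simp
  then have "s - t = of_int (k s - k t) * \<delta>" by (simp add: algebra_simps)
  then show "\<exists>n::int. s - t = of_int n * \<delta>" by blast
next
  assume "\<exists>n::int. s - t = of_int n * \<delta>"
  then obtain n :: int where "s = t + of_int n * \<delta>" by (auto simp: algebra_simps)
  then show "Gorbit rotation_group (end_axis s) = Gorbit rotation_group (end_axis t)"
    using Gorbit_axis_shift by simp
qed

lemma closed_geodesic_axis: "closed_geodesic_around_end rotation_group end_axis \<delta>"
  unfolding closed_geodesic_around_end_def Let_def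
  using geodesic_line_axis \<delta> Gorbit_axis_iff end_component by blast

lemma holonomy_rotation_group: "holonomy_O23 \<delta> rotation_group"
  unfolding holonomy_O23_def
  using subgroup_rho'_image[OF x] rho'_image_eq discrete_rotation_group orbit_space_homeomorphic
    orbifold_area_rotation_group cone_points_rotation_group vertex2_H2 vertex3_H2
    card_stabilizer_vertex2 card_stabilizer_vertex3 closed_geodesic_axis by metis

end

end

theorem theorem6:
  fixes x \<delta> :: real
  assumes "1 < x" and "\<delta> > 0" and "x = cosh (\<delta> / 2)"
  shows "subgroup (rho' x ` carrier trefoil_group) SO012 \<and>
    (\<exists>\<Gamma>. holonomy_O23 \<delta> \<Gamma> \<and>
      (\<exists>A \<in> carrier SO012.
        (\<lambda>B. A \<otimes>\<^bsub>SO012\<^esub> B \<otimes>\<^bsub>SO012\<^esub> inv\<^bsub>SO012\<^esub> A)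
          \<in> iso (SO012\<lparr>carrier := rho' x ` carrier trefoil_group\<rparr>) (SO012\<lparr>carrier := \<Gamma>\<rparr>)))"
proof -
  define y \<kappa> \<alpha> where "y = sinh (\<delta> / 2)" and "\<kappa> = 1 / (2 * y)" and "\<alpha> = sqrt (\<kappa> * \<kappa> + 1)"
  have y: "y > 0" using assms(2) by (simp add: y_def)
  have "y * y = x * x - 1"
    using cosh_square_eq[of "\<delta> / 2"] by (simp add: y_def assms(3) power2_eq_square)
  moreover have "\<alpha> > 0" "\<alpha> * \<alpha> = \<kappa> * \<kappa> + 1" by (simp_all add: \<alpha>_def add_nonneg_pos)
  ultimately interpret triangle x y \<kappa> \<alpha>
    using y assms(1) by unfold_locales (simp_all add: \<kappa>_def)
  let ?I = "rho' x ` carrier trefoil_group"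
  interpret SO012: group SO012 by (rule group_SO012)
  have I: "subgroup ?I SO012" by (rule subgroup_rho'_image[OF assms(1)])
  have "holonomy_O23 \<delta> ?I"
    unfolding rho'_image_eq using holonomy_rotation_group assms y_def by blast
  \<comment> \<open>No conjugation is required, so the identity is the witness.\<close>
  moreover have "(\<lambda>B. \<one>\<^bsub>SO012\<^esub> \<otimes>\<^bsub>SO012\<^esub> B \<otimes>\<^bsub>SO012\<^esub> inv\<^bsub>SO012\<^esub> \<one>\<^bsub>SO012\<^esub>)
      \<in> iso (SO012\<lparr>carrier := ?I\<rparr>) (SO012\<lparr>carrier := ?I\<rparr>)"
  proof -
    have "(\<lambda>B. \<one>\<^bsub>SO012\<^esub> \<otimes>\<^bsub>SO012\<^esub> B \<otimes>\<^bsub>SO012\<^esub> inv\<^bsub>SO012\<^esub> \<one>\<^bsub>SO012\<^esub>) = (\<lambda>B. B)"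
      unfolding SO012.inv_one by (simp add: SO012_def)
    then show ?thesis by (simp add: iso_def hom_def bij_betw_def)
  qed
  ultimately show ?thesis using I SO012.one_closed by blast
qed

end
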